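(* Let $(\mathfrak X,+,\mathcal A)$ be a measurable Abelian semigroup with zero element. Let $n\in\mathbb N$ and $\ell\in\{0,\dots,n\}$. For $j\in\{1,\dots,n\}$ let $p_j\in(0,1]$, let $Q_j$ be a probability measure on $(\mathfrak X,\mathcal A)$, and set $R_j=p_j(Q_j-\delta_0)$, $F_j=\delta_0+R_j$, $V_j=F_je^{-R_j}-\delta_0$. Set $\lambda=\sum_{j=1}^n p_j$, $F=\prod_{j=1}^n F_j$, $Q=\frac1\lambda\sum_{j=1}^n p_jQ_j$. For $j\in\{1,\dots,n\}$ let $f_j$ be a Radon-Nikod\'ym density of $Q_j$ with respect to $Q$ (which exists since $Q_j\ll Q$). For $k\in\{0,\dots,n\}$ let $$M_k=\sum_{J\subseteq\{1,\dots,n\}:\,|J|=k}\ \prod_{j\in J}V_j,\qquad H_k=M_k\exp(\lambda(Q-\delta_0)),$$ and set $G_\ell=\sum_{k=0}^\ell H_k$. Let $g(z)=2\sum_{m=2}^\infty\frac{m-1}{m!}z^{m-2}$ and $$\widetilde\alpha_1=\sum_{j=1}^n g(2p_j)\,p_j^2\int f_j\min\Bigl\{\frac{f_j}{2^{3/2}\lambda},\,2\Bigr\}\,dQ,\qquad \widetilde\beta_1=\sum_{j=1}^n p_j^2\int f_j\min\Bigl\{\frac{f_j}{\lambda},\,1\Bigr\}\,dQ.$$ If $\widetilde\alpha_1<\frac1{2^{3/2}}$, then $$\|F-G_\ell\|\le\frac{\sqrt{(2(\ell+1))!}}{(\ell+1)!}\,2^{(\ell+1)/2}\,\frac{\widetilde\alpha_1^{\,\ell+1}}{1-2^{3/2}\widetilde\alpha_1}.$$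 Moreover, the following bound is generally valid: $$\|F-G_\ell\|\le c_\ell\,\widetilde\beta_1^{\,\ell+1},$$ where $c_\ell$ is the constant defined in the context (depending only on $\ell$).
   Context: A measurable Abelian semigroup with zero element $(\mathfrak X,+,\mathcal A)$ is a commutative semigroup $(\mathfrak X,+)$ with identity element $0$ and a $\sigma$-algebra $\mathcal A$ on $\mathfrak X$ such that $(x,y)\mapsto x+y$ is measurable from $(\mathfrak X\times\mathfrak X,\mathcal A\otimes\mathcal A)$ to $(\mathfrak X,\mathcal A)$. $\delta_x$ is the Dirac measure at $x\in\mathfrak X$. Products and powers of finite signed measures on $(\mathfrak X,\mathcal A)$ are convolutions, $VW(A)=\int_{\mathfrak X}V(\{y\in\mathfrak X: x+y\in A\})\,dW(x)$, with empty products and zeroth powers equal to $\delta_0$; $e^V=\exp(V)=\sum_{m=0}^\infty V^m/m!$. $\|V\|=V^+(\mathfrak X)+V^-(\mathfrak X)$ is the total variation norm, where $V=V^+-V^-$ is the Hahn-Jordan decomposition. $|J|$ is the cardinality of a finite set $J$; empty sums are $0$. The function $g$ satisfies $g(z)=\frac{2e^z}{z^2}(e^{-z}-1+z)$ for $z\neq0$, $g(0)=1$. Definition of $c_\ell$: Let $D_2=10.784$, $D_3=21.721$, $D_4=40.687$, $D_5=74.672$, $D_6=125.448$, $D_7=186.872$, $D_8=253.020$, $D_9=305.314$, and $D_k=\frac{\sqrt{(2k)!}}{k!}$ for $k\ge10$. Set $D_1'=3.11$ and $D_k'=D_k\bigl(\frac{g(2)}2\bigr)^k$ for $k\ge2$.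 For $x\in[0,\infty)$ let $h_1(x)=\sum_{k=\ell+1}^\infty D_k'x^k\in[0,\infty]$ and $h_2(x)=2+\sum_{k=1}^\ell D_k'x^k$. Let $x_\ell\in(0,\infty)$ be the unique positive solution of $h_1(x_\ell)=h_2(x_\ell)$ and $c_\ell=\frac{h_2(x_\ell)}{x_\ell^{\ell+1}}$. *)

theory Defs
  imports "HOL-Probability.Probability"
begin

section \<open>Finite signed measures and convolution\<close>

text \<open>
  As usual, only the sigma-algebra of the \<^typ>\<open>'a measure\<close> \<open>M\<close> matters below.
  The semigroup is the whole type \<open>'a\<close>, so that the underlying set must be \<open>UNIV\<close>.
\<close>

locale measurable_abelian_semigroup =
  fixes M :: "'a::comm_monoid_add measure"
  assumes space_eq_UNIV: "space M = UNIV"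
    and measurable_plus: "(\<lambda>(x, y). x + y) \<in> M \<Otimes>\<^sub>M M \<rightarrow>\<^sub>M M"

text \<open>
  A finite signed measure on \<open>M\<close> is represented by its set function \<open>V :: 'a set \<Rightarrow> real\<close>,
  with value \<open>0\<close> outside \<open>sets M\<close>. This convention agrees with \<^const>\<open>measure\<close>,
  so that a finite measure \<open>N\<close> on \<open>sets M\<close> is the signed measure \<open>measure N\<close>. Sums, differences
  and scalar multiples are taken setwise.
\<close>

definition is_Hahn_set :: "'a measure \<Rightarrow> ('a set \<Rightarrow> real) \<Rightarrow> 'a set \<Rightarrow> bool" where
  "is_Hahn_set M V P \<longleftrightarrow> P \<in> sets M \<and>
     (\<forall>A\<in>sets M. A \<subseteq> P \<longrightarrow> 0 \<le> V A) \<and>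
     (\<forall>A\<in>sets M. A \<subseteq> space M - P \<longrightarrow> V A \<le> 0)"

definition Hahn_set :: "'a measure \<Rightarrow> ('a set \<Rightarrow> real) \<Rightarrow> 'a set" where
  "Hahn_set M V = (SOME P. is_Hahn_set M V P)"

definition pos_part :: "'a measure \<Rightarrow> ('a set \<Rightarrow> real) \<Rightarrow> 'a measure" where
  "pos_part M V = measure_of (space M) (sets M) (\<lambda>A. ennreal (V (A \<inter> Hahn_set M V)))"

definition neg_part :: "'a measure \<Rightarrow> ('a set \<Rightarrow> real) \<Rightarrow> 'a measure" where
  "neg_part M V = measure_of (space M) (sets M) (\<lambda>A. ennreal (- V (A - Hahn_set M V)))"

definition tv_norm :: "'a measure \<Rightarrow> ('a set \<Rightarrow> real) \<Rightarrow> real" where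
  "tv_norm M V = measure (pos_part M V) (space M) + measure (neg_part M V) (space M)"

definition signed_integral :: "'a measure \<Rightarrow> ('a set \<Rightarrow> real) \<Rightarrow> ('a \<Rightarrow> real) \<Rightarrow> real" where
  "signed_integral M W h = (\<integral>x. h x \<partial>pos_part M W) - (\<integral>x. h x \<partial>neg_part M W)"

definition dirac :: "'a measure \<Rightarrow> 'a \<Rightarrow> 'a set \<Rightarrow> real" where
  "dirac M x = measure (return M x)"

definition conv :: "'a::comm_monoid_add measure \<Rightarrow> ('a set \<Rightarrow> real) \<Rightarrow> ('a set \<Rightarrow> real) \<Rightarrow> 'a set \<Rightarrow> real"
  where
  "conv M V W A =
     (if A \<in> sets M then signed_integral M W (\<lambda>x. V {y \<in> space M. x + y \<in> A}) else 0)"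

primrec conv_power :: "'a::comm_monoid_add measure \<Rightarrow> ('a set \<Rightarrow> real) \<Rightarrow> nat \<Rightarrow> 'a set \<Rightarrow> real"
  where
  "conv_power M V 0 = dirac M 0"
| "conv_power M V (Suc m) = conv M V (conv_power M V m)"

text \<open>
  Convolution of finite signed measures is commutative and associative; the increasing order
  in which the factors are multiplied is therefore immaterial.
\<close>

definition conv_prod ::
    "'a::comm_monoid_add measure \<Rightarrow> (nat \<Rightarrow> 'a set \<Rightarrow> real) \<Rightarrow> nat set \<Rightarrow> 'a set \<Rightarrow> real" where
  "conv_prod M V J = foldr (\<lambda>j. conv M (V j)) (sorted_list_of_set J) (dirac M 0)"

text \<open>
  The exponential series converges in total variation, in particular on every set.
\<close>

definition conv_exp :: "'a::comm_monoid_add measure \<Rightarrow> ('a set \<Rightarrow> real) \<Rightarrow> 'a set \<Rightarrow> real" where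
  "conv_exp M V A = (\<Sum>m. conv_power M V m A / fact m)"

definition mixture :: "'a measure \<Rightarrow> nat set \<Rightarrow> (nat \<Rightarrow> real) \<Rightarrow> (nat \<Rightarrow> 'a measure) \<Rightarrow> 'a measure"
  where
  "mixture M J p Q = measure_of (space M) (sets M)
     (\<lambda>A. ennreal (1 / (\<Sum>j\<in>J. p j) * (\<Sum>j\<in>J. p j * measure (Q j) A)))"

section \<open>The function \<open>g\<close> and the constants \<open>c\<^sub>\<ell>\<close>\<close>

text \<open>The summation index is \<open>m + 2\<close>.\<close>

definition g :: "real \<Rightarrow> real" where
  "g z = 2 * (\<Sum>m. (real (m + 2) - 1) / fact (m + 2) * z ^ m)"

text \<open>Only \<open>D k\<close> for \<open>k \<ge> 2\<close> and \<open>D' k\<close> for \<open>k \<ge> 1\<close> are used.\<close>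

definition D :: "nat \<Rightarrow> real" where
  "D k =
    (if k = 2 then 10.784
     else if k = 3 then 21.721
     else if k = 4 then 40.687
     else if k = 5 then 74.672
     else if k = 6 then 125.448
     else if k = 7 then 186.872
     else if k = 8 then 253.020
     else if k = 9 then 305.314
     else sqrt (fact (2 * k)) / fact k)"

definition D' :: "nat \<Rightarrow> real" where
  "D' k = (if k = 1 then 3.11 else D k * (g 2 / 2) ^ k)"

definition h1 :: "nat \<Rightarrow> real \<Rightarrow> ennreal" where
  "h1 l x = (\<Sum>i. ennreal (D' (l + 1 + i) * x ^ (l + 1 + i)))"

definition h2 :: "nat \<Rightarrow> real \<Rightarrow> real" where
  "h2 l x = 2 + (\<Sum>k = 1..l. D' k * x ^ k)"

definition x_sol :: "nat \<Rightarrow> real" where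
  "x_sol l = (THE x. x > 0 \<and> h1 l x = ennreal (h2 l x))"

definition c_const :: "nat \<Rightarrow> real" where
  "c_const l = h2 l (x_sol l) / x_sol l ^ (l + 1)"

section \<open>Consistency of the definitions\<close>

lemma is_Hahn_set_Hahn_set:
  assumes "finite_measure N1" "finite_measure N2" "sets N1 = sets M" "sets N2 = sets M"
  shows "is_Hahn_set M (\<lambda>A. measure N1 A - measure N2 A)
           (Hahn_set M (\<lambda>A. measure N1 A - measure N2 A))"
proof -
  interpret N1: finite_measure N1 by fact
  interpret N2: finite_measure N2 by fact
  obtain Y where Y: "Y \<in> sets M"
    and 1: "\<And>X. X \<in> sets M \<Longrightarrow> X \<subseteq> Y \<Longrightarrow> emeasure N2 X \<le> emeasure N1 X"
    and 2: "\<And>X. X \<in> sets M \<Longrightarrow> X \<inter> Y = {} \<Longrightarrow> emeasure N1 X \<le> emeasure N2 X"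
    using finite_unsigned_Hahn_decomposition[of N1 N2] assms by auto
  have "is_Hahn_set M (\<lambda>A. measure N1 A - measure N2 A) Y"
    unfolding is_Hahn_set_def
  proof (intro conjI ballI impI)
    fix A assume A: "A \<in> sets M" "A \<subseteq> Y"
    show "0 \<le> measure N1 A - measure N2 A"
      using 1[OF A] by (simp add: N1.emeasure_eq_measure N2.emeasure_eq_measure)
  next
    fix A assume A: "A \<in> sets M" "A \<subseteq> space M - Y"
    then have "A \<inter> Y = {}" by auto
    from 2[OF A(1) this] show "measure N1 A - measure N2 A \<le> 0"
      by (simp add: N1.emeasure_eq_measure N2.emeasure_eq_measure)
  qed (fact Y)
  then show ?thesis
    unfolding Hahn_set_def by (rule someI)
qed

lemma emeasure_mixture:
  assumes "finite J" "\<And>j. j \<in> J \<Longrightarrow> 0 \<le> p j"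
    "\<And>j. j \<in> J \<Longrightarrow> finite_measure (Q j)" "\<And>j. j \<in> J \<Longrightarrow> sets (Q j) = sets M"
    and A: "A \<in> sets M"
  shows "emeasure (mixture M J p Q) A =
           ennreal (1 / (\<Sum>j\<in>J. p j) * (\<Sum>j\<in>J. p j * measure (Q j) A))"
  unfolding mixture_def
proof (rule emeasure_measure_of_sigma[OF sets.sigma_algebra_axioms _ _ A])
  let ?\<mu> = "\<lambda>A. ennreal (1 / (\<Sum>j\<in>J. p j) * (\<Sum>j\<in>J. p j * measure (Q j) A))"
  show "positive (sets M) ?\<mu>"
    by (simp add: positive_def)
  show "countably_additive (sets M) ?\<mu>"
  proof (rule countably_additiveI)
    fix B :: "nat \<Rightarrow> 'a set"
    assume B: "range B \<subseteq> sets M" "disjoint_family B"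
    have "(\<lambda>i. measure (Q j) (B i)) sums measure (Q j) (\<Union>i. B i)" if "j \<in> J" for j
      using that B assms(3,4)[OF that] by (intro finite_measure.finite_measure_UNION) auto
    then have "(\<lambda>i. 1 / (\<Sum>j\<in>J. p j) * (\<Sum>j\<in>J. p j * measure (Q j) (B i))) sums
        (1 / (\<Sum>j\<in>J. p j) * (\<Sum>j\<in>J. p j * measure (Q j) (\<Union>i. B i)))"
      by (intro sums_mult sums_sum) auto
    moreover have "0 \<le> 1 / (\<Sum>j\<in>J. p j) * (\<Sum>j\<in>J. p j * measure (Q j) A)" for A
      using assms(2) by (intro mult_nonneg_nonneg divide_nonneg_nonneg sum_nonneg) auto
    ultimately show "(\<Sum>i. ?\<mu> (B i)) = ?\<mu> (\<Union>i. B i)"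
      by (intro suminf_ennreal_eq) auto
  qed
qed

end

theory Submission
  imports Defs
begin

text \<open>
  Write \<open>R\<^sub>j = S\<^sub>j + T\<^sub>j\<close>, where \<open>S\<^sub>j\<close> comes from the part of the density \<open>f\<^sub>j\<close> below a truncation
  level and \<open>T\<^sub>j\<close> from the remaining mass. Since \<open>V\<^sub>j = R\<^sub>j\<^sup>2 w\<^sub>j\<close> with a power series \<open>w\<^sub>j\<close> in \<open>R\<^sub>j\<close>, the
  terms \<open>H\<^sub>k\<close> of \<open>F = \<Sum>\<^sub>k H\<^sub>k\<close> are expanded by \<open>R\<^sub>j\<^sup>2 = S\<^sub>j\<^sup>2 + T\<^sub>j (2 S\<^sub>j + T\<^sub>j)\<close>: factors containing
  \<open>T\<^sub>j\<close> are bounded in total variation, while the product of \<open>m\<close> factors \<open>S\<^sub>j\<close> with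
  \<open>exp (\<lambda>(Q - \<delta>\<^sub>0))\<close> has norm at most \<open>\<surd>m!\<close> times the \<open>L\<^sup>2\<close> norms of their densities, divided by
  \<open>\<lambda>\<^sup>m\<^sup>/\<^sup>2\<close>. The latter follows from an orthogonality argument for the approximation of the
  exponential by the \<open>N\<close>-fold power of \<open>\<delta>\<^sub>0 + (\<lambda>/N)(Q - \<delta>\<^sub>0)\<close>, in which the \<open>m\<close> centred factors
  occupy distinct, independent slots. For the second bound one half of \<open>exp (- R\<^sub>j)\<close> is absorbed into
  \<open>exp (\<lambda>(Q - \<delta>\<^sub>0))\<close> first, which keeps half of the smoothing and improves the constants.
\<close>

section \<open>Finite signed measures and their convolution\<close>

text \<open>Each \<open>V j\<close> vanishes to second order in \<open>R j\<close>. It therefore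
  brings two centred factors, and smoothing is worth a factor of order 1/sqrt(lambda) for each of
  them. Where the density f of \<open>Q j\<close> is large, the smoothing cost f^2/lambda exceeds a
  total variation cost of the form const * f. Up to constants, the minimum in
  \<open>\<alpha>1\<close> and \<open>\<beta>1\<close> records the cheaper of the two, and the
  truncation levels 2^(5/2) lambda and lambda are the points where its arguments meet. The factor
  sqrt(m!) is the price of Cauchy-Schwarz: different slots are orthogonal, but different centred
  factors in the same slot are not. The first bound sums a geometric series, whence the smallness
  condition. The second has none, because for large \<open>\<beta>1\<close> the head of the
  expansion is estimated together with the trivial norms of \<open>F\<close> and of the Poisson
  term; \<open>x_sol l\<close> balances the two alternatives. Power series, exponentials and norms
  are handled in a Banach algebra, and the set functions of the statement are identified with
  components of its elements only at the end.\<close>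

text \<open>Encoded as a difference of two finite measures, so that integrals, linear combinations
  and convolutions reduce to those of measures.\<close>

definition signed_measure :: "'a measure \<Rightarrow> ('a set \<Rightarrow> real) \<Rightarrow> bool" where
  "signed_measure M V \<longleftrightarrow> (\<exists>N1 N2. finite_measure N1 \<and> finite_measure N2 \<and>
     sets N1 = sets M \<and> sets N2 = sets M \<and> V = (\<lambda>A. measure N1 A - measure N2 A))"

lemma signed_measureI:
  assumes "finite_measure N1" "finite_measure N2" "sets N1 = sets M" "sets N2 = sets M"
    "V = (\<lambda>A. measure N1 A - measure N2 A)"
  shows "signed_measure M V"
  using assms unfolding signed_measure_def by blast

lemma signed_measureE:
  assumes "signed_measure M V"
  obtains N1 N2 where "finite_measure N1" "finite_measure N2" "sets N1 = sets M" "sets N2 = sets M"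
    "V = (\<lambda>A. measure N1 A - measure N2 A)"
  using assms unfolding signed_measure_def by blast

section \<open>Finite measures and integrals against their linear combinations\<close>

lemma finite_measure_of_countably_additive:
  fixes v :: "'a set \<Rightarrow> real"
  assumes nn: "\<And>A. A \<in> sets M \<Longrightarrow> 0 \<le> v A" and null: "v {} = 0"
    and ca: "\<And>B. range B \<subseteq> sets M \<Longrightarrow> disjoint_family B \<Longrightarrow> (\<lambda>i. v (B i)) sums v (\<Union>i. B i)"
  defines "N \<equiv> measure_of (space M) (sets M) (\<lambda>A. ennreal (v A))"
  shows "finite_measure N" "sets N = sets M" "\<And>A. A \<in> sets M \<Longrightarrow> measure N A = v A"
proof -
  show s: "sets N = sets M" by (simp add: N_def)
  have e: "emeasure N A = ennreal (v A)" if "A \<in> sets M" for A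
    unfolding N_def
  proof (rule emeasure_measure_of_sigma[OF sets.sigma_algebra_axioms _ _ that])
    show "positive (sets M) (\<lambda>A. ennreal (v A))" by (simp add: positive_def null)
    show "countably_additive (sets M) (\<lambda>A. ennreal (v A))"
    proof (rule countably_additiveI)
      fix B :: "nat \<Rightarrow> 'a set"
      assume B: "range B \<subseteq> sets M" "disjoint_family B"
      then show "(\<Sum>i. ennreal (v (B i))) = ennreal (v (\<Union>i. B i))"
        using ca[OF B] nn by (intro suminf_ennreal_eq) auto
    qed
  qed
  have "space N = space M" by (simp add: N_def)
  then show "finite_measure N"
    by (intro finite_measureI) (simp add: e)
  show "measure N A = v A" if "A \<in> sets M" for A
    using that by (simp add: measure_def e nn)
qed

lemma ex_finite_measure:
  fixes v :: "'a set \<Rightarrow> real"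
  assumes "\<And>A. A \<in> sets M \<Longrightarrow> 0 \<le> v A" "v {} = 0"
    "\<And>B. range B \<subseteq> sets M \<Longrightarrow> disjoint_family B \<Longrightarrow> (\<lambda>i. v (B i)) sums v (\<Union>i. B i)"
    and off: "\<And>A. A \<notin> sets M \<Longrightarrow> v A = 0"
  obtains N where "finite_measure N" "sets N = sets M" "measure N = v"
proof -
  let ?N = "measure_of (space M) (sets M) (\<lambda>A. ennreal (v A))"
  note N = finite_measure_of_countably_additive[of M v, OF assms(1-3)]
  have "measure ?N A = v A" for A
    using N(2,3) off by (cases "A \<in> sets M") (metis, metis measure_notin_sets)
  then show ?thesis using N(1,2) that[of ?N] by blast
qed

lemma measure_sums_UNION:
  assumes "finite_measure N" "sets N = sets M" "range B \<subseteq> sets M" "disjoint_family B"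
  shows "(\<lambda>i. measure N (B i)) sums measure N (\<Union>i. B i)"
  using finite_measure.finite_measure_UNION[OF assms(1), of B] assms by simp

lemma measure_notin_sets': "sets N = sets M \<Longrightarrow> A \<notin> sets M \<Longrightarrow> measure N A = 0"
  by (simp add: measure_notin_sets)

lemma ex_measure_linear:
  fixes a b :: real
  assumes "finite_measure N" "finite_measure L" "sets N = sets M" "sets L = sets M" "0 \<le> a" "0 \<le> b"
  obtains K where "finite_measure K" "sets K = sets M"
    "measure K = (\<lambda>A. a * measure N A + b * measure L A)"
proof (rule ex_finite_measure[of M "\<lambda>A. a * measure N A + b * measure L A"])
  fix B :: "nat \<Rightarrow> 'a set" assume B: "range B \<subseteq> sets M" "disjoint_family B"
  show "(\<lambda>i. a * measure N (B i) + b * measure L (B i))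
      sums (a * measure N (\<Union>i. B i) + b * measure L (\<Union>i. B i))"
    using measure_sums_UNION[OF assms(1,3) B] measure_sums_UNION[OF assms(2,4) B]
    by (intro sums_add sums_mult)
qed (use assms that in \<open>auto simp: measure_notin_sets'\<close>)

text \<open>Induction over nonnegative measurable functions: indicators are the hypothesis
  \<open>eq\<close>, and in the limit step weights and sum move through the suprema because the
  integrals increase.\<close>

lemma nn_integral_linear_measure:
  assumes s: "sets K = sets M" "sets N = sets M" "sets L = sets M"
    and eq: "\<And>A. A \<in> sets M \<Longrightarrow> emeasure K A = a * emeasure N A + b * emeasure L A"
    and u: "u \<in> borel_measurable M"
  shows "(\<integral>\<^sup>+x. u x \<partial>K) = a * (\<integral>\<^sup>+x. u x \<partial>N) + b * (\<integral>\<^sup>+x. u x \<partial>L)"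
proof -
  note [measurable_cong] = s
  note sp = s[THEN sets_eq_imp_space_eq]
  show ?thesis using u
  proof (induction rule: borel_measurable_induct)
    case (cong f g)
    have "(\<integral>\<^sup>+x. f x \<partial>N) = (\<integral>\<^sup>+x. g x \<partial>N)" if "space N = space M" for N
      using cong(3) that by (intro nn_integral_cong) auto
    then show ?case using cong(4) by (simp add: sp)
  next
    case (set A)
    then show ?case using eq by (simp add: s)
  next
    case (mult u r)
    note [measurable] = mult(2)
    show ?case using mult(4) by (simp add: nn_integral_cmult distrib_left mult.left_commute)
  next
    case (add u v)
    note [measurable] = add(1,4)
    show ?case using add by (simp add: nn_integral_add distrib_left ac_simps)
  next
    case (seq U)
    note [measurable] = seq(1)
    have *: "(\<integral>\<^sup>+x. (SUP i. U i) x \<partial>K) = (SUP i. \<integral>\<^sup>+x. U i x \<partial>K)" if [measurable_cong]: "sets K = sets M" for K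
      using seq(3) unfolding SUP_apply by (intro nn_integral_monotone_convergence_SUP) auto
    have inc: "incseq (\<lambda>i. c * (\<integral>\<^sup>+x. U i x \<partial>K))" for K c
      using seq(3) by (auto simp: incseq_def le_fun_def intro!: nn_integral_mono mult_left_mono)
    show ?case
      unfolding \<open>u = (SUP i. U i)\<close> *[OF s(1)] *[OF s(2)] *[OF s(3)]
      using seq by (simp add: SUP_mult_left_ennreal ennreal_SUP_add[OF inc inc, symmetric])
  qed
qed

lemma integrable_bounded:
  fixes h :: "'a \<Rightarrow> real"
  assumes "finite_measure N" "sets N = sets M" "h \<in> borel_measurable M" "\<And>x. \<bar>h x\<bar> \<le> K"
  shows "integrable N h"
  using assms by (intro finite_measure.integrable_const_bound[of N _ K])
    (auto cong: measurable_cong_sets)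

definition bounded_measurable :: "'c measure \<Rightarrow> ('c \<Rightarrow> real) \<Rightarrow> bool" where
  "bounded_measurable N f \<longleftrightarrow> f \<in> borel_measurable N \<and> (\<exists>C. \<forall>x. \<bar>f x\<bar> \<le> C)"

lemma bounded_measurableI: "f \<in> borel_measurable N \<Longrightarrow> (\<And>x. \<bar>f x\<bar> \<le> C) \<Longrightarrow> bounded_measurable N f"
  by (auto simp: bounded_measurable_def)

lemma bounded_measurable_const: "bounded_measurable N (\<lambda>_. c)"
  by (rule bounded_measurableI[of _ _ "\<bar>c\<bar>"]) auto

lemma bounded_measurable_add:
  assumes "bounded_measurable N f" "bounded_measurable N k"
  shows "bounded_measurable N (\<lambda>x. f x + k x)"
proof -
  obtain C where C: "f \<in> borel_measurable N" "\<And>x. \<bar>f x\<bar> \<le> C" using assms(1) unfolding bounded_measurable_def by blast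
  obtain B where B: "k \<in> borel_measurable N" "\<And>x. \<bar>k x\<bar> \<le> B" using assms(2) unfolding bounded_measurable_def by blast
  show ?thesis
    by (rule bounded_measurableI[of _ _ "C + B"])
       (use C B in \<open>auto intro!: order_trans[OF abs_triangle_ineq] add_mono\<close>)
qed

lemma bounded_measurable_mult:
  assumes "bounded_measurable N f" "bounded_measurable N k"
  shows "bounded_measurable N (\<lambda>x. f x * k x)"
proof -
  obtain C where C: "f \<in> borel_measurable N" "\<And>x. \<bar>f x\<bar> \<le> C" using assms(1) unfolding bounded_measurable_def by blast
  obtain B where B: "k \<in> borel_measurable N" "\<And>x. \<bar>k x\<bar> \<le> B" using assms(2) unfolding bounded_measurable_def by blast
  have "0 \<le> C" using C(2)[of undefined] by linarith
  then show ?thesis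
    by (intro bounded_measurableI[of _ _ "C * B"])
       (use C B in \<open>auto simp: abs_mult intro!: mult_mono\<close>)
qed

lemma bounded_measurable_sum:
  "(\<And>i. i \<in> I \<Longrightarrow> bounded_measurable N (f i)) \<Longrightarrow> bounded_measurable N (\<lambda>x. \<Sum>i\<in>I. f i x)"
  by (induction I rule: infinite_finite_induct)
     (auto intro: bounded_measurable_const bounded_measurable_add)

lemma bounded_measurable_power2:
  "bounded_measurable N f \<Longrightarrow> bounded_measurable N (\<lambda>x. (f x)\<^sup>2)"
  unfolding power2_eq_square by (rule bounded_measurable_mult)

lemma bounded_measurable_compose:
  assumes "bounded_measurable N f" "t \<in> L \<rightarrow>\<^sub>M N"
  shows "bounded_measurable L (\<lambda>x. f (t x))"
proof -
  obtain C where C: "f \<in> borel_measurable N" "\<And>x. \<bar>f x\<bar> \<le> C" using assms(1) unfolding bounded_measurable_def by blast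
  show ?thesis by (rule bounded_measurableI[OF measurable_compose[OF assms(2) C(1)] C(2)])
qed

lemma integrable_bounded_measurable:
  assumes "finite_measure N" "bounded_measurable N f"
  shows "integrable N f"
proof -
  obtain C where C: "f \<in> borel_measurable N" "\<And>x. \<bar>f x\<bar> \<le> C" using assms(2) unfolding bounded_measurable_def by blast
  show ?thesis by (rule integrable_bounded[OF assms(1) refl C])
qed

lemma integral_linear_measure:
  fixes h :: "'a \<Rightarrow> real"
  assumes f: "finite_measure K" "finite_measure N" "finite_measure L"
    and s: "sets K = sets M" "sets N = sets M" "sets L = sets M"
    and eq: "measure K = (\<lambda>A. a * measure N A + b * measure L A)" and ab: "0 \<le> a" "0 \<le> b"
    and h: "h \<in> borel_measurable M" "\<And>x. \<bar>h x\<bar> \<le> C"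
  shows "integral\<^sup>L K h = a * integral\<^sup>L N h + b * integral\<^sup>L L h"
proof -
  have nn: "integral\<^sup>L K u = a * integral\<^sup>L N u + b * integral\<^sup>L L u"
    if u: "u \<in> borel_measurable M" "\<And>x. 0 \<le> u x" "\<And>x. \<bar>u x\<bar> \<le> C" for u :: "'a \<Rightarrow> real" and C
  proof -
    have fin: "integral\<^sup>L N u \<ge> 0 \<and> (\<integral>\<^sup>+x. ennreal (u x) \<partial>N) = ennreal (integral\<^sup>L N u)"
      if "finite_measure N" "sets N = sets M" for N
      using integrable_bounded[OF that u(1,3)] u(2) by (auto intro!: nn_integral_eq_integral)
    have "emeasure K A = ennreal a * emeasure N A + ennreal b * emeasure L A" for A
      by (simp add: finite_measure.emeasure_eq_measure f eq ab ennreal_mult)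
    from nn_integral_linear_measure[OF s this, of "\<lambda>x. ennreal (u x)"]
    have "(\<integral>\<^sup>+x. ennreal (u x) \<partial>K) = ennreal a * (\<integral>\<^sup>+x. ennreal (u x) \<partial>N) + ennreal b * (\<integral>\<^sup>+x. ennreal (u x) \<partial>L)"
      using u(1) by simp
    then have "ennreal (integral\<^sup>L K u) = ennreal (a * integral\<^sup>L N u + b * integral\<^sup>L L u)"
      using fin f s ab by (simp add: ennreal_mult)
    then show ?thesis using fin f s ab by (subst (asm) ennreal_inj) auto
  qed
  \<comment> \<open>Shifting \<open>h\<close> by its bound \<open>C\<close> makes it nonnegative;
    the nonnegative case is then applied to \<open>h + C\<close> and to the constant
    \<open>C\<close>.\<close>
  have C: "0 \<le> C" using h(2)[of undefined] by linarith
  have "integral\<^sup>L K (\<lambda>x. h x + C) = a * integral\<^sup>L N (\<lambda>x. h x + C) + b * integral\<^sup>L L (\<lambda>x. h x + C)"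
  proof (rule nn[of _ "2 * C"])
    fix x show "0 \<le> h x + C" "\<bar>h x + C\<bar> \<le> 2 * C" using h(2)[of x] by linarith+
  qed (use h in measurable)
  moreover have "integral\<^sup>L K (\<lambda>x. C) = a * integral\<^sup>L N (\<lambda>x. C) + b * integral\<^sup>L L (\<lambda>x. C)"
    by (rule nn[of _ C]) (use C in auto)
  moreover have "integral\<^sup>L N (\<lambda>x. h x + C) = integral\<^sup>L N h + integral\<^sup>L N (\<lambda>x. C)"
    if "finite_measure N" "sets N = sets M" for N
    using integrable_bounded[OF that h] integrable_bounded[OF that, of "\<lambda>_. C" C] C by simp
  ultimately show ?thesis using f s by (simp add: algebra_simps)
qed

text \<open>If a - b = c - d as set functions, then a + d and c + b are one and the same finite
  measure \<open>S\<close>, which can be integrated in two ways. Hence an integral against a signed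
  measure may be computed from any decomposition.\<close>

lemma integral_diff_cong:
  fixes h :: "'a \<Rightarrow> real"
  assumes f: "finite_measure a" "finite_measure b" "finite_measure c" "finite_measure d"
    and s: "sets a = sets M" "sets b = sets M" "sets c = sets M" "sets d = sets M"
    and eq: "\<And>A. A \<in> sets M \<Longrightarrow> measure a A - measure b A = measure c A - measure d A"
    and h: "h \<in> borel_measurable M" "\<And>x. \<bar>h x\<bar> \<le> K"
  shows "integral\<^sup>L a h - integral\<^sup>L b h = integral\<^sup>L c h - integral\<^sup>L d h"
proof -
  have p: "(0::real) \<le> 1" by simp
  obtain S where S: "finite_measure S" "sets S = sets M" "measure S = (\<lambda>A. 1 * measure a A + 1 * measure d A)"
    using ex_measure_linear[OF f(1,4) s(1,4) p p] .
  have "measure S A = 1 * measure c A + 1 * measure b A" for A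
    using eq[of A] by (cases "A \<in> sets M") (auto simp: S measure_notin_sets' s)
  then have "measure S = (\<lambda>A. 1 * measure c A + 1 * measure b A)" by auto
  from integral_linear_measure[OF S(1) f(1,4) S(2) s(1,4) S(3) p p h]
    integral_linear_measure[OF S(1) f(3,2) S(2) s(3,2) this p p h]
  show ?thesis by simp
qed

section \<open>Jordan parts, signed integrals and total variation\<close>

lemma
  assumes "signed_measure M V"
  shows signed_measure_Hahn: "is_Hahn_set M V (Hahn_set M V)"
    and finite_measure_pos_part: "finite_measure (pos_part M V)"
    and finite_measure_neg_part: "finite_measure (neg_part M V)"
    and sets_pos_part: "sets (pos_part M V) = sets M"
    and sets_neg_part: "sets (neg_part M V) = sets M"
    and measure_pos_part: "\<And>A. A \<in> sets M \<Longrightarrow> measure (pos_part M V) A = V (A \<inter> Hahn_set M V)"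
    and measure_neg_part: "\<And>A. A \<in> sets M \<Longrightarrow> measure (neg_part M V) A = - V (A - Hahn_set M V)"
    and measure_pos_neg: "\<And>A. A \<in> sets M \<Longrightarrow> measure (pos_part M V) A - measure (neg_part M V) A = V A"
proof -
  obtain N1 N2 where N: "finite_measure N1" "finite_measure N2" "sets N1 = sets M" "sets N2 = sets M"
    and V: "V = (\<lambda>A. measure N1 A - measure N2 A)"
    using assms by (rule signed_measureE)
  define P where "P = Hahn_set M V"
  have H: "is_Hahn_set M V P"
    unfolding V P_def using is_Hahn_set_Hahn_set[OF N] .
  then show "is_Hahn_set M V (Hahn_set M V)" by (simp add: P_def)
  have P: "P \<in> sets M" and pos: "\<And>A. A \<in> sets M \<Longrightarrow> A \<subseteq> P \<Longrightarrow> 0 \<le> V A"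
    and neg: "\<And>A. A \<in> sets M \<Longrightarrow> A \<subseteq> space M - P \<Longrightarrow> V A \<le> 0"
    using H by (auto simp: is_Hahn_set_def)
  have ca: "(\<lambda>i. V (B i)) sums V (\<Union>i. B i)" if "range B \<subseteq> sets M" "disjoint_family B" for B
    unfolding V using N that by (intro sums_diff measure_sums_UNION) auto
  \<comment> \<open>Intersecting with the Hahn set or removing it keeps disjoint unions disjoint, so
    both restrictions of \<open>V\<close> are countably additive, and \<open>measure_of\<close>
    really takes the values prescribed in \<open>pos_part\<close> and
    \<open>neg_part\<close>.\<close>
  have caP: "(\<lambda>i. V (B i \<inter> P)) sums V ((\<Union>i. B i) \<inter> P)" "(\<lambda>i. - V (B i - P)) sums - V ((\<Union>i. B i) - P)"
    if B: "range B \<subseteq> sets M" "disjoint_family B" for B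
  proof -
    have "range (\<lambda>i. B i \<inter> P) \<subseteq> sets M" "range (\<lambda>i. B i - P) \<subseteq> sets M" using B P by auto
    moreover have "disjoint_family (\<lambda>i. B i \<inter> P)" "disjoint_family (\<lambda>i. B i - P)"
      using B(2) by (auto simp: disjoint_family_on_def)
    ultimately show "(\<lambda>i. V (B i \<inter> P)) sums V ((\<Union>i. B i) \<inter> P)" "(\<lambda>i. - V (B i - P)) sums - V ((\<Union>i. B i) - P)"
      using ca[of "\<lambda>i. B i \<inter> P"] ca[of "\<lambda>i. B i - P"] by (auto intro!: sums_minus)
  qed
  have nl: "V ({} \<inter> P) = 0" "- V ({} - P) = 0" by (simp_all add: V)
  have "0 \<le> V (A \<inter> P)" if "A \<in> sets M" for A using that P pos by auto
  note 1 = finite_measure_of_countably_additive[of M "\<lambda>A. V (A \<inter> P)", OF this nl(1) caP(1)]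
  have "0 \<le> - V (A - P)" if "A \<in> sets M" for A
    using that P neg[of "A - P"] sets.sets_into_space[OF that] by auto
  note 2 = finite_measure_of_countably_additive[of M "\<lambda>A. - V (A - P)", OF this nl(2) caP(2)]
  note unf = pos_part_def neg_part_def P_def[symmetric]
  show "finite_measure (pos_part M V)" unfolding unf by (rule 1(1))
  show "finite_measure (neg_part M V)" unfolding unf by (rule 2(1))
  show "sets (pos_part M V) = sets M" unfolding unf by (rule 1(2))
  show "sets (neg_part M V) = sets M" unfolding unf by (rule 2(2))
  show p: "measure (pos_part M V) A = V (A \<inter> Hahn_set M V)" if "A \<in> sets M" for A
    unfolding unf by (rule 1(3)) (use that in auto)
  show n: "measure (neg_part M V) A = - V (A - Hahn_set M V)" if "A \<in> sets M" for A
    unfolding unf by (rule 2(3)) (use that in auto)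
  show "measure (pos_part M V) A - measure (neg_part M V) A = V A" if A: "A \<in> sets M" for A
  proof -
    have "measure N A = measure N (A \<inter> P) + measure N (A - P)" if "finite_measure N" "sets N = sets M" for N
      using finite_measure.finite_measure_Union[OF that(1), of "A \<inter> P" "A - P"] A P that
      by (auto simp: Int_Diff_Un)
    from this[OF N(1,3)] this[OF N(2,4)] show ?thesis
      unfolding p[OF A] n[OF A] P_def[symmetric] unfolding V by simp
  qed
qed

lemma signed_integral_eq:
  fixes h :: "'a \<Rightarrow> real"
  assumes N: "finite_measure N1" "finite_measure N2" "sets N1 = sets M" "sets N2 = sets M"
    and h: "h \<in> borel_measurable M" "\<And>x. \<bar>h x\<bar> \<le> K"
    and V: "V = (\<lambda>A. measure N1 A - measure N2 A)"
  shows "signed_integral M V h = integral\<^sup>L N1 h - integral\<^sup>L N2 h"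
proof -
  have sV: "signed_measure M V" using N V by (rule signed_measureI)
  show ?thesis unfolding signed_integral_def
    by (rule integral_diff_cong[OF finite_measure_pos_part[OF sV] finite_measure_neg_part[OF sV]
       N(1,2) sets_pos_part[OF sV] sets_neg_part[OF sV] N(3,4) _ h])
       (simp add: measure_pos_neg[OF sV], simp add: V)
qed

lemma tv_norm_eq:
  assumes "signed_measure M V"
  shows "tv_norm M V = V (Hahn_set M V) - V (space M - Hahn_set M V)" "Hahn_set M V \<in> sets M"
proof -
  show s: "Hahn_set M V \<in> sets M"
    using signed_measure_Hahn[OF assms] by (simp add: is_Hahn_set_def)
  then show "tv_norm M V = V (Hahn_set M V) - V (space M - Hahn_set M V)"
    using measure_pos_part[OF assms, of "space M"] measure_neg_part[OF assms, of "space M"]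
    by (simp add: tv_norm_def)
qed

lemma signed_integral_bound:
  fixes h :: "'a \<Rightarrow> real"
  assumes sV: "signed_measure M V" and h: "h \<in> borel_measurable M" "\<And>x. \<bar>h x\<bar> \<le> K"
  shows "\<bar>signed_integral M V h\<bar> \<le> K * tv_norm M V"
proof -
  have *: "\<bar>integral\<^sup>L N h\<bar> \<le> K * measure N (space M)" if "finite_measure N" "sets N = sets M" for N
  proof -
    interpret finite_measure N by fact
    have "\<bar>integral\<^sup>L N h\<bar> \<le> (\<integral>x. \<bar>h x\<bar> \<partial>N)" by (rule integral_abs_bound)
    also have "\<dots> \<le> (\<integral>x. K \<partial>N)"
      using integrable_bounded[OF that h] h(2) by (intro integral_mono) auto
    finally show ?thesis using sets_eq_imp_space_eq[OF that(2)] by (simp add: mult.commute)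
  qed
  show ?thesis
    using *[OF finite_measure_pos_part[OF sV] sets_pos_part[OF sV]]
      *[OF finite_measure_neg_part[OF sV] sets_neg_part[OF sV]]
    unfolding signed_integral_def tv_norm_def distrib_left by linarith
qed

lemma
  assumes sV: "signed_measure M V" and sW: "signed_measure M W"
  shows signed_measure_linear: "signed_measure M (\<lambda>A. a * V A + b * W A)"
    and signed_integral_linear: "\<And>h K. h \<in> borel_measurable M \<Longrightarrow> (\<And>x. \<bar>h x\<bar> \<le> K) \<Longrightarrow>
      signed_integral M (\<lambda>A. a * V A + b * W A) h = a * signed_integral M V h + b * signed_integral M W h"
proof -
  have scale: "signed_measure M (\<lambda>A. r * V A) \<and> (\<forall>h K. h \<in> borel_measurable M \<longrightarrow> (\<forall>x. \<bar>h x\<bar> \<le> K) \<longrightarrow>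
      signed_integral M (\<lambda>A. r * V A) h = r * signed_integral M V h)" if sV: "signed_measure M V" for V r
  proof -
    obtain N1 N2 where N: "finite_measure N1" "finite_measure N2" "sets N1 = sets M" "sets N2 = sets M"
      and V: "V = (\<lambda>A. measure N1 A - measure N2 A)"
      using sV by (rule signed_measureE)
    \<comment> \<open>A scalar of either sign: its positive part keeps the two measures in place,
      its negative part exchanges them.\<close>
    have r: "0 \<le> max r 0" "0 \<le> max (- r) 0" by auto
    obtain K where K: "finite_measure K" "sets K = sets M"
      "measure K = (\<lambda>A. max r 0 * measure N1 A + max (- r) 0 * measure N2 A)"
      using ex_measure_linear[OF N r] .
    obtain L where L: "finite_measure L" "sets L = sets M"
      "measure L = (\<lambda>A. max r 0 * measure N2 A + max (- r) 0 * measure N1 A)"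
      using ex_measure_linear[OF N(2,1,4,3) r] .
    have eq: "(\<lambda>A. r * V A) = (\<lambda>A. measure K A - measure L A)"
      by (auto simp: V K(3) L(3) max_def algebra_simps fun_eq_iff)
    have "signed_integral M (\<lambda>A. r * V A) h = r * signed_integral M V h"
      if h: "h \<in> borel_measurable M" "\<And>x. \<bar>h x\<bar> \<le> C" for h C
      using signed_integral_eq[OF K(1) L(1) K(2) L(2) h eq] signed_integral_eq[OF N h V]
        integral_linear_measure[OF K(1) N(1,2) K(2) N(3,4) K(3) r h]
        integral_linear_measure[OF L(1) N(2,1) L(2) N(4,3) L(3) r h]
      by (cases "0 \<le> r") (simp_all add: max_def right_diff_distrib)
    moreover have "signed_measure M (\<lambda>A. r * V A)"
      using K L eq by (intro signed_measureI)
    ultimately show ?thesis by blast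
  qed
  have plus: "signed_measure M (\<lambda>A. V A + W A) \<and> (\<forall>h K. h \<in> borel_measurable M \<longrightarrow> (\<forall>x. \<bar>h x\<bar> \<le> K) \<longrightarrow>
      signed_integral M (\<lambda>A. V A + W A) h = signed_integral M V h + signed_integral M W h)"
    if sV: "signed_measure M V" and sW: "signed_measure M W" for V W
  proof -
    obtain N1 N2 where N: "finite_measure N1" "finite_measure N2" "sets N1 = sets M" "sets N2 = sets M"
      and V: "V = (\<lambda>A. measure N1 A - measure N2 A)"
      using sV by (rule signed_measureE)
    obtain L1 L2 where L: "finite_measure L1" "finite_measure L2" "sets L1 = sets M" "sets L2 = sets M"
      and W: "W = (\<lambda>A. measure L1 A - measure L2 A)"
      using sW by (rule signed_measureE)
    have p: "(0::real) \<le> 1" by simp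
    obtain K where K: "finite_measure K" "sets K = sets M" "measure K = (\<lambda>A. 1 * measure N1 A + 1 * measure L1 A)"
      using ex_measure_linear[OF N(1) L(1) N(3) L(3) p p] .
    obtain J where J: "finite_measure J" "sets J = sets M" "measure J = (\<lambda>A. 1 * measure N2 A + 1 * measure L2 A)"
      using ex_measure_linear[OF N(2) L(2) N(4) L(4) p p] .
    have eq: "(\<lambda>A. V A + W A) = (\<lambda>A. measure K A - measure J A)"
      by (auto simp: V W K(3) J(3))
    have "signed_integral M (\<lambda>A. V A + W A) h = signed_integral M V h + signed_integral M W h"
      if h: "h \<in> borel_measurable M" "\<And>x. \<bar>h x\<bar> \<le> C" for h C
      using signed_integral_eq[OF K(1) J(1) K(2) J(2) h eq] signed_integral_eq[OF N h V]
        signed_integral_eq[OF L h W]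
        integral_linear_measure[OF K(1) N(1) L(1) K(2) N(3) L(3) K(3) p p h]
        integral_linear_measure[OF J(1) N(2) L(2) J(2) N(4) L(4) J(3) p p h]
      by simp
    moreover have "signed_measure M (\<lambda>A. V A + W A)"
      using K J eq by (intro signed_measureI)
    ultimately show ?thesis by blast
  qed
  note sa = scale[OF sV, of a] and sb = scale[OF sW, of b]
  note pl = plus[OF conjunct1[OF sa] conjunct1[OF sb]]
  show "signed_measure M (\<lambda>A. a * V A + b * W A)" using pl by blast
  show "signed_integral M (\<lambda>A. a * V A + b * W A) h = a * signed_integral M V h + b * signed_integral M W h"
    if h: "h \<in> borel_measurable M" "\<And>x. \<bar>h x\<bar> \<le> K" for h K
  proof -
    have "\<forall>x. \<bar>h x\<bar> \<le> K" using h by blast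
    have "signed_integral M (\<lambda>A. a * V A + b * W A) h =
        signed_integral M (\<lambda>A. a * V A) h + signed_integral M (\<lambda>A. b * W A) h"
      using pl h(1) \<open>\<forall>x. \<bar>h x\<bar> \<le> K\<close> by blast
    moreover have "signed_integral M (\<lambda>A. a * V A) h = a * signed_integral M V h"
      using sa h(1) \<open>\<forall>x. \<bar>h x\<bar> \<le> K\<close> by blast
    moreover have "signed_integral M (\<lambda>A. b * W A) h = b * signed_integral M W h"
      using sb h(1) \<open>\<forall>x. \<bar>h x\<bar> \<le> K\<close> by blast
    ultimately show ?thesis by simp
  qed
qed

lemma finite_measure_null_measure: "finite_measure (null_measure M)"
  by (rule finite_measureI) simp

lemma signed_measure_measure:
  assumes "finite_measure N" "sets N = sets M"
  shows "signed_measure M (measure N)"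
proof (rule signed_measureI[OF assms(1) finite_measure_null_measure assms(2)])
  show "measure N = (\<lambda>A. measure N A - measure (null_measure M) A)"
    by (rule ext) (simp add: measure_def)
qed simp

lemma signed_integral_measure:
  fixes h :: "'a \<Rightarrow> real"
  assumes "finite_measure N" "sets N = sets M" "h \<in> borel_measurable M" "\<And>x. \<bar>h x\<bar> \<le> K"
  shows "signed_integral M (measure N) h = integral\<^sup>L N h"
proof -
  have "measure N = (\<lambda>A. measure N A - measure (null_measure M) A)"
    by (rule ext) (simp add: measure_def)
  from signed_integral_eq[OF assms(1) finite_measure_null_measure assms(2) _ assms(3,4) this]
  show ?thesis by simp
qed

lemma signed_measure_off: "signed_measure M V \<Longrightarrow> A \<notin> sets M \<Longrightarrow> V A = 0"
  by (elim signed_measureE) (metis diff_zero measure_notin_sets')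

lemma signed_integral_indicator:
  assumes "signed_measure M V" "A \<in> sets M"
  shows "signed_integral M V (indicator A) = V A"
proof -
  have *: "integral\<^sup>L N (indicator A) = measure N A" if "sets N = sets M" for N
    using sets_eq_imp_space_eq[OF that] sets.sets_into_space[OF assms(2)] by (simp add: Int_absorb2)
  show ?thesis
    unfolding signed_integral_def *[OF sets_pos_part[OF assms(1)]] *[OF sets_neg_part[OF assms(1)]]
    by (rule measure_pos_neg[OF assms])
qed

section \<open>Convolution of finite signed measures\<close>

context measurable_abelian_semigroup
begin

declare measurable_plus[measurable]

lemma measurable_translate:
  assumes "h \<in> M \<rightarrow>\<^sub>M N"
  shows "(\<lambda>y. h (x + y)) \<in> M \<rightarrow>\<^sub>M N"
proof -
  have "(\<lambda>y. (x, y)) \<in> M \<rightarrow>\<^sub>M M \<Otimes>\<^sub>M M" by (rule measurable_Pair1') (simp add: space_eq_UNIV)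
  from measurable_compose[OF measurable_compose[OF this measurable_plus] assms]
  show ?thesis by simp
qed

lemma translate_sets: "A \<in> sets M \<Longrightarrow> {y \<in> space M. x + y \<in> A} \<in> sets M"
  using measurable_sets[OF measurable_translate[OF measurable_id], of A x]
  by (simp add: vimage_def Int_def conj_commute)

lemma measurable_fun_plus:
  assumes "h \<in> M \<rightarrow>\<^sub>M N"
  shows "(\<lambda>(x, y). h (x + y)) \<in> M \<Otimes>\<^sub>M M \<rightarrow>\<^sub>M N"
  using measurable_compose[OF measurable_plus assms] by (simp add: case_prod_unfold)

lemma measurable_integral_translate:
  fixes h :: "'a \<Rightarrow> real"
  assumes "finite_measure N" "sets N = sets M" "h \<in> borel_measurable M"
  shows "(\<lambda>x. \<integral>y. h (x + y) \<partial>N) \<in> borel_measurable M"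
proof -
  interpret finite_measure N by fact
  note [measurable_cong] = assms(2)
  show ?thesis
    using measurable_fun_plus[OF assms(3)] by (intro borel_measurable_lebesgue_integral) simp
qed

lemma integral_translate_bound:
  fixes h :: "'a \<Rightarrow> real"
  assumes N: "finite_measure N" "sets N = sets M" and h: "h \<in> borel_measurable M" "\<And>x. \<bar>h x\<bar> \<le> K"
  shows "\<bar>\<integral>y. h (x + y) \<partial>N\<bar> \<le> K * measure N (space M)"
proof -
  interpret finite_measure N by fact
  have "\<bar>\<integral>y. h (x + y) \<partial>N\<bar> \<le> (\<integral>y. \<bar>h (x + y)\<bar> \<partial>N)" by (rule integral_abs_bound)
  also have "\<dots> \<le> (\<integral>y. K \<partial>N)"
    using integrable_bounded[OF N measurable_translate[OF h(1)] h(2)] h(2) by (intro integral_mono) auto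
  finally show ?thesis using sets_eq_imp_space_eq[OF N(2)] by (simp add: mult.commute)
qed

text \<open>The convolution of two finite measures is the image of their product measure under
  addition. Fubini's theorem in both orders, together with commutativity of the semigroup, gives two
  iterated integrals; having both is what makes convolution commutative.\<close>

lemma ex_convolution:
  assumes N: "finite_measure N" "sets N = sets M" and L: "finite_measure L" "sets L = sets M"
  obtains K where "finite_measure K" "sets K = sets M"
    "\<And>h C. h \<in> borel_measurable M \<Longrightarrow> (\<And>x. \<bar>h x\<bar> \<le> C) \<Longrightarrow>
      integral\<^sup>L K h = (\<integral>x. (\<integral>y. h (x + y) \<partial>N) \<partial>L :: real)"
    "\<And>h C. h \<in> borel_measurable M \<Longrightarrow> (\<And>x. \<bar>h x\<bar> \<le> C) \<Longrightarrow>
      integral\<^sup>L K h = (\<integral>x. (\<integral>y. h (x + y) \<partial>L) \<partial>N :: real)"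
proof -
  interpret N: finite_measure N by fact
  interpret L: finite_measure L by fact
  interpret LN: pair_sigma_finite L N ..
  note [measurable_cong] = N(2) L(2)
  have m: "(\<lambda>(x, y). x + y) \<in> L \<Otimes>\<^sub>M N \<rightarrow>\<^sub>M M" by measurable
  interpret P: finite_measure "L \<Otimes>\<^sub>M N"
    by (rule finite_measure_pair_measure) unfold_locales
  let ?K = "distr (L \<Otimes>\<^sub>M N) M (\<lambda>(x, y). x + y)"
  have 1: "integral\<^sup>L ?K h = (\<integral>x. (\<integral>y. h (x + y) \<partial>N) \<partial>L)"
    and 2: "integral\<^sup>L ?K h = (\<integral>x. (\<integral>y. h (x + y) \<partial>L) \<partial>N)"
    if h: "h \<in> borel_measurable M" "\<And>x. \<bar>h x\<bar> \<le> C" for h :: "'a \<Rightarrow> real" and C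
  proof -
    have int: "integrable (L \<Otimes>\<^sub>M N) (\<lambda>(x, y). h (x + y))"
      using measurable_fun_plus[OF h(1)] h(2)
      by (intro P.integrable_const_bound[of _ C]) auto
    have "integral\<^sup>L ?K h = (\<integral>z. h (case z of (x, y) \<Rightarrow> x + y) \<partial>(L \<Otimes>\<^sub>M N))"
      using h m by (subst integral_distr) auto
    also have "\<dots> = (\<integral>z. (case z of (x, y) \<Rightarrow> h (x + y)) \<partial>(L \<Otimes>\<^sub>M N))"
      by (simp add: case_prod_unfold)
    finally have e: "integral\<^sup>L ?K h = (\<integral>z. (case z of (x, y) \<Rightarrow> h (x + y)) \<partial>(L \<Otimes>\<^sub>M N))" .
    show "integral\<^sup>L ?K h = (\<integral>x. (\<integral>y. h (x + y) \<partial>N) \<partial>L)"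
      unfolding e using LN.integral_fst'[OF int] by simp
    show "integral\<^sup>L ?K h = (\<integral>x. (\<integral>y. h (x + y) \<partial>L) \<partial>N)"
      unfolding e using LN.integral_snd[of "\<lambda>x y. h (x + y)"] int by (simp add: add.commute)
  qed
  show ?thesis
    by (rule that[OF P.finite_measure_distr[OF m] _ 1 2]) auto
qed

text \<open>Multiplying out (N1 - N2)(L1 - L2) gives four convolutions of finite measures;
  \<open>P\<close> collects those with positive sign, \<open>Q\<close> the mixed ones. Their
  difference \<open>Z\<close> is characterised by its integrals, in either order, and only
  afterwards identified with \<open>conv\<close>.\<close>

lemma
  assumes sV: "signed_measure M V" and sW: "signed_measure M W"
  shows signed_measure_conv: "signed_measure M (conv M V W)"
    and conv_commute: "conv M V W = conv M W V"
    and measurable_signed_integral_translate: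
      "\<And>h K. h \<in> borel_measurable M \<Longrightarrow> (\<And>x. \<bar>h x\<bar> \<le> K) \<Longrightarrow>
        (\<lambda>x. signed_integral M V (\<lambda>y. h (x + y))) \<in> borel_measurable M"
    and signed_integral_conv:
      "\<And>h K. h \<in> borel_measurable M \<Longrightarrow> (\<And>x. \<bar>h x\<bar> \<le> K) \<Longrightarrow> signed_integral M (conv M V W) h =
        signed_integral M W (\<lambda>x. signed_integral M V (\<lambda>y. h (x + y)))"
proof -
  obtain N1 N2 where N: "finite_measure N1" "finite_measure N2" "sets N1 = sets M" "sets N2 = sets M"
    and V: "V = (\<lambda>A. measure N1 A - measure N2 A)"
    using sV by (rule signed_measureE)
  obtain L1 L2 where L: "finite_measure L1" "finite_measure L2" "sets L1 = sets M" "sets L2 = sets M"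
    and W: "W = (\<lambda>A. measure L1 A - measure L2 A)"
    using sW by (rule signed_measureE)
  note tr = integrable_bounded[OF _ _ measurable_integral_translate[OF _ _ ] integral_translate_bound]
  have iV: "signed_integral M V (\<lambda>y. h (x + y)) = (\<integral>y. h (x + y) \<partial>N1) - (\<integral>y. h (x + y) \<partial>N2)"
    and iW: "signed_integral M W (\<lambda>y. h (x + y)) = (\<integral>y. h (x + y) \<partial>L1) - (\<integral>y. h (x + y) \<partial>L2)"
    if h: "h \<in> borel_measurable M" "\<And>x. \<bar>h x\<bar> \<le> K" for h K x
    using h by (auto intro!: signed_integral_eq[OF N measurable_translate _ V] signed_integral_eq[OF L measurable_translate _ W])
  show meas: "(\<lambda>x. signed_integral M V (\<lambda>y. h (x + y))) \<in> borel_measurable M"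
    if h: "h \<in> borel_measurable M" "\<And>x. \<bar>h x\<bar> \<le> K" for h K
    unfolding iV[OF h] using N h by (intro borel_measurable_diff measurable_integral_translate) auto
  have measW: "(\<lambda>x. signed_integral M W (\<lambda>y. h (x + y))) \<in> borel_measurable M"
    if h: "h \<in> borel_measurable M" "\<And>x. \<bar>h x\<bar> \<le> K" for h K
    unfolding iW[OF h] using L h by (intro borel_measurable_diff measurable_integral_translate) auto
  obtain A11 where A11: "finite_measure A11" "sets A11 = sets M"
    "\<And>h C. h \<in> borel_measurable M \<Longrightarrow> (\<And>x. \<bar>h x\<bar> \<le> C) \<Longrightarrow> integral\<^sup>L A11 h = (\<integral>x. (\<integral>y. h (x + y) \<partial>N1) \<partial>L1 :: real)"
    "\<And>h C. h \<in> borel_measurable M \<Longrightarrow> (\<And>x. \<bar>h x\<bar> \<le> C) \<Longrightarrow> integral\<^sup>L A11 h = (\<integral>x. (\<integral>y. h (x + y) \<partial>L1) \<partial>N1 :: real)"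
    using ex_convolution[OF N(1,3) L(1,3)] by blast
  obtain A12 where A12: "finite_measure A12" "sets A12 = sets M"
    "\<And>h C. h \<in> borel_measurable M \<Longrightarrow> (\<And>x. \<bar>h x\<bar> \<le> C) \<Longrightarrow> integral\<^sup>L A12 h = (\<integral>x. (\<integral>y. h (x + y) \<partial>N1) \<partial>L2 :: real)"
    "\<And>h C. h \<in> borel_measurable M \<Longrightarrow> (\<And>x. \<bar>h x\<bar> \<le> C) \<Longrightarrow> integral\<^sup>L A12 h = (\<integral>x. (\<integral>y. h (x + y) \<partial>L2) \<partial>N1 :: real)"
    using ex_convolution[OF N(1,3) L(2,4)] by blast
  obtain A21 where A21: "finite_measure A21" "sets A21 = sets M"
    "\<And>h C. h \<in> borel_measurable M \<Longrightarrow> (\<And>x. \<bar>h x\<bar> \<le> C) \<Longrightarrow> integral\<^sup>L A21 h = (\<integral>x. (\<integral>y. h (x + y) \<partial>N2) \<partial>L1 :: real)"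
    "\<And>h C. h \<in> borel_measurable M \<Longrightarrow> (\<And>x. \<bar>h x\<bar> \<le> C) \<Longrightarrow> integral\<^sup>L A21 h = (\<integral>x. (\<integral>y. h (x + y) \<partial>L1) \<partial>N2 :: real)"
    using ex_convolution[OF N(2,4) L(1,3)] by blast
  obtain A22 where A22: "finite_measure A22" "sets A22 = sets M"
    "\<And>h C. h \<in> borel_measurable M \<Longrightarrow> (\<And>x. \<bar>h x\<bar> \<le> C) \<Longrightarrow> integral\<^sup>L A22 h = (\<integral>x. (\<integral>y. h (x + y) \<partial>N2) \<partial>L2 :: real)"
    "\<And>h C. h \<in> borel_measurable M \<Longrightarrow> (\<And>x. \<bar>h x\<bar> \<le> C) \<Longrightarrow> integral\<^sup>L A22 h = (\<integral>x. (\<integral>y. h (x + y) \<partial>L2) \<partial>N2 :: real)"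
    using ex_convolution[OF N(2,4) L(2,4)] by blast
  have p: "(0::real) \<le> 1" by simp
  obtain P where P: "finite_measure P" "sets P = sets M" "measure P = (\<lambda>A. 1 * measure A11 A + 1 * measure A22 A)"
    using ex_measure_linear[OF A11(1) A22(1) A11(2) A22(2) p p] .
  obtain Q where Q: "finite_measure Q" "sets Q = sets M" "measure Q = (\<lambda>A. 1 * measure A12 A + 1 * measure A21 A)"
    using ex_measure_linear[OF A12(1) A21(1) A12(2) A21(2) p p] .
  define Z where "Z = (\<lambda>A. measure P A - measure Q A)"
  have sZ: "signed_measure M Z" by (rule signed_measureI[OF P(1) Q(1) P(2) Q(2) Z_def])
  have Z: "signed_integral M Z h = signed_integral M W (\<lambda>x. signed_integral M V (\<lambda>y. h (x + y)))"
      "signed_integral M Z h = signed_integral M V (\<lambda>x. signed_integral M W (\<lambda>y. h (x + y)))"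
    if h: "h \<in> borel_measurable M" "\<And>x. \<bar>h x\<bar> \<le> K" for h K
  proof -
    have z: "signed_integral M Z h = integral\<^sup>L A11 h + integral\<^sup>L A22 h - (integral\<^sup>L A12 h + integral\<^sup>L A21 h)"
      unfolding signed_integral_eq[OF P(1) Q(1) P(2) Q(2) h Z_def]
      using integral_linear_measure[OF P(1) A11(1) A22(1) P(2) A11(2) A22(2) P(3) p p h]
        integral_linear_measure[OF Q(1) A12(1) A21(1) Q(2) A12(2) A21(2) Q(3) p p h] by simp
    have b: "\<bar>signed_integral M V (\<lambda>y. h (x + y))\<bar> \<le> K * tv_norm M V"
      "\<bar>signed_integral M W (\<lambda>y. h (x + y))\<bar> \<le> K * tv_norm M W" for x
      using h by (auto intro!: signed_integral_bound sV sW measurable_translate)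
    have int: "integrable B (\<lambda>x. \<integral>y. h (x + y) \<partial>A)"
      if "finite_measure A" "sets A = sets M" "finite_measure B" "sets B = sets M" for A B
      by (rule integrable_bounded[OF that(3,4) measurable_integral_translate[OF that(1,2) h(1)]
        integral_translate_bound[OF that(1,2) h]])
    show "signed_integral M Z h = signed_integral M W (\<lambda>x. signed_integral M V (\<lambda>y. h (x + y)))"
      unfolding signed_integral_eq[OF L meas[OF h] b(1) W] z
      unfolding iV[OF h] using int N L
      by (simp add: A11(3)[OF h] A12(3)[OF h] A21(3)[OF h] A22(3)[OF h])
    show "signed_integral M Z h = signed_integral M V (\<lambda>x. signed_integral M W (\<lambda>y. h (x + y)))"
      unfolding signed_integral_eq[OF N measW[OF h] b(2) V] z
      unfolding iW[OF h] using int N L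
      by (simp add: A11(4)[OF h] A12(4)[OF h] A21(4)[OF h] A22(4)[OF h])
  qed
  \<comment> \<open>For \<open>h\<close> the indicator of \<open>A\<close>, the iterated integral
    characterising \<open>Z\<close> is the defining expression of \<open>conv\<close> at
    \<open>A\<close>; off \<open>sets M\<close> both vanish.\<close>
  have ZA: "conv M V W A = Z A" "conv M W V A = Z A" for A
  proof -
    have ind: "X {y \<in> space M. x + y \<in> A} = signed_integral M X (\<lambda>y. indicator A (x + y))"
      if "A \<in> sets M" "signed_measure M X" for X x
    proof -
      have "indicator {y \<in> space M. x + y \<in> A} = (\<lambda>y. indicator A (x + y) :: real)"
        by (auto simp: indicator_def space_eq_UNIV)
      then show ?thesis
        using signed_integral_indicator[OF that(2) translate_sets[OF that(1)], of x] by simp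
    qed
    have "conv M V W A = Z A \<and> conv M W V A = Z A" if "A \<in> sets M"
    proof -
      have h: "indicator A \<in> borel_measurable M" "\<And>x. \<bar>indicator A x :: real\<bar> \<le> 1"
        using that by (auto simp: indicator_def)
      show ?thesis
        using Z[OF h] that unfolding conv_def ind[OF that sV] ind[OF that sW]
          signed_integral_indicator[OF sZ that] by simp
    qed
    then show "conv M V W A = Z A" "conv M W V A = Z A"
      using signed_measure_off[OF sZ, of A] by (auto simp: conv_def)
  qed
  then have e: "conv M V W = Z" "conv M W V = Z" by auto
  show "signed_measure M (conv M V W)" by (simp add: e sZ)
  show "conv M V W = conv M W V" by (simp add: e)
  show "signed_integral M (conv M V W) h =
        signed_integral M W (\<lambda>x. signed_integral M V (\<lambda>y. h (x + y)))"
    if h: "h \<in> borel_measurable M" "\<And>x. \<bar>h x\<bar> \<le> K" for h K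
    unfolding e by (rule Z(1)[OF h])
qed

lemma finite_measure_return: "finite_measure (return M x)"
  using prob_space_return[of x M] by (simp add: space_eq_UNIV prob_space.finite_measure)

lemma signed_measure_dirac: "signed_measure M (dirac M x)"
  unfolding dirac_def by (intro signed_measure_measure finite_measure_return) simp

lemma signed_integral_dirac:
  fixes h :: "'a \<Rightarrow> real"
  assumes h: "h \<in> borel_measurable M" "\<And>x. \<bar>h x\<bar> \<le> K"
  shows "signed_integral M (dirac M x) h = h x"
  unfolding dirac_def using signed_integral_measure[OF finite_measure_return _ h] h(1)
  by (simp add: integral_return space_eq_UNIV)

lemma signed_measure_eqI:
  assumes sV: "signed_measure M V" and sW: "signed_measure M W"
    and eq: "\<And>h. h \<in> borel_measurable M \<Longrightarrow> (\<And>x. \<bar>h x\<bar> \<le> 1) \<Longrightarrow>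
      signed_integral M V h = signed_integral M W h"
  shows "V = W"
proof
  fix A
  show "V A = W A"
  proof (cases "A \<in> sets M")
    case True
    have "signed_integral M V (indicator A) = signed_integral M W (indicator A)"
      using True by (intro eq) (auto simp: indicator_def)
    then show ?thesis using True by (simp add: signed_integral_indicator sV sW)
  qed (simp add: signed_measure_off[OF sV] signed_measure_off[OF sW])
qed

lemma conv_dirac:
  assumes "signed_measure M V"
  shows "conv M V (dirac M 0) = V"
proof (rule signed_measure_eqI)
  fix h :: "'a \<Rightarrow> real" assume h: "h \<in> borel_measurable M" "\<And>x. \<bar>h x\<bar> \<le> 1"
  show "signed_integral M (conv M V (dirac M 0)) h = signed_integral M V h"
    using signed_integral_dirac[OF measurable_signed_integral_translate[OF assms signed_measure_dirac h]
       signed_integral_bound[OF assms measurable_translate[OF h(1)] h(2)], of 0]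
    by (simp add: signed_integral_conv[OF assms signed_measure_dirac h])
qed (intro signed_measure_conv assms signed_measure_dirac)+

text \<open>Tested on a bounded function, both sides are the same triple integral of h(x + y +
  z).\<close>

lemma conv_assoc:
  assumes s: "signed_measure M U" "signed_measure M V" "signed_measure M W"
  shows "conv M (conv M U V) W = conv M U (conv M V W)"
proof (rule signed_measure_eqI)
  fix h :: "'a \<Rightarrow> real" assume h: "h \<in> borel_measurable M" "\<And>x. \<bar>h x\<bar> \<le> 1"
  note sc = signed_measure_conv[OF s(1,2)] signed_measure_conv[OF s(2,3)]
  have t: "(\<lambda>y. h (x + y)) \<in> borel_measurable M" "\<And>y. \<bar>h (x + y)\<bar> \<le> 1" for x
    using measurable_translate h by auto
  show "signed_integral M (conv M (conv M U V) W) h = signed_integral M (conv M U (conv M V W)) h"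
    unfolding signed_integral_conv[OF sc(1) s(3) h] signed_integral_conv[OF s(1,2) t]
      signed_integral_conv[OF s(1) sc(2) h]
    by (subst signed_integral_conv[OF s(2,3) measurable_signed_integral_translate[OF s(1,2) h]
         signed_integral_bound[OF s(1) t]]) (simp add: add.assoc)
qed (intro signed_measure_conv s)+

lemma conv_linear:
  assumes s: "signed_measure M U" "signed_measure M V" "signed_measure M W"
  shows "conv M U (\<lambda>A. a * V A + b * W A) = (\<lambda>A. a * conv M U V A + b * conv M U W A)"
proof (rule signed_measure_eqI)
  fix h :: "'a \<Rightarrow> real" assume h: "h \<in> borel_measurable M" "\<And>x. \<bar>h x\<bar> \<le> 1"
  note sc = signed_measure_conv[OF s(1,2)] signed_measure_conv[OF s(1,3)]
  show "signed_integral M (conv M U (\<lambda>A. a * V A + b * W A)) h =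
      signed_integral M (\<lambda>A. a * conv M U V A + b * conv M U W A) h"
    unfolding signed_integral_conv[OF s(1) signed_measure_linear[OF s(2,3)] h]
      signed_integral_linear[OF sc h] signed_integral_conv[OF s(1,2) h] signed_integral_conv[OF s(1,3) h]
    by (rule signed_integral_linear[OF s(2,3) measurable_signed_integral_translate[OF s(1,2) h]
       signed_integral_bound[OF s(1) measurable_translate[OF h(1)] h(2)]])
qed (intro signed_measure_conv signed_measure_linear s)+

end

section \<open>The Banach algebra of finite signed measures\<close>

lemma signed_integral_linear_fun:
  fixes h k :: "'a \<Rightarrow> real"
  assumes sV: "signed_measure M V" and h: "h \<in> borel_measurable M" "\<And>x. \<bar>h x\<bar> \<le> C"
    and k: "k \<in> borel_measurable M" "\<And>x. \<bar>k x\<bar> \<le> K"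
  shows "signed_integral M V (\<lambda>x. a * h x + b * k x) = a * signed_integral M V h + b * signed_integral M V k"
proof -
  note p = finite_measure_pos_part[OF sV] sets_pos_part[OF sV]
    and n = finite_measure_neg_part[OF sV] sets_neg_part[OF sV]
  show ?thesis unfolding signed_integral_def
    using integrable_bounded[OF p h] integrable_bounded[OF p k] integrable_bounded[OF n h] integrable_bounded[OF n k]
    by (simp add: algebra_simps)
qed

text \<open>The weights (1, 0) control single values, the weights (1, -1) the total variation.
  Translating \<open>A\<close> commutes with taking complements, so the integrand that arises from
  the convolution is bounded by \<open>K\<close> at every point.\<close>

lemma (in measurable_abelian_semigroup) conv_bound:
  assumes "signed_measure M V" "signed_measure M W" "A \<in> sets M"
    and "\<And>A. A \<in> sets M \<Longrightarrow> \<bar>a * V A + b * V (UNIV - A)\<bar> \<le> K"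
  shows "\<bar>a * conv M V W A + b * conv M V W (UNIV - A)\<bar> \<le> K * tv_norm M W"
proof -
  define Ax where "Ax = (\<lambda>x. {y \<in> space M. x + y \<in> A})"
  have Ax: "Ax x \<in> sets M" for x unfolding Ax_def by (rule translate_sets[OF assms(3)])
  have c: "UNIV - A \<in> sets M" using assms(3) sets.compl_sets[of A M] by (simp add: space_eq_UNIV)
  have eq: "{y \<in> space M. x + y \<in> UNIV - A} = UNIV - Ax x" for x by (auto simp: Ax_def space_eq_UNIV)
  have meas: "(\<lambda>x. V {y \<in> space M. x + y \<in> B}) \<in> borel_measurable M"
    and bd: "\<bar>V {y \<in> space M. x + y \<in> B}\<bar> \<le> 1 * tv_norm M V" if B: "B \<in> sets M" for B x
  proof -
    have i: "indicator B \<in> borel_measurable M" "\<And>x. \<bar>indicator B x :: real\<bar> \<le> 1"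
      using B by (auto simp: indicator_def)
    have "indicator {y \<in> space M. x + y \<in> B} = (\<lambda>y. indicator B (x + y) :: real)" for x
      by (auto simp: indicator_def space_eq_UNIV)
    then have ind: "signed_integral M V (\<lambda>y. indicator B (x + y)) = V {y \<in> space M. x + y \<in> B}" for x
      using signed_integral_indicator[OF assms(1) translate_sets[OF B], of x] by simp
    show "(\<lambda>x. V {y \<in> space M. x + y \<in> B}) \<in> borel_measurable M"
      using measurable_signed_integral_translate[OF assms(1,1) i] by (simp add: ind)
    show "\<bar>V {y \<in> space M. x + y \<in> B}\<bar> \<le> 1 * tv_norm M V"
      unfolding ind[symmetric] by (rule signed_integral_bound[OF assms(1) measurable_translate[OF i(1)] i(2)])
  qed
  define h where "h = (\<lambda>x. a * V {y \<in> space M. x + y \<in> A} + b * V {y \<in> space M. x + y \<in> UNIV - A})"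
  have "a * conv M V W A + b * conv M V W (UNIV - A) = signed_integral M W h"
    unfolding h_def using signed_integral_linear_fun[OF assms(2) meas[OF assms(3)] bd[OF assms(3)] meas[OF c] bd[OF c]]
      assms(3) c by (simp add: conv_def)
  moreover have "h \<in> borel_measurable M"
    unfolding h_def using meas[OF assms(3)] meas[OF c] by simp
  moreover have "\<bar>h x\<bar> \<le> K" for x
    using assms(4)[OF Ax, of x] unfolding h_def eq unfolding Ax_def .
  ultimately show ?thesis
    using signed_integral_bound[OF assms(2), of h K] by simp
qed

text \<open>The total variation norm is itself a value of this expression, namely the one at a Hahn
  set.\<close>

lemma tv_norm_le:
  assumes "signed_measure M V" "space M = UNIV" "\<And>A. A \<in> sets M \<Longrightarrow> \<bar>V A - V (UNIV - A)\<bar> \<le> K"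
  shows "tv_norm M V \<le> K"
  using tv_norm_eq[OF assms(1)] assms(2,3) by (smt (verit))

section \<open>The Banach algebra of bounded families\<close>

text \<open>The fixed value 0 at everything that is not a measurable semigroup makes equality of
  families a matter of the semigroups alone; the uniform bound keeps the supremum norm
  finite.\<close>

definition is_family :: "('a::comm_monoid_add measure \<Rightarrow> 'a set \<Rightarrow> real) \<Rightarrow> bool" where
  "is_family W \<longleftrightarrow>
     (\<forall>M. if measurable_abelian_semigroup M then signed_measure M (W M) else W M = (\<lambda>_. 0)) \<and>
     (\<exists>K. \<forall>M A. \<bar>W M A\<bar> \<le> K)"

lemma is_familyI:
  assumes "\<And>M. measurable_abelian_semigroup M \<Longrightarrow> signed_measure M (W M)"
    "\<And>M A. \<not> measurable_abelian_semigroup M \<Longrightarrow> W M A = 0" "\<And>M A. \<bar>W M A\<bar> \<le> K"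
  shows "is_family W"
  using assms unfolding is_family_def by (auto simp: fun_eq_iff)

lemma is_familyD:
  assumes "is_family W"
  shows "measurable_abelian_semigroup M \<Longrightarrow> signed_measure M (W M)"
    "\<not> measurable_abelian_semigroup M \<Longrightarrow> W M A = 0"
  using assms unfolding is_family_def by (auto split: if_splits simp: fun_eq_iff)

lemma is_family_bound:
  assumes "is_family W"
  obtains K where "\<And>M A. \<bar>W M A\<bar> \<le> K"
  using assms unfolding is_family_def by blast

lemma is_family_linear:
  assumes V: "is_family V" and W: "is_family W"
  shows "is_family (\<lambda>M A. a * V M A + b * W M A)"
proof -
  obtain K where K: "\<And>M A. \<bar>V M A\<bar> \<le> K" using is_family_bound[OF V] by blast
  obtain L where L: "\<And>M A. \<bar>W M A\<bar> \<le> L" using is_family_bound[OF W] by blast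
  show ?thesis
  proof (rule is_familyI)
    fix M A show "\<bar>a * V M A + b * W M A\<bar> \<le> \<bar>a\<bar> * K + \<bar>b\<bar> * L"
      by (intro order_trans[OF abs_triangle_ineq] add_mono) (auto simp: abs_mult intro!: mult_left_mono K L)
  qed (use V W in \<open>auto intro: signed_measure_linear is_familyD simp: is_familyD(2)\<close>)
qed

lemma is_family_add: "is_family V \<Longrightarrow> is_family W \<Longrightarrow> is_family (\<lambda>M A. V M A + W M A)"
  using is_family_linear[of V W 1 1] by simp

lemma is_family_diff: "is_family V \<Longrightarrow> is_family W \<Longrightarrow> is_family (\<lambda>M A. V M A - W M A)"
  using is_family_linear[of V W 1 "-1"] by simp

lemma is_family_scale: "is_family V \<Longrightarrow> is_family (\<lambda>M A. a * V M A)"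
  using is_family_linear[of V V a 0] by simp

lemma is_family_zero: "is_family (\<lambda>M A. 0)"
proof (rule is_familyI)
  fix M :: "'a measure"
  show "signed_measure M (\<lambda>A. 0)"
    by (rule signed_measureI[OF finite_measure_null_measure finite_measure_null_measure]) auto
qed auto

lemma abs_dirac_le: "\<bar>dirac M x A\<bar> \<le> 1"
  by (cases "A \<in> sets M") (auto simp: dirac_def measure_return measure_notin_sets' indicator_def)

lemma is_family_dirac:
  "is_family (\<lambda>M. if measurable_abelian_semigroup M then dirac M 0 else (\<lambda>_. 0))"
  by (rule is_familyI[of _ 1]) (auto intro: measurable_abelian_semigroup.signed_measure_dirac simp: abs_dirac_le)

lemma is_family_conv:
  assumes V: "is_family V" and W: "is_family W"
  shows "is_family (\<lambda>M. if measurable_abelian_semigroup M then conv M (V M) (W M) else (\<lambda>_. 0))"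
proof -
  obtain K where K: "\<And>M A. \<bar>V M A\<bar> \<le> K" using is_family_bound[OF V] by blast
  obtain L where L: "\<And>M A. \<bar>W M A\<bar> \<le> L" using is_family_bound[OF W] by blast
  show ?thesis
  proof (rule is_familyI)
    fix M :: "'a measure" and A
    assume "measurable_abelian_semigroup M"
    then interpret measurable_abelian_semigroup M .
    show "signed_measure M (if measurable_abelian_semigroup M then conv M (V M) (W M) else (\<lambda>_. 0))"
      by (simp add: measurable_abelian_semigroup_axioms signed_measure_conv is_familyD V W)
  next
    fix M :: "'a measure" and A
    have K0: "0 \<le> K" "0 \<le> L" using K[of undefined undefined] L[of undefined undefined] by linarith+
    show "\<bar>(if measurable_abelian_semigroup M then conv M (V M) (W M) else (\<lambda>_. 0)) A\<bar> \<le> K * (2 * L)"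
    proof (cases "measurable_abelian_semigroup M \<and> A \<in> sets M")
      case True
      then interpret measurable_abelian_semigroup M by simp
      note s = is_familyD(1)[OF V measurable_abelian_semigroup_axioms] is_familyD(1)[OF W measurable_abelian_semigroup_axioms]
      have "\<bar>1 * conv M (V M) (W M) A + 0 * conv M (V M) (W M) (UNIV - A)\<bar> \<le> K * tv_norm M (W M)"
        using True K by (intro conv_bound s) auto
      moreover have "\<bar>W M A - W M (UNIV - A)\<bar> \<le> 2 * L" for A
        using L[of M A] L[of M "UNIV - A"] by linarith
      then have "tv_norm M (W M) \<le> 2 * L"
        by (intro tv_norm_le s space_eq_UNIV)
      ultimately show ?thesis using True K0 mult_left_mono[of "tv_norm M (W M)" "2 * L" K] by simp
    qed (auto simp: conv_def K0)
  qed auto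
qed

text \<open>A structure that exists over every carrier type; its component separates 0 from 1 and
  shows that 1 has norm at least 1.\<close>

lemma measurable_abelian_semigroup_trivial:
  "measurable_abelian_semigroup (sigma (UNIV :: 'a::comm_monoid_add set) {})"
proof
  show "(\<lambda>(x, y). x + y) \<in> sigma UNIV {} \<Otimes>\<^sub>M sigma UNIV {} \<rightarrow>\<^sub>M sigma (UNIV :: 'a set) {}"
    by (rule measurable_measure_of) auto
qed simp

text \<open>Convolution algebras of different measurable structures are collected into a single product
  ring, so that their common carrier is a type and can be made an instance of the class of
  Banach algebras.\<close>

typedef (overloaded) 'a smeasure = "{W :: 'a::comm_monoid_add measure \<Rightarrow> 'a set \<Rightarrow> real. is_family W}"
  using is_family_zero by blast

setup_lifting type_definition_smeasure

lemma Rep_smeasure_family: "is_family (Rep_smeasure X)"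
  using Rep_smeasure[of X] by simp

lemma signed_measure_Rep: "measurable_abelian_semigroup M \<Longrightarrow> signed_measure M (Rep_smeasure X M)"
  by (rule is_familyD(1)[OF Rep_smeasure_family])

lemma smeasure_eqI:
  assumes "\<And>M. measurable_abelian_semigroup M \<Longrightarrow> Rep_smeasure X M = Rep_smeasure Y M"
  shows "X = Y"
proof -
  have "Rep_smeasure X M A = Rep_smeasure Y M A" for M A
    using assms[of M] is_familyD(2)[OF Rep_smeasure_family, of M _ A]
    by (cases "measurable_abelian_semigroup M") auto
  then have "Rep_smeasure X = Rep_smeasure Y" by blast
  then show ?thesis by (simp add: Rep_smeasure_inject)
qed

instantiation smeasure :: (comm_monoid_add) comm_ring_1
begin

lift_definition zero_smeasure :: "'a smeasure" is "\<lambda>_ _. 0" by (rule is_family_zero)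
lift_definition one_smeasure :: "'a smeasure" is
  "\<lambda>M. if measurable_abelian_semigroup M then dirac M 0 else (\<lambda>_. 0)" by (rule is_family_dirac)
lift_definition plus_smeasure :: "'a smeasure \<Rightarrow> 'a smeasure \<Rightarrow> 'a smeasure" is
  "\<lambda>V W M A. V M A + W M A" by (rule is_family_add)
lift_definition minus_smeasure :: "'a smeasure \<Rightarrow> 'a smeasure \<Rightarrow> 'a smeasure" is
  "\<lambda>V W M A. V M A - W M A" by (rule is_family_diff)
lift_definition uminus_smeasure :: "'a smeasure \<Rightarrow> 'a smeasure" is
  "\<lambda>V M A. - V M A" using is_family_scale[of _ "-1"] by simp
lift_definition times_smeasure :: "'a smeasure \<Rightarrow> 'a smeasure \<Rightarrow> 'a smeasure" is
  "\<lambda>V W M. if measurable_abelian_semigroup M then conv M (V M) (W M) else (\<lambda>_. 0)"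
  by (rule is_family_conv)

instance
proof
  fix X Y Z :: "'a smeasure"
  show "X * Y * Z = X * (Y * Z)"
    by (rule smeasure_eqI)
       (simp add: times_smeasure.rep_eq measurable_abelian_semigroup.conv_assoc signed_measure_Rep)
  have comm: "X * Y = Y * X" for X Y :: "'a smeasure"
    by (rule smeasure_eqI)
       (simp add: times_smeasure.rep_eq measurable_abelian_semigroup.conv_commute signed_measure_Rep)
  show "X * Y = Y * X" by (rule comm)
  have "X * 1 = X"
    by (rule smeasure_eqI)
       (simp add: times_smeasure.rep_eq one_smeasure.rep_eq measurable_abelian_semigroup.conv_dirac signed_measure_Rep)
  then show "1 * X = X" by (simp add: comm)
  have "Z * (X + Y) = Z * X + Z * Y"
    apply (rule smeasure_eqI)
    subgoal for M
      using measurable_abelian_semigroup.conv_linear[of M "Rep_smeasure Z M" "Rep_smeasure X M" "Rep_smeasure Y M" 1 1]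
      by (auto simp: times_smeasure.rep_eq plus_smeasure.rep_eq signed_measure_Rep)
    done
  then show "(X + Y) * Z = X * Z + Y * Z" by (simp add: comm)
  show "(0::'a smeasure) \<noteq> 1"
  proof
    assume "(0::'a smeasure) = 1"
    then have "Rep_smeasure (0::'a smeasure) (sigma UNIV {}) UNIV = Rep_smeasure (1::'a smeasure) (sigma UNIV {}) UNIV"
      by simp
    then show False
      by (simp add: zero_smeasure.rep_eq one_smeasure.rep_eq measurable_abelian_semigroup_trivial dirac_def
         measure_return sigma_sets_top)
  qed
qed (transfer; simp add: algebra_simps fun_eq_iff)+

end

instantiation smeasure :: (comm_monoid_add) real_vector
begin

lift_definition scaleR_smeasure :: "real \<Rightarrow> 'a smeasure \<Rightarrow> 'a smeasure" is
  "\<lambda>r V M A. r * V M A" by (rule is_family_scale)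

instance by intro_classes (transfer; simp add: algebra_simps fun_eq_iff)+

end

lemma bdd_above_family:
  assumes "is_family W"
  shows "bdd_above (range (\<lambda>(M, A). \<bar>W M A - W M (UNIV - A)\<bar>))"
proof -
  obtain K where K: "\<And>M A. \<bar>W M A\<bar> \<le> K" using is_family_bound[OF assms] by blast
  have "\<bar>W M A - W M (UNIV - A)\<bar> \<le> K + K" for M A
    using K[of M A] K[of M "UNIV - A"] by linarith
  then show ?thesis by (intro bdd_aboveI[of _ "K + K"]) auto
qed

instantiation smeasure :: (comm_monoid_add) real_normed_vector
begin

text \<open>At a semigroup \<open>M\<close> the supremum over \<open>A\<close> is the total
  variation norm of the component, attained at a Hahn set; taking it over all \<open>M\<close> as
  well gives a norm of the whole family.\<close>

lift_definition norm_smeasure :: "'a smeasure \<Rightarrow> real" is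
  "\<lambda>W. SUP (M, A). \<bar>W M A - W M (UNIV - A)\<bar>" .

definition dist_smeasure :: "'a smeasure \<Rightarrow> 'a smeasure \<Rightarrow> real"
  where "dist_smeasure X Y = norm (X - Y)"

definition sgn_smeasure :: "'a smeasure \<Rightarrow> 'a smeasure"
  where "sgn_smeasure X = X /\<^sub>R norm X"

definition uniformity_smeasure :: "('a smeasure \<times> 'a smeasure) filter"
  where [code del]: "uniformity_smeasure = (INF e\<in>{0<..}. principal {(X, Y). dist X Y < e})"

definition open_smeasure :: "'a smeasure set \<Rightarrow> bool"
  where [code del]: "open_smeasure U = (\<forall>X\<in>U. eventually (\<lambda>(X', Y). X' = X \<longrightarrow> Y \<in> U) uniformity)"

lemma norm_smeasure_ge: "\<bar>Rep_smeasure X M A - Rep_smeasure X M (UNIV - A)\<bar> \<le> norm X"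
  unfolding norm_smeasure.rep_eq
  using cSUP_upper[OF UNIV_I bdd_above_family[OF Rep_smeasure_family], of X "(M, A)"] by simp

lemma norm_smeasure_le:
  assumes "0 \<le> K" "\<And>M A. measurable_abelian_semigroup M \<Longrightarrow> A \<in> sets M \<Longrightarrow>
    \<bar>Rep_smeasure X M A - Rep_smeasure X M (UNIV - A)\<bar> \<le> K"
  shows "norm X \<le> K"
  unfolding norm_smeasure.rep_eq
proof (rule cSUP_least)
  fix z :: "'a measure \<times> 'a set"
  obtain M A where z: "z = (M, A)" by (cases z)
  have "\<bar>Rep_smeasure X M A - Rep_smeasure X M (UNIV - A)\<bar> \<le> K"
  proof (cases "measurable_abelian_semigroup M")
    case True
    then interpret measurable_abelian_semigroup M .
    show ?thesis
    proof (cases "A \<in> sets M")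
      case False
      then have "UNIV - A \<notin> sets M"
        using sets.compl_sets[of "UNIV - A" M] by (auto simp: space_eq_UNIV double_diff)
      with False show ?thesis
        using signed_measure_off[OF signed_measure_Rep[OF True, of X]] assms(1) by simp
    qed (use assms True in auto)
  next
    case False
    then show ?thesis using assms(1) by (simp add: is_familyD(2)[OF Rep_smeasure_family False])
  qed
  then show "(case z of (M, A) \<Rightarrow> \<bar>Rep_smeasure X M A - Rep_smeasure X M (UNIV - A)\<bar>) \<le> K"
    by (simp add: z)
qed simp

text \<open>With U the whole space, 2 V(A) = (V(A) - V(U - A)) + V(U), and both summands are bounded
  by the norm.\<close>

lemma abs_Rep_smeasure_le: "\<bar>Rep_smeasure X M A\<bar> \<le> norm X"
proof (cases "measurable_abelian_semigroup M \<and> A \<in> sets M")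
  case True
  then interpret measurable_abelian_semigroup M by simp
  from True obtain N1 N2 where N: "finite_measure N1" "finite_measure N2" "sets N1 = sets M" "sets N2 = sets M"
    "Rep_smeasure X M = (\<lambda>A. measure N1 A - measure N2 A)"
    using signed_measure_Rep signed_measureE by metis
  have sp: "space N1 = UNIV" "space N2 = UNIV"
    using N(3,4)[THEN sets_eq_imp_space_eq] space_eq_UNIV by auto
  have "Rep_smeasure X M (UNIV - A) = Rep_smeasure X M UNIV - Rep_smeasure X M A"
    using finite_measure.finite_measure_compl[OF N(1), of A] finite_measure.finite_measure_compl[OF N(2), of A]
      True N(3,4) by (simp add: sp N(5))
  moreover have "Rep_smeasure X M {} = 0" by (simp add: N(5))
  ultimately show ?thesis
    using norm_smeasure_ge[of X M A] norm_smeasure_ge[of X M UNIV] by simp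
next
  case False
  then have "Rep_smeasure X M A = 0"
    using signed_measure_off[OF signed_measure_Rep] is_familyD(2)[OF Rep_smeasure_family] by blast
  then show ?thesis using norm_smeasure_ge[of X M A] by linarith
qed

instance
proof
  fix X Y :: "'a smeasure" and r :: real
  show "dist X Y = norm (X - Y)" by (rule dist_smeasure_def)
  show "sgn X = X /\<^sub>R norm X" by (rule sgn_smeasure_def)
  show "uniformity = (INF e\<in>{0<..}. principal {(X, Y :: 'a smeasure). dist X Y < e})"
    by (rule uniformity_smeasure_def)
  show "open U = (\<forall>X\<in>U. \<forall>\<^sub>F (X', Y) in uniformity. X' = X \<longrightarrow> Y \<in> U)" for U :: "'a smeasure set"
    by (rule open_smeasure_def)
  have n0: "0 \<le> norm X" for X :: "'a smeasure"
    using norm_smeasure_ge[of X undefined undefined] by linarith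
  show "norm X = 0 \<longleftrightarrow> X = 0"
  proof
    assume "norm X = 0"
    then show "X = 0"
      using abs_Rep_smeasure_le[of X] by (intro smeasure_eqI) (auto simp: zero_smeasure.rep_eq fun_eq_iff)
  qed (auto intro!: antisym n0 norm_smeasure_le simp: zero_smeasure.rep_eq)
  show "norm (X + Y) \<le> norm X + norm Y"
  proof (rule norm_smeasure_le)
    fix M A
    show "\<bar>Rep_smeasure (X + Y) M A - Rep_smeasure (X + Y) M (UNIV - A)\<bar> \<le> norm X + norm Y"
      unfolding plus_smeasure.rep_eq
      using norm_smeasure_ge[of X M A] norm_smeasure_ge[of Y M A] by linarith
  qed (simp add: n0)
  have le: "norm (r *\<^sub>R X) \<le> \<bar>r\<bar> * norm X" for r and X :: "'a smeasure"
  proof (rule norm_smeasure_le)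
    fix M A
    have "\<bar>Rep_smeasure (r *\<^sub>R X) M A - Rep_smeasure (r *\<^sub>R X) M (UNIV - A)\<bar> =
        \<bar>r\<bar> * \<bar>Rep_smeasure X M A - Rep_smeasure X M (UNIV - A)\<bar>"
      by (simp add: scaleR_smeasure.rep_eq abs_mult[symmetric] right_diff_distrib)
    then show "\<bar>Rep_smeasure (r *\<^sub>R X) M A - Rep_smeasure (r *\<^sub>R X) M (UNIV - A)\<bar> \<le> \<bar>r\<bar> * norm X"
      using norm_smeasure_ge[of X M A] by (simp add: mult_left_mono)
  qed (simp add: n0)
  show "norm (r *\<^sub>R X) = \<bar>r\<bar> * norm X"
  proof (cases "r = 0")
    case False
    have "norm X = norm (inverse r *\<^sub>R (r *\<^sub>R X))" using False by simp
    also have "\<dots> \<le> \<bar>inverse r\<bar> * norm (r *\<^sub>R X)" by (rule le)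
    finally have "\<bar>r\<bar> * norm X \<le> norm (r *\<^sub>R X)"
      using False by (simp add: field_simps)
    then show ?thesis using le[of r X] by simp
  qed (use le[of 0 X] n0[of "0 *\<^sub>R X"] in simp)
qed

end

lemma tv_norm_le_norm:
  assumes "measurable_abelian_semigroup M"
  shows "tv_norm M (Rep_smeasure X M) \<le> norm X"
  using norm_smeasure_ge measurable_abelian_semigroup.space_eq_UNIV[OF assms]
  by (intro tv_norm_le signed_measure_Rep assms) auto

instance smeasure :: (comm_monoid_add) real_normed_algebra_1
proof
  fix X Y :: "'a smeasure" and r :: real
  have right: "X * (r *\<^sub>R Y) = r *\<^sub>R (X * Y)" for r and X Y :: "'a smeasure"
    apply (rule smeasure_eqI)
    subgoal for M
      using measurable_abelian_semigroup.conv_linear[of M "Rep_smeasure X M" "Rep_smeasure Y M" "Rep_smeasure Y M" r 0]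
      by (auto simp: times_smeasure.rep_eq scaleR_smeasure.rep_eq signed_measure_Rep)
    done
  then show "X * (r *\<^sub>R Y) = r *\<^sub>R (X * Y)" .
  show "r *\<^sub>R X * Y = r *\<^sub>R (X * Y)" using right[of Y r X] by (simp add: mult.commute)
  show "norm (X * Y) \<le> norm X * norm Y"
  proof (rule norm_smeasure_le)
    fix M :: "'a measure" and A assume M: "measurable_abelian_semigroup M" and A: "A \<in> sets M"
    interpret measurable_abelian_semigroup M by fact
    have "\<bar>1 * conv M (Rep_smeasure X M) (Rep_smeasure Y M) A +
        (-1) * conv M (Rep_smeasure X M) (Rep_smeasure Y M) (UNIV - A)\<bar> \<le> norm X * tv_norm M (Rep_smeasure Y M)"
      using norm_smeasure_ge[of X M] by (intro conv_bound signed_measure_Rep M A) simp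
    also have "\<dots> \<le> norm X * norm Y"
      by (intro mult_left_mono tv_norm_le_norm M) simp
    finally show "\<bar>Rep_smeasure (X * Y) M A - Rep_smeasure (X * Y) M (UNIV - A)\<bar> \<le> norm X * norm Y"
      by (simp add: times_smeasure.rep_eq M)
  qed simp
  show "norm (1::'a smeasure) = 1"
  proof (rule antisym)
    show "norm (1::'a smeasure) \<le> 1"
    proof (rule norm_smeasure_le)
      fix M :: "'a measure" and A assume M: "measurable_abelian_semigroup M" and A: "A \<in> sets M"
      interpret measurable_abelian_semigroup M by fact
      have "UNIV - A \<in> sets M" using sets.compl_sets[OF A] by (simp add: space_eq_UNIV)
      then show "\<bar>Rep_smeasure 1 M A - Rep_smeasure 1 M (UNIV - A)\<bar> \<le> 1"
        using A by (auto simp: one_smeasure.rep_eq M dirac_def measure_return indicator_def)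
    qed simp
    have "Rep_smeasure (1::'a smeasure) (sigma UNIV {}) UNIV = 1"
      by (simp add: one_smeasure.rep_eq measurable_abelian_semigroup_trivial dirac_def
         measure_return sigma_sets_top)
    then show "1 \<le> norm (1::'a smeasure)"
      using abs_Rep_smeasure_le[of "1 :: 'a smeasure" "sigma UNIV {}" UNIV] by simp
  qed
qed

text \<open>Along a subsequence with errors (1/2)^k the Jordan parts of the telescoping increments
  \<open>W k\<close> are dominated by a geometric series. They add up to two finite measures whose
  difference is \<open>L\<close>. Uniformity in \<open>A\<close> matters because the Hahn set
  changes with \<open>k\<close>.\<close>

lemma signed_measure_uniform_limit:
  fixes M :: "'a measure"
  assumes s: "\<And>n. signed_measure M (V n)"
    and lim: "\<And>e. 0 < e \<Longrightarrow> \<exists>n. \<forall>A. \<bar>V n A - L A\<bar> \<le> e"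
  shows "signed_measure M L"
proof -
  have "\<exists>n. \<forall>A. \<bar>V n A - L A\<bar> \<le> (1/2) ^ k" for k :: nat by (rule lim) simp
  then obtain r where r: "\<And>k A. \<bar>V (r k) A - L A\<bar> \<le> (1/2) ^ k" by metis
  define W where "W = (\<lambda>k A. case k of 0 \<Rightarrow> V (r 0) A | Suc i \<Rightarrow> V (r (Suc i)) A - V (r i) A)"
  have sW: "signed_measure M (W k)" for k
  proof (cases k)
    case 0
    then show ?thesis using s[of "r 0"] by (simp add: W_def)
  next
    case (Suc i)
    then show ?thesis using signed_measure_linear[OF s[of "r (Suc i)"] s[of "r i"], of 1 "-1"] by (simp add: W_def)
  qed
  have W_le: "\<bar>W (Suc k) A\<bar> \<le> 2 * (1/2) ^ k" for k A
  proof -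
    have "(1/2::real) ^ Suc k \<le> (1/2) ^ k" by simp
    moreover have "W (Suc k) A = (V (r (Suc k)) A - L A) - (V (r k) A - L A)" by (simp add: W_def)
    ultimately show ?thesis using r[of "Suc k" A] r[of k A] by linarith
  qed
  have part: "(\<Sum>k<Suc n. W k A) = V (r n) A" for n A
    by (induction n) (auto simp: W_def)
  have sumsW: "(\<lambda>k. W k A) sums L A" for A
  proof -
    have "(\<lambda>n. V (r n) A - L A) \<longlonglongrightarrow> 0"
      by (rule Lim_null_comparison[OF _ LIMSEQ_realpow_zero[of "1/2"]]) (use r in auto)
    then have "(\<lambda>n. V (r n) A) \<longlonglongrightarrow> L A" by (simp add: LIM_zero_iff)
    then have "(\<lambda>n. \<Sum>k<Suc n. W k A) \<longlonglongrightarrow> L A" by (simp only: part)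
    then show ?thesis unfolding sums_def by (simp only: filterlim_sequentially_Suc[of "\<lambda>n. \<Sum>k<n. W k A"])
  qed
  have *: "\<exists>N. finite_measure N \<and> sets N = sets M \<and> (\<forall>A. (\<lambda>k. measure (P k) A) sums measure N A)"
    if P: "\<And>k. finite_measure (P k)" "\<And>k. sets (P k) = sets M" "\<And>k A. measure (P (Suc k)) A \<le> 2 * (1/2) ^ k" for P
  proof -
    have sm: "summable (\<lambda>k. measure (P k) A)" for A
    \<comment> \<open>The geometric bound concerns \<open>P (Suc k)\<close> only, so the term of
      index 0 is split off.\<close>
    proof (subst summable_Suc_iff[symmetric], rule summable_comparison_test)
      show "summable (\<lambda>k. 2 * (1/2::real) ^ k)" by (intro summable_mult summable_geometric) simp
      show "\<exists>N. \<forall>n\<ge>N. norm (measure (P (Suc n)) A) \<le> 2 * (1/2) ^ n" using P(3) by auto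
    qed
    obtain N where N: "finite_measure N" "sets N = sets M" "measure N = (\<lambda>A. \<Sum>k. measure (P k) A)"
    proof (rule ex_finite_measure[of M "\<lambda>A. \<Sum>k. measure (P k) A"])
      fix B :: "nat \<Rightarrow> 'a set" assume B: "range B \<subseteq> sets M" "disjoint_family B"
      \<comment> \<open>As an integral over the counting measure, the sum over \<open>k\<close> can
        be exchanged with the sum over \<open>i\<close>, which is countable additivity of the sum of
        the measures \<open>P k\<close>.\<close>
      have e: "ennreal (\<Sum>k. measure (P k) A) = (\<integral>\<^sup>+k. emeasure (P k) A \<partial>count_space UNIV)" for A
        using sm[of A] finite_measure.emeasure_eq_measure[OF P(1)]
        by (simp add: nn_integral_count_space_nat suminf_ennreal2)
      have "(\<Sum>i. ennreal (\<Sum>k. measure (P k) (B i))) = (\<integral>\<^sup>+k. (\<Sum>i. emeasure (P k) (B i)) \<partial>count_space UNIV)"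
        unfolding e by (rule nn_integral_suminf[symmetric]) auto
      also have "\<dots> = (\<integral>\<^sup>+k. emeasure (P k) (\<Union>i. B i) \<partial>count_space UNIV)"
        using B P(2) by (intro nn_integral_cong suminf_emeasure) auto
      finally have "(\<Sum>i. ennreal (\<Sum>k. measure (P k) (B i))) = ennreal (\<Sum>k. measure (P k) (\<Union>i. B i))"
        by (simp add: e)
      moreover have "(\<lambda>i. ennreal (\<Sum>k. measure (P k) (B i))) sums (\<Sum>i. ennreal (\<Sum>k. measure (P k) (B i)))"
        by (rule summable_sums) simp
      ultimately show "(\<lambda>i. \<Sum>k. measure (P k) (B i)) sums (\<Sum>k. measure (P k) (\<Union>i. B i))"
        by (simp add: suminf_nonneg sm)
    qed (auto intro: suminf_nonneg sm simp: measure_notin_sets'[OF P(2)])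
    then show ?thesis using sm by (intro exI[of _ N]) (auto intro: summable_sums)
  qed
  note H = signed_measure_Hahn[OF sW, unfolded is_Hahn_set_def]
  have "measure (pos_part M (W (Suc k))) A \<le> 2 * (1/2) ^ k" "measure (neg_part M (W (Suc k))) A \<le> 2 * (1/2) ^ k" for k A
  proof -
    have "measure (pos_part M (W (Suc k))) A \<le> 2 * (1/2) ^ k \<and> measure (neg_part M (W (Suc k))) A \<le> 2 * (1/2) ^ k"
    proof (cases "A \<in> sets M")
      case True
      then show ?thesis
        using W_le[of k "A \<inter> Hahn_set M (W (Suc k))"] W_le[of k "A - Hahn_set M (W (Suc k))"]
        unfolding measure_pos_part[OF sW True] measure_neg_part[OF sW True] by linarith
    qed (simp add: measure_notin_sets'[OF sets_pos_part[OF sW]] measure_notin_sets'[OF sets_neg_part[OF sW]])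
    then show "measure (pos_part M (W (Suc k))) A \<le> 2 * (1/2) ^ k" "measure (neg_part M (W (Suc k))) A \<le> 2 * (1/2) ^ k"
      by auto
  qed
  with *[of "\<lambda>k. pos_part M (W k)"] *[of "\<lambda>k. neg_part M (W k)"]
  obtain N1 N2 where N: "finite_measure N1" "finite_measure N2" "sets N1 = sets M" "sets N2 = sets M"
    "\<And>A. (\<lambda>k. measure (pos_part M (W k)) A) sums measure N1 A"
    "\<And>A. (\<lambda>k. measure (neg_part M (W k)) A) sums measure N2 A"
    using finite_measure_pos_part[OF sW] finite_measure_neg_part[OF sW] sets_pos_part[OF sW] sets_neg_part[OF sW] by metis
  have "L A = measure N1 A - measure N2 A" for A
  proof (cases "A \<in> sets M")
    case True
    then have "(\<lambda>k. W k A) sums (measure N1 A - measure N2 A)"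
      using sums_diff[OF N(5,6), of A A] by (simp add: measure_pos_neg[OF sW])
    then show ?thesis using sumsW sums_unique2 by blast
  next
    case False
    then have "(\<lambda>k. W k A) sums 0" by (simp add: signed_measure_off[OF sW])
    then have "L A = 0" using sumsW sums_unique2 by blast
    then show ?thesis using False by (simp add: measure_notin_sets'[OF N(3)] measure_notin_sets'[OF N(4)])
  qed
  then show ?thesis using N(1-4) by (intro signed_measureI[of N1 N2]) auto
qed

text \<open>The norm dominates all values uniformly in structure and set. A Cauchy sequence thus
  converges uniformly, which keeps the limit a signed measure at each structure and also gives
  convergence in norm.\<close>

instance smeasure :: (comm_monoid_add) banach
proof
  fix X :: "nat \<Rightarrow> 'a smeasure"
  assume X: "Cauchy X"
  have diff_le: "\<bar>Rep_smeasure (X m) M A - Rep_smeasure (X n) M A\<bar> \<le> norm (X m - X n)" for m n M A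
    using abs_Rep_smeasure_le[of "X m - X n" M A] by (simp add: minus_smeasure.rep_eq)
  have "convergent (\<lambda>n. Rep_smeasure (X n) M A)" for M A
  proof (rule Cauchy_convergent, rule CauchyI)
    fix e :: real assume "0 < e"
    then obtain N where "\<forall>m\<ge>N. \<forall>n\<ge>N. norm (X m - X n) < e" using X CauchyD by blast
    then show "\<exists>N. \<forall>m\<ge>N. \<forall>n\<ge>N. norm (Rep_smeasure (X m) M A - Rep_smeasure (X n) M A) < e"
      using diff_le by (smt (verit) real_norm_def)
  qed
  then obtain L where L: "\<And>M A. (\<lambda>n. Rep_smeasure (X n) M A) \<longlonglongrightarrow> L M A"
    unfolding convergent_def by metis
  have unif: "\<exists>N. \<forall>n\<ge>N. \<forall>M A. \<bar>Rep_smeasure (X n) M A - L M A\<bar> \<le> e" if "0 < e" for e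
  proof -
    obtain N where N: "\<And>m n. m \<ge> N \<Longrightarrow> n \<ge> N \<Longrightarrow> norm (X m - X n) < e" using X CauchyD \<open>0 < e\<close> by blast
    have "\<bar>Rep_smeasure (X n) M A - L M A\<bar> \<le> e" if "n \<ge> N" for n M A
    proof (rule LIMSEQ_le_const2)
      show "(\<lambda>m. \<bar>Rep_smeasure (X n) M A - Rep_smeasure (X m) M A\<bar>) \<longlonglongrightarrow> \<bar>Rep_smeasure (X n) M A - L M A\<bar>"
        by (intro tendsto_intros L)
      show "\<exists>N. \<forall>m\<ge>N. \<bar>Rep_smeasure (X n) M A - Rep_smeasure (X m) M A\<bar> \<le> e"
        using N[OF that] diff_le[of n M A] by (intro exI[of _ N]) (metis less_le order_trans)
    qed
    then show ?thesis by blast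
  qed
  obtain K where K: "\<And>n. norm (X n) \<le> K" using Cauchy_Bseq[OF X] by (auto simp: Bseq_def)
  have fam: "is_family L"
  proof (rule is_familyI)
    fix M :: "'a measure" and A
    show "\<bar>L M A\<bar> \<le> K"
      by (rule LIMSEQ_le_const2[OF tendsto_rabs[OF L]])
         (intro exI[of _ 0] allI impI order_trans[OF abs_Rep_smeasure_le K])
    show "signed_measure M (L M)" if "measurable_abelian_semigroup M"
    proof (rule signed_measure_uniform_limit[of M "\<lambda>n. Rep_smeasure (X n) M"])
      fix e :: real assume "0 < e"
      from unif[OF this] obtain N where "\<forall>n\<ge>N. \<forall>M A. \<bar>Rep_smeasure (X n) M A - L M A\<bar> \<le> e" ..
      then have "\<forall>A. \<bar>Rep_smeasure (X N) M A - L M A\<bar> \<le> e" by simp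
      then show "\<exists>n. \<forall>A. \<bar>Rep_smeasure (X n) M A - L M A\<bar> \<le> e" ..
    qed (rule signed_measure_Rep[OF that])
    show "L M A = 0" if "\<not> measurable_abelian_semigroup M"
      using L[of M A] by (simp add: is_familyD(2)[OF Rep_smeasure_family that] LIMSEQ_const_iff)
  qed
  define Y where "Y = Abs_smeasure L"
  have Y: "Rep_smeasure Y = L" unfolding Y_def by (rule Abs_smeasure_inverse) (simp add: fam)
  have "X \<longlonglongrightarrow> Y"
  proof (rule LIMSEQ_I)
    fix r :: real assume r: "0 < r"
    then obtain N where N: "\<And>n M A. n \<ge> N \<Longrightarrow> \<bar>Rep_smeasure (X n) M A - L M A\<bar> \<le> r / 4" using unif[of "r/4"] by auto
    have "norm (X n - Y) < r" if "n \<ge> N" for n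
    proof -
      have "norm (X n - Y) \<le> r / 2"
      proof (rule norm_smeasure_le)
        fix M A
        show "\<bar>Rep_smeasure (X n - Y) M A - Rep_smeasure (X n - Y) M (UNIV - A)\<bar> \<le> r / 2"
          using N[OF that, of M A] N[OF that, of M "UNIV - A"] unfolding minus_smeasure.rep_eq Y by linarith
      qed (use r in simp)
      then show ?thesis using r by simp
    qed
    then show "\<exists>no. \<forall>n\<ge>no. norm (X n - Y) < r" by blast
  qed
  then show "convergent X" unfolding convergent_def by blast
qed

section \<open>Translation between set functions and elements of the algebra\<close>

context measurable_abelian_semigroup
begin

lemma Rep_mult: "Rep_smeasure (X * Y) M = conv M (Rep_smeasure X M) (Rep_smeasure Y M)"
  by (simp add: times_smeasure.rep_eq measurable_abelian_semigroup_axioms)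

lemma Rep_one: "Rep_smeasure 1 M = dirac M 0"
  by (simp add: one_smeasure.rep_eq measurable_abelian_semigroup_axioms)

lemma Rep_power: "Rep_smeasure (X ^ m) M = conv_power M (Rep_smeasure X M) m"
  by (induction m) (simp_all add: Rep_one Rep_mult)

lemma bounded_linear_Rep: "bounded_linear (\<lambda>X. Rep_smeasure X M A)"
  by (rule bounded_linear_intro[of _ 1])
     (simp_all add: plus_smeasure.rep_eq scaleR_smeasure.rep_eq abs_Rep_smeasure_le)

lemma Rep_sum: "Rep_smeasure (sum X I) M A = (\<Sum>i\<in>I. Rep_smeasure (X i) M A)"
  by (rule linear_sum[OF bounded_linear.linear[OF bounded_linear_Rep]])

lemma Rep_exp: "Rep_smeasure (exp X) M = conv_exp M (Rep_smeasure X M)"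
proof
  fix A
  have "(\<lambda>m. Rep_smeasure (X ^ m /\<^sub>R fact m) M A) sums Rep_smeasure (exp X) M A"
    by (rule bounded_linear.sums[OF bounded_linear_Rep exp_converges])
  then show "Rep_smeasure (exp X) M A = conv_exp M (Rep_smeasure X M) A"
    unfolding conv_exp_def by (simp add: scaleR_smeasure.rep_eq Rep_power sums_iff divide_inverse mult.commute)
qed

lemma conv_prod_Rep:
  assumes "finite J" "\<And>j. j \<in> J \<Longrightarrow> V j = Rep_smeasure (X j) M"
  shows "conv_prod M V J = Rep_smeasure (\<Prod>j\<in>J. X j) M"
proof -
  have "foldr (\<lambda>j. conv M (V j)) xs (dirac M 0) = Rep_smeasure (prod_list (map X xs)) M"
    if "set xs \<subseteq> J" for xs
    using that by (induction xs) (simp_all add: Rep_one Rep_mult assms(2))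
  then show ?thesis
    using assms(1) by (simp add: conv_prod_def prod.distinct_set_conv_list[symmetric])
qed

definition expect :: "'a smeasure \<Rightarrow> ('a \<Rightarrow> real) \<Rightarrow> real" where
  "expect X h = signed_integral M (Rep_smeasure X M) h"

lemma
  assumes h: "h \<in> borel_measurable M" "\<And>x. \<bar>h x\<bar> \<le> K"
  shows expect_bound: "\<bar>expect X h\<bar> \<le> K * norm X"
    and measurable_expect: "(\<lambda>x. expect X (\<lambda>y. h (x + y))) \<in> borel_measurable M"
proof -
  note s = signed_measure_Rep[OF measurable_abelian_semigroup_axioms]
  have "0 \<le> K" using h(2)[of undefined] by linarith
  then show "\<bar>expect X h\<bar> \<le> K * norm X"
    unfolding expect_def using signed_integral_bound[OF s h, of X]
      mult_left_mono[OF tv_norm_le_norm[OF measurable_abelian_semigroup_axioms, of X]] by force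
  show "(\<lambda>x. expect X (\<lambda>y. h (x + y))) \<in> borel_measurable M"
    unfolding expect_def by (rule measurable_signed_integral_translate[OF s s h])
qed

lemma
  assumes "bounded_measurable M h"
  shows expect_mult: "expect (X * Y) h = expect Y (\<lambda>x. expect X (\<lambda>y. h (x + y)))"
    and expect_add: "expect (X + Y) h = expect X h + expect Y h"
    and expect_diff: "expect (X - Y) h = expect X h - expect Y h"
    and expect_scaleR: "expect (r *\<^sub>R X) h = r * expect X h"
    and expect_one: "expect 1 h = h 0"
    and expect_zero: "expect 0 h = 0"
    and expect_sum: "expect (\<Sum>i\<in>J. Z i) h = (\<Sum>i\<in>J. expect (Z i) h)"
    and bounded_measurable_expect: "bounded_measurable M (\<lambda>x. expect X (\<lambda>y. h (x + y)))"
proof -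
  obtain C where h: "h \<in> borel_measurable M" "\<And>x. \<bar>h x\<bar> \<le> C"
    using assms unfolding bounded_measurable_def by blast
  note s = signed_measure_Rep[OF measurable_abelian_semigroup_axioms]
  show "expect (X * Y) h = expect Y (\<lambda>x. expect X (\<lambda>y. h (x + y)))"
    unfolding expect_def Rep_mult by (rule signed_integral_conv[OF s s h])
  show add: "expect (X + Y) h = expect X h + expect Y h" for X Y
    using signed_integral_linear[OF s s h, of 1 X 1 Y] by (simp add: expect_def plus_smeasure.rep_eq[abs_def])
  show "expect (X - Y) h = expect X h - expect Y h"
    using signed_integral_linear[OF s s h, of 1 X "-1" Y] by (simp add: expect_def minus_smeasure.rep_eq[abs_def])
  show scale: "expect (r *\<^sub>R X) h = r * expect X h" for r X
    using signed_integral_linear[OF s s h, of r X 0 X] by (simp add: expect_def scaleR_smeasure.rep_eq[abs_def])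
  show "expect 1 h = h 0"
    unfolding expect_def Rep_one by (rule signed_integral_dirac[OF h])
  show zero: "expect 0 h = 0" using scale[of 0 0] by simp
  show "expect (\<Sum>i\<in>J. Z i) h = (\<Sum>i\<in>J. expect (Z i) h)"
    by (induction J rule: infinite_finite_induct) (auto simp: zero add)
  show "bounded_measurable M (\<lambda>x. expect X (\<lambda>y. h (x + y)))"
    by (rule bounded_measurableI[OF measurable_expect[OF h] expect_bound[OF measurable_translate[OF h(1)] h(2)]])
qed

text \<open>At the structures other than \<open>M\<close> a measure is replaced by its total mass, so that
  total masses can be treated as scalars of the algebra.\<close>

definition embed :: "'a measure \<Rightarrow> 'a smeasure" where
  "embed N = Abs_smeasure (\<lambda>M' A. if M' = M then measure N A
     else if measurable_abelian_semigroup M' then measure N UNIV * dirac M' 0 A else 0)"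

lemma Rep_embed:
  assumes "finite_measure N" "sets N = sets M"
  shows "Rep_smeasure (embed N) M' A = (if M' = M then measure N A
     else if measurable_abelian_semigroup M' then measure N UNIV * dirac M' 0 A else 0)"
proof -
  have sp: "space N = UNIV" using sets_eq_imp_space_eq[OF assms(2)] by (simp add: space_eq_UNIV)
  have "is_family (\<lambda>M' A. if M' = M then measure N A
     else if measurable_abelian_semigroup M' then measure N UNIV * dirac M' 0 A else 0)"
  proof (rule is_familyI)
    fix M' :: "'a measure" and A
    have "measure N A \<le> measure N UNIV"
      using finite_measure.bounded_measure[OF assms(1)] by (simp add: sp)
    then show "\<bar>if M' = M then measure N A
       else if measurable_abelian_semigroup M' then measure N UNIV * dirac M' 0 A else 0\<bar> \<le> measure N UNIV"
      using mult_left_mono[OF abs_dirac_le[of M' 0 A], of "measure N UNIV"] by (auto simp: abs_mult)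
    assume M': "measurable_abelian_semigroup M'"
    show "signed_measure M' (\<lambda>A. if M' = M then measure N A
       else if measurable_abelian_semigroup M' then measure N UNIV * dirac M' 0 A else 0)"
      using signed_measure_linear[OF measurable_abelian_semigroup.signed_measure_dirac[OF M']
          measurable_abelian_semigroup.signed_measure_dirac[OF M'], of "measure N UNIV" 0 0 0]
        signed_measure_measure[OF assms] M' by (cases "M' = M") auto
  qed (use measurable_abelian_semigroup_axioms in auto)
  then show ?thesis by (simp add: embed_def Abs_smeasure_inverse)
qed

lemma Rep_embed_M: "finite_measure N \<Longrightarrow> sets N = sets M \<Longrightarrow> Rep_smeasure (embed N) M = measure N"
  by (simp add: Rep_embed fun_eq_iff)

lemma norm_embed:
  assumes "finite_measure N" "sets N = sets M"
  shows "norm (embed N) \<le> measure N UNIV"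
proof (rule norm_smeasure_le)
  have sp: "space N = UNIV" using sets_eq_imp_space_eq[OF assms(2)] by (simp add: space_eq_UNIV)
  fix M' :: "'a measure" and A assume M': "measurable_abelian_semigroup M'" "A \<in> sets M'"
  have c: "UNIV - A \<in> sets M'"
    using sets.compl_sets[OF M'(2)] by (simp add: measurable_abelian_semigroup.space_eq_UNIV[OF M'(1)])
  show "\<bar>Rep_smeasure (embed N) M' A - Rep_smeasure (embed N) M' (UNIV - A)\<bar> \<le> measure N UNIV"
  proof (cases "M' = M")
    case True
    then have "A \<in> sets N" using M' assms by simp
    from finite_measure.finite_measure_compl[OF assms(1) this]
    have "measure N (UNIV - A) = measure N UNIV - measure N A" by (simp add: sp)
    moreover have "measure N A \<le> measure N UNIV"
      using finite_measure.bounded_measure[OF assms(1), of A] by (simp add: sp)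
    ultimately show ?thesis
      using measure_nonneg[of N A] unfolding True Rep_embed_M[OF assms] by linarith
  next
    case False
    then show ?thesis using M' c
      by (auto simp: Rep_embed[OF assms] dirac_def measure_return indicator_def)
  qed
qed simp

text \<open>A relation between measures passes to their total masses at \<open>A = UNIV\<close>.
  Since \<open>embed\<close> carries exactly these masses at all other structures, the relation
  holds in the whole algebra.\<close>

lemma embed_sum:
  assumes "finite J" "finite_measure N" "sets N = sets M"
    "\<And>j. j \<in> J \<Longrightarrow> finite_measure (L j)" "\<And>j. j \<in> J \<Longrightarrow> sets (L j) = sets M"
    "\<And>A. A \<in> sets M \<Longrightarrow> a * measure N A = (\<Sum>j\<in>J. c j * measure (L j) A)"
  shows "a *\<^sub>R embed N = (\<Sum>j\<in>J. c j *\<^sub>R embed (L j))"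
proof (rule smeasure_eqI)
  fix M' :: "'a measure" assume M': "measurable_abelian_semigroup M'"
  have U: "UNIV \<in> sets M" using sets.top[of M] by (simp add: space_eq_UNIV)
  have eq: "a * measure N A = (\<Sum>j\<in>J. c j * measure (L j) A)" for A
    using assms by (cases "A \<in> sets M") (auto simp: measure_notin_sets')
  show "Rep_smeasure (a *\<^sub>R embed N) M' = Rep_smeasure (\<Sum>j\<in>J. c j *\<^sub>R embed (L j)) M'"
    using M' assms(2-5) eq
    by (cases "M' = M") (simp_all add: fun_eq_iff measurable_abelian_semigroup.Rep_sum scaleR_smeasure.rep_eq
      Rep_embed sum_distrib_right mult.assoc[symmetric])
qed

lemma expect_embed:
  assumes "finite_measure N" "sets N = sets M" "h \<in> borel_measurable M" "\<And>x. \<bar>h x\<bar> \<le> K"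
  shows "expect (embed N) h = integral\<^sup>L N h"
  unfolding expect_def Rep_embed_M[OF assms(1,2)] by (rule signed_integral_measure[OF assms])

text \<open>Centred elements live at \<open>M\<close> alone. A product with one such factor vanishes
  at every other structure, so that its norm is decided by the component at
  \<open>M\<close>.\<close>

lemma Rep_embed_diff_other:
  assumes "finite_measure N" "sets N = sets M" "M' \<noteq> M"
  shows "Rep_smeasure (embed N - measure N UNIV *\<^sub>R 1) M' A = 0"
  by (simp add: minus_smeasure.rep_eq scaleR_smeasure.rep_eq one_smeasure.rep_eq Rep_embed[OF assms(1,2)] assms(3))

end

section \<open>Estimates in commutative Banach algebras\<close>

text \<open>In the expansion of the k-th power of the sum, the product over each set of size k
  occurs \<open>fact k\<close> times. The induction keeps only the two lowest powers of
  \<open>x a\<close> in the binomial expansion after adding the element \<open>a\<close>.\<close>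

lemma sum_prod_subsets_le:
  fixes x :: "'i \<Rightarrow> real"
  assumes "finite I" "\<And>i. i \<in> I \<Longrightarrow> 0 \<le> x i"
  shows "(\<Sum>J | J \<subseteq> I \<and> card J = k. \<Prod>j\<in>J. x j) \<le> (\<Sum>i\<in>I. x i) ^ k / fact k"
  using assms
proof (induction I arbitrary: k rule: finite_induct)
  case empty
  have "{J :: 'i set. J = {} \<and> card J = k} = (if k = 0 then {{}} else {})" by auto
  then show ?case by (cases k) auto
next
  case (insert a I)
  let ?S = "\<lambda>I k. {J. J \<subseteq> I \<and> card J = k}"
  have fin: "finite (?S I k)" for k using insert.hyps by simp
  show ?case
  proof (cases k)
    case 0
    have "?S (insert a I) 0 = {{}}" using insert.hyps by (auto dest: finite_subset)
    then show ?thesis using 0 by simp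
  next
    case (Suc m)
    have eq: "?S (insert a I) (Suc m) = ?S I (Suc m) \<union> insert a ` ?S I m"
    proof (intro equalityI subsetI)
      fix J assume J: "J \<in> ?S (insert a I) (Suc m)"
      then have fJ: "finite J" using insert.hyps finite_subset by auto
      show "J \<in> ?S I (Suc m) \<union> insert a ` ?S I m"
      proof (cases "a \<in> J")
        case True
        then have "J = insert a (J - {a})" "J - {a} \<in> ?S I m" using J fJ by auto
        then show ?thesis by blast
      qed (use J in auto)
    next
      fix J assume "J \<in> ?S I (Suc m) \<union> insert a ` ?S I m"
      then show "J \<in> ?S (insert a I) (Suc m)"
        using insert.hyps finite_subset[of _ I] by (auto simp: card_insert_if)
    qed
    have inj: "inj_on (insert a) (?S I m)" using insert.hyps by (auto simp: inj_on_def)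
    let ?s = "\<Sum>i\<in>I. x i"
    have s0: "0 \<le> ?s" and a0: "0 \<le> x a" using insert.prems by (auto intro: sum_nonneg)
    have "(\<Sum>J\<in>?S (insert a I) (Suc m). \<Prod>j\<in>J. x j) =
        (\<Sum>J\<in>?S I (Suc m). \<Prod>j\<in>J. x j) + (\<Sum>J\<in>insert a ` ?S I m. \<Prod>j\<in>J. x j)"
      unfolding eq using insert.hyps fin by (intro sum.union_disjoint) auto
    also have "(\<Sum>J\<in>insert a ` ?S I m. \<Prod>j\<in>J. x j) = (\<Sum>J\<in>?S I m. x a * (\<Prod>j\<in>J. x j))"
      using insert.hyps finite_subset[of _ I] by (subst sum.reindex[OF inj]) (auto intro!: sum.cong prod.insert)
    also have "\<dots> = x a * (\<Sum>J\<in>?S I m. \<Prod>j\<in>J. x j)" by (simp add: sum_distrib_left)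
    also have "(\<Sum>J\<in>?S I (Suc m). \<Prod>j\<in>J. x j) + x a * (\<Sum>J\<in>?S I m. \<Prod>j\<in>J. x j) \<le>
        ?s ^ Suc m / fact (Suc m) + x a * (?s ^ m / fact m)"
      using insert by (intro add_mono mult_left_mono insert.IH) auto
    also have "\<dots> = (?s ^ Suc m + real (Suc m) * (x a * ?s ^ m)) / fact (Suc m)"
      by (simp add: add_divide_distrib del: of_nat_Suc)
    also have "?s ^ Suc m + real (Suc m) * (x a * ?s ^ m) \<le> (x a + ?s) ^ Suc m"
    proof -
      have e: "?s ^ Suc m + real (Suc m) * (x a * ?s ^ m) =
          (\<Sum>i\<in>{0,1}. of_nat (Suc m choose i) * x a ^ i * ?s ^ (Suc m - i))"
        by simp
      show ?thesis unfolding e binomial_ring[of "x a" ?s "Suc m"]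
        using s0 a0 by (intro sum_mono2) auto
    qed
    finally show ?thesis using Suc insert.hyps by (simp add: divide_right_mono)
  qed
qed

lemma sum_card_eq_sum_Pow:
  fixes n :: nat
  assumes "finite I" "card I = n"
  shows "(\<Sum>k\<le>n. \<Sum>J | J \<subseteq> I \<and> card J = k. f J) = (\<Sum>J\<in>Pow I. f J)"
proof -
  have "(\<Sum>J\<in>Pow I. f J) = (\<Sum>k\<in>{..n}. \<Sum>J\<in>{J \<in> Pow I. card J = k}. f J)"
    using assms card_mono[OF assms(1)] by (intro sum.group[symmetric]) auto
  then show ?thesis by (simp add: Pow_def conj_commute)
qed

lemma exp_scaleR_one: "exp (r *\<^sub>R (1::'b::{real_normed_algebra_1,banach})) = exp r *\<^sub>R 1"
  using exp_of_real[of r, where 'a='b] by (simp add: of_real_def)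

text \<open>Since 1 commutes with \<open>Q\<close>, the element equals exp(-t) exp(t Q), and the
  norm of the second factor is at most exp(t).\<close>

lemma norm_exp_contraction:
  fixes Q :: "'b::{real_normed_algebra_1,banach,comm_ring_1}"
  assumes "norm Q \<le> 1" "0 \<le> t"
  shows "norm (exp (t *\<^sub>R (Q - 1))) \<le> 1"
proof -
  have "exp (t *\<^sub>R (Q - 1)) = exp (t *\<^sub>R Q) * exp ((- t) *\<^sub>R 1)"
    by (subst exp_add_commuting[symmetric]) (simp_all add: algebra_simps)
  also have "\<dots> = exp (- t) *\<^sub>R exp (t *\<^sub>R Q)"
    unfolding exp_scaleR_one by simp
  finally have "norm (exp (t *\<^sub>R (Q - 1))) = exp (- t) * norm (exp (t *\<^sub>R Q))" by simp
  also have "norm (exp (t *\<^sub>R Q)) \<le> exp (norm (t *\<^sub>R Q))" by (rule norm_exp)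
  also have "exp (norm (t *\<^sub>R Q)) \<le> exp t" using assms by (simp add: mult_left_le)
  finally show ?thesis by (simp add: exp_minus)
qed

section \<open>Power series for the factors of the expansion\<close>

lemma power_series_factor:
  fixes x :: "'b::{real_normed_algebra_1,banach,comm_ring_1}"
  assumes s: "(\<lambda>i. c i *\<^sub>R x ^ i) sums s" and c01: "c 0 = 0" "c 1 = 0"
    and d: "d sums K" "\<And>m. \<bar>c (m + 2)\<bar> * r ^ m \<le> d m" and x: "norm x \<le> r"
  obtains w where "s = x\<^sup>2 * w" "norm w \<le> K"
proof -
  have le: "norm (c (m + 2) *\<^sub>R x ^ m) \<le> d m" for m
  proof -
    have "norm (c (m + 2) *\<^sub>R x ^ m) \<le> \<bar>c (m + 2)\<bar> * r ^ m"
      using x by (auto intro!: mult_left_mono order_trans[OF norm_power_ineq] power_mono)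
    then show ?thesis using d(2)[of m] by linarith
  qed
  note sd = sums_summable[OF d(1)]
  have sw: "summable (\<lambda>m. norm (c (m + 2) *\<^sub>R x ^ m))"
    by (rule summable_comparison_test[OF _ sd]) (use le in auto)
  define w where "w = (\<Sum>m. c (m + 2) *\<^sub>R x ^ m)"
  have "norm w \<le> K"
    unfolding w_def sums_unique[OF d(1)] by (rule order_trans[OF summable_norm[OF sw] suminf_le[OF le sw sd]])
  moreover have "(\<lambda>m. c (m + 2) *\<^sub>R x ^ (m + 2)) sums s"
    using s sums_Suc_iff[of "\<lambda>i. c i *\<^sub>R x ^ i" s] sums_Suc_iff[of "\<lambda>i. c (Suc i) *\<^sub>R x ^ Suc i" s]
    by (simp add: c01 c01[unfolded One_nat_def])
  moreover have "(\<lambda>m. x\<^sup>2 * (c (m + 2) *\<^sub>R x ^ m)) sums (x\<^sup>2 * w)"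
    unfolding w_def by (intro sums_mult summable_sums summable_norm_cancel[OF sw])
  then have "(\<lambda>m. c (m + 2) *\<^sub>R x ^ (m + 2)) sums (x\<^sup>2 * w)"
    by (simp add: power2_eq_square algebra_simps)
  ultimately show ?thesis using that sums_unique2 by blast
qed

text \<open>The second series is the first one multiplied by \<open>x\<close> and shifted; at i = 0
  the truncated exponent \<open>i - 1\<close> is harmless, since the coefficient is 0.\<close>

lemma exp_scaleR_sums:
  fixes x :: "'b::{real_normed_algebra_1,banach,comm_ring_1}"
  shows "(\<lambda>i. (t ^ i / fact i) *\<^sub>R x ^ i) sums exp (t *\<^sub>R x)"
    and "(\<lambda>i. (real i * t ^ (i - 1) / fact i) *\<^sub>R x ^ i) sums (x * exp (t *\<^sub>R x))"
proof -
  show *: "(\<lambda>i. (t ^ i / fact i) *\<^sub>R x ^ i) sums exp (t *\<^sub>R x)"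
    using exp_converges[of "t *\<^sub>R x"] by (simp add: divide_inverse mult.commute)
  from sums_mult[OF this, of x]
  have "(\<lambda>i. (real (Suc i) * t ^ (Suc i - 1) / fact (Suc i)) *\<^sub>R x ^ Suc i) sums (x * exp (t *\<^sub>R x))"
    by (simp del: of_nat_Suc)
  then show "(\<lambda>i. (real i * t ^ (i - 1) / fact i) *\<^sub>R x ^ i) sums (x * exp (t *\<^sub>R x))"
    by (subst (asm) sums_Suc_iff) simp
qed

lemma g_sums:
  assumes r: "0 \<le> r"
  shows "(\<lambda>m. (real (m + 2) - 1) / fact (m + 2) * r ^ m) sums (g r / 2)"
proof -
  define d where "d = (\<lambda>m. (real (m + 2) - 1) / fact (m + 2) * r ^ m)"
  have "summable d"
  proof (rule summable_comparison_test)
    show "summable (\<lambda>m. r ^ m /\<^sub>R fact m)" using exp_converges[of r] by (rule sums_summable)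
    have "\<bar>d m\<bar> \<le> r ^ m /\<^sub>R fact m" for m
    proof -
      have "fact (m + 2) = (real m + 2) * (real m + 1) * fact m" by (simp add: algebra_simps)
      moreover have "a / (b * a * c) = 1 / c / b" if "a \<noteq> 0" for a b c :: real using that by simp
      ultimately have "(real (m + 2) - 1) / fact (m + 2) = 1 / fact m / (real m + 2)" by simp
      also have "\<dots> \<le> 1 / fact m / 1" by (intro divide_left_mono) auto
      finally have "(real (m + 2) - 1) / fact (m + 2) \<le> 1 / fact m" by (simp only: div_by_1)
      then have "d m \<le> 1 / fact m * r ^ m" unfolding d_def using r by (intro mult_right_mono) auto
      moreover have "0 \<le> d m" by (simp add: d_def r)
      ultimately show ?thesis by (simp add: divide_inverse)
    qed
    then show "\<exists>N. \<forall>m\<ge>N. norm (d m) \<le> r ^ m /\<^sub>R fact m" by auto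
  qed
  then show ?thesis by (simp add: g_def d_def summable_sums)
qed

text \<open>The coefficient of R^(m+2) in (1 + R) exp(-R) is (-1)^(m+1) (m+1)/(m+2)!. Summing the
  absolute values at radius \<open>r\<close> gives half of the defining series of \<open>g\<close>,
  which is where \<open>g\<close> comes from.\<close>

lemma kerstan_factor:
  fixes R :: "'b::{real_normed_algebra_1,banach,comm_ring_1}"
  assumes "norm R \<le> r"
  obtains w where "(1 + R) * exp (- R) - 1 = R\<^sup>2 * w" "norm w \<le> g r / 2"
proof -
  define c :: "nat \<Rightarrow> real" where
    "c = (\<lambda>i. (-1) ^ i / fact i + real i * (-1) ^ (i - 1) / fact i - (if i = 0 then 1 else 0))"
  have r: "0 \<le> r" using assms norm_ge_zero order_trans by blast
  have 1: "(\<lambda>i. (if i = 0 then 1 else 0 :: real) *\<^sub>R R ^ i) sums 1"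
  proof -
    have "(\<lambda>i. (if i = 0 then 1 else 0 :: real) *\<^sub>R R ^ i) = (\<lambda>i. if i = 0 then R ^ i else 0)" by auto
    then show ?thesis using sums_single[of 0 "\<lambda>i. R ^ i"] by simp
  qed
  have "(\<lambda>i. c i *\<^sub>R R ^ i) sums (exp ((-1) *\<^sub>R R) + R * exp ((-1) *\<^sub>R R) - 1)"
    unfolding c_def scaleR_diff_left scaleR_add_left by (intro sums_diff sums_add exp_scaleR_sums 1)
  then have s: "(\<lambda>i. c i *\<^sub>R R ^ i) sums ((1 + R) * exp (- R) - 1)"
    by (simp add: distrib_right)
  define d where "d = (\<lambda>m. (real (m + 2) - 1) / fact (m + 2) * r ^ m)"
  have c: "\<bar>c (m + 2)\<bar> * r ^ m \<le> d m" for m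
  proof -
    have "c (m + 2) = - ((-1) ^ m * ((real (m + 2) - 1) / fact (m + 2)))"
      by (simp add: c_def diff_divide_distrib add_divide_distrib algebra_simps del: fact_Suc of_nat_Suc)
    then show ?thesis by (simp add: d_def abs_mult power_abs)
  qed
  have "d sums (g r / 2)" unfolding d_def by (rule g_sums[OF r])
  moreover have "c 0 = 0" "c 1 = 0" by (simp_all add: c_def)
  ultimately show ?thesis
    using power_series_factor[OF s _ _ _ c assms] that by metis
qed

text \<open>The absolute values of the coefficients of \<open>w\<close>, weighted with \<open>2\<^sup>m\<close>, sum to at most
  \<open>(e - 1)/2 - 1/12 < 777/1000\<close>.\<close>

lemma kerstan_factor_half:
  fixes R :: "'b::{real_normed_algebra_1,banach,comm_ring_1}"
  assumes "norm R \<le> 2"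
  obtains w where "(1 + R) * exp (- R) - 1 = exp ((-1/2) *\<^sub>R R) * (R\<^sup>2 * w)" "norm w \<le> 777 / 1000"
proof -
  \<comment> \<open>Coefficients of (1 + R) exp(-R/2) - exp(R/2), that is, of the element in
    question multiplied by exp(R/2).\<close>
  define c :: "nat \<Rightarrow> real" where
    "c = (\<lambda>i. (-1/2) ^ i / fact i + real i * (-1/2) ^ (i - 1) / fact i - (1/2) ^ i / fact i)"
  have "(\<lambda>i. c i *\<^sub>R R ^ i) sums (exp ((-1/2) *\<^sub>R R) + R * exp ((-1/2) *\<^sub>R R) - exp ((1/2) *\<^sub>R R))"
    unfolding c_def scaleR_diff_left scaleR_add_left by (intro sums_diff sums_add exp_scaleR_sums)
  then have s: "(\<lambda>i. c i *\<^sub>R R ^ i) sums ((1 + R) * exp ((-1/2) *\<^sub>R R) - exp ((1/2) *\<^sub>R R))"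
    by (simp add: distrib_right)
  \<comment> \<open>For even m the weighted coefficient is exactly 1/(2 (m+1)!), for odd m it is
    smaller by the factor (m+1)/(m+2). Keeping this gain at m = 1 only, where it is 1/4 - 1/6 =
    1/12, suffices.\<close>
  define d :: "nat \<Rightarrow> real" where "d = (\<lambda>m. 1 / 2 * (1 / fact (Suc m)) - (if m = 1 then 1 / 12 else 0))"
  have c: "\<bar>c (m + 2)\<bar> * 2 ^ m \<le> d m" for m
  proof -
    have f: "fact (m + 2) = (real m + 2) * fact (Suc m)" by (simp add: algebra_simps)
    have "c (m + 2) * 2 ^ m = ((-1) ^ m * (1 - 2 * real (m + 2)) - 1) / (4 * fact (m + 2))"
    proof -
      have gen: "(X / P / 4 / F + r * (- (X / P / 2)) / F - 1 / P / 4 / F) * P = (X * (1 - 2 * r) - 1) / (4 * F)"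
        if "P \<noteq> 0" "F \<noteq> 0" for X P F r :: real using that by (simp add: field_simps)
      have "(-1/2::real) ^ m = (-1) ^ m / 2 ^ m" by (rule power_divide)
      then have 1: "(-1/2::real) ^ (m + 2) = (-1) ^ m / 2 ^ m / 4"
        and 2: "(-1/2::real) ^ (m + 2 - 1) = - ((-1) ^ m / 2 ^ m / 2)"
        and 3: "(1/2::real) ^ (m + 2) = 1 / 2 ^ m / 4" by (simp_all add: power_divide)
      show ?thesis
        unfolding c_def 1 2 3 by (rule gen) simp_all
    qed
    moreover have "\<bar>c (m + 2)\<bar> * 2 ^ m = \<bar>c (m + 2) * 2 ^ m\<bar>" by (simp add: abs_mult)
    moreover have "\<bar>y / (4 * fact (m + 2))\<bar> = \<bar>y\<bar> / (4 * fact (m + 2))" for y :: real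
      by (simp only: abs_divide abs_mult abs_numeral abs_of_nonneg[OF fact_ge_zero])
    ultimately have e: "\<bar>c (m + 2)\<bar> * 2 ^ m = \<bar>(-1) ^ m * (1 - 2 * real (m + 2)) - 1\<bar> / (4 * fact (m + 2))"
      by (simp only:)
    show ?thesis
    proof (cases "even m")
      case True
      then have "\<bar>c (m + 2)\<bar> * 2 ^ m = 1 / 2 * (1 / fact (Suc m))"
        unfolding e f by (simp add: divide_simps del: fact_Suc)
      then show ?thesis using True by (auto simp: d_def)
    next
      case False
      then have "\<bar>c (m + 2)\<bar> * 2 ^ m = (2 * real m + 2) / (4 * ((real m + 2) * fact (Suc m)))"
        unfolding e f by simp
      also have "\<dots> = 1 / 2 * (1 / fact (Suc m)) * ((real m + 1) / (real m + 2))"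
        by (simp add: divide_simps del: fact_Suc) (simp add: algebra_simps)
      finally have e2: "\<bar>c (m + 2)\<bar> * 2 ^ m = 1 / 2 * (1 / fact (Suc m)) * ((real m + 1) / (real m + 2))" .
      show ?thesis
      proof (cases "m = 1")
        case True
        then show ?thesis unfolding e2 by (simp add: d_def)
      next
        case False
        have "1 / 2 * (1 / fact (Suc m)) * ((real m + 1) / (real m + 2)) \<le> 1 / 2 * (1 / fact (Suc m)) * 1"
          by (intro mult_left_mono) auto
        then show ?thesis unfolding e2 using False by (simp add: d_def)
      qed
    qed
  qed
  have "(\<lambda>m. 1 / fact m) sums exp (1::real)" using exp_converges[of "1::real"] by (simp add: divide_inverse)
  then have "(\<lambda>m. 1 / fact (Suc m)) sums (exp 1 - 1 :: real)" by (subst sums_Suc_iff) simp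
  then have "d sums (1 / 2 * (exp 1 - 1) - 1 / 12)"
    unfolding d_def using sums_single[of 1 "\<lambda>m. 1 / 12 :: real"] by (intro sums_diff sums_mult) auto
  from power_series_factor[OF s _ _ this c assms]
  obtain w where w: "(1 + R) * exp ((-1/2) *\<^sub>R R) - exp ((1/2) *\<^sub>R R) = R\<^sup>2 * w"
    "norm w \<le> 1 / 2 * (exp 1 - 1) - 1 / 12" by (auto simp: c_def)
  have "exp ((-1/2) *\<^sub>R R) * exp ((-1/2) *\<^sub>R R) = exp (- R)" "exp ((-1/2) *\<^sub>R R) * exp ((1/2) *\<^sub>R R) = 1"
    by (simp_all add: exp_add_commuting[symmetric] scaleR_left_distrib[symmetric] del: scaleR_minus_left)
  then have "(1 + R) * exp (- R) - 1 = exp ((-1/2) *\<^sub>R R) * (R\<^sup>2 * w)"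
    unfolding w(1)[symmetric] by (simp add: right_diff_distrib mult.left_commute)
  moreover have "norm w \<le> 777 / 1000" proof -
    have "1 / 2 * (exp 1 - 1) - 1 / 12 \<le> (777 / 1000 :: real)" using e_less_272 by (simp add: field_simps)
    then show ?thesis by (rule order_trans[OF w(2)])
  qed
  ultimately show ?thesis using that by blast
qed

lemma norm_exp_remainder:
  fixes x :: "'b::{real_normed_algebra_1,banach}"
  assumes "norm x \<le> r"
  shows "norm (exp x - 1 - x) \<le> exp r - 1 - r"
proof -
  have "(\<lambda>i. x ^ (i + 2) /\<^sub>R fact (i + 2)) sums (exp x - 1 - x)"
    using sums_split_initial_segment[OF exp_converges[of x], of 2]
    by (simp add: numeral_2_eq_2 algebra_simps)
  moreover have "(\<lambda>i. r ^ (i + 2) /\<^sub>R fact (i + 2)) sums (exp r - 1 - r)"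
    using sums_split_initial_segment[OF exp_converges[of r], of 2]
    by (simp add: numeral_2_eq_2 algebra_simps)
  moreover have "norm (x ^ (i + 2) /\<^sub>R fact (i + 2)) \<le> r ^ (i + 2) /\<^sub>R fact (i + 2)" for i
  proof -
    have scale: "norm (c *\<^sub>R y) \<le> c *\<^sub>R K" if "0 \<le> c" "norm y \<le> K" for c K and y :: 'b
      using that by (simp add: mult_left_mono)
    have "norm (x ^ (i + 2)) \<le> norm x ^ (i + 2)" by (rule norm_power_ineq)
    also have "\<dots> \<le> r ^ (i + 2)" using assms by (intro power_mono) auto
    finally show ?thesis by (intro scale) simp_all
  qed
  ultimately show ?thesis using norm_sums_le by blast
qed

text \<open>Writing exp R = exp(-p) exp(p Q) and separating the coefficients of 1 and
  \<open>Q\<close> from the remainder \<open>T\<close>, the absolute values add up to 2 p (1 -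
  exp(-p)). This is the classical distance between a Bernoulli and a Poisson law, carried over to
  the algebra.\<close>

lemma norm_exp_defect:
  fixes Q :: "'b::{real_normed_algebra_1,banach,comm_ring_1}"
  assumes Q: "norm Q \<le> 1" and p: "0 \<le> p" "p \<le> 1" and R: "R = p *\<^sub>R (Q - 1)"
  shows "norm (1 + R - exp R) \<le> 2 * p\<^sup>2"
proof -
  define T where "T = exp (p *\<^sub>R Q) - 1 - p *\<^sub>R Q"
  have T: "norm T \<le> exp p - 1 - p"
    unfolding T_def using Q p by (intro norm_exp_remainder) (auto simp: mult_left_le)
  have "exp (p *\<^sub>R Q + (- p) *\<^sub>R 1) = exp (p *\<^sub>R Q) * exp ((- p) *\<^sub>R 1)"
    by (rule exp_add_commuting) simp
  moreover have "p *\<^sub>R Q + (- p) *\<^sub>R 1 = R" by (simp add: R algebra_simps)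
  ultimately have "exp R = exp (p *\<^sub>R Q) * (exp (- p) *\<^sub>R 1)" by (simp only: exp_scaleR_one)
  then have eR: "exp R = exp (- p) *\<^sub>R exp (p *\<^sub>R Q)" by simp
  have "1 + R - exp R = (1 - p - exp (- p)) *\<^sub>R 1 + (p - p * exp (- p)) *\<^sub>R Q - exp (- p) *\<^sub>R T"
    unfolding eR unfolding T_def R by (simp add: algebra_simps)
  also have "norm \<dots> \<le> \<bar>1 - p - exp (- p)\<bar> + \<bar>p - p * exp (- p)\<bar> * norm Q + exp (- p) * norm T"
    by (rule order_trans[OF norm_triangle_ineq4]) (simp add: norm_triangle_le)
  also have "\<dots> \<le> (exp (- p) - 1 + p) + (p - p * exp (- p)) * 1 + exp (- p) * (exp p - 1 - p)"
  proof (intro add_mono mult_mono T Q)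
    have "1 - p \<le> exp (- p)" using exp_ge_add_one_self[of "- p"] by simp
    then show "\<bar>1 - p - exp (- p)\<bar> \<le> exp (- p) - 1 + p" by linarith
    have "p * exp (- p) \<le> p * 1" using p by (intro mult_left_mono) auto
    then show "\<bar>p - p * exp (- p)\<bar> \<le> p - p * exp (- p)" "0 \<le> p - p * exp (- p)" by auto
  qed auto
  also have "\<dots> = 2 * p * (1 - exp (- p))" by (simp add: algebra_simps exp_minus)
  also have "\<dots> \<le> 2 * p * p"
    using p exp_ge_add_one_self[of "- p"] by (intro mult_left_mono) auto
  finally show ?thesis by (simp add: power2_eq_square)
qed

lemma norm_prod_le_1:
  fixes f :: "'i \<Rightarrow> 'b::{real_normed_algebra_1,comm_ring_1}"
  assumes "\<And>i. i \<in> J \<Longrightarrow> norm (f i) \<le> 1"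
  shows "norm (\<Prod>i\<in>J. f i) \<le> 1"
  using norm_prod_le[of f J] prod_le_1[of J "\<lambda>i. norm (f i)"] assms by (meson norm_ge_zero order_trans)

lemma norm_mult_le:
  fixes x y :: "'b::real_normed_algebra_1"
  assumes "norm x \<le> a" "norm y \<le> b"
  shows "norm (x * y) \<le> a * b"
  using assms norm_mult_ineq[of x y] mult_mono[of "norm x" a "norm y" b] norm_ge_zero order_trans by metis

text \<open>The expansion over subsets \<open>K\<close> of \<open>J\<close> gives
  \<open>i = card K\<close> smoothed squares and \<open>card J - i\<close> factors containing
  \<open>T\<close>. Since \<open>C\<close> dominates the combined weights for every
  \<open>i\<close>, the sum over \<open>K\<close> recombines to the product of the
  \<open>A j + B j\<close>.\<close>

lemma norm_prod_square_expansion_le: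
  fixes S T w :: "'i \<Rightarrow> 'b::{real_normed_algebra_1,comm_ring_1}"
  assumes J: "finite J"
    and smooth: "\<And>K. K \<subseteq> J \<Longrightarrow> norm ((\<Prod>j\<in>K. (S j)\<^sup>2) * E) \<le> s (card K) * (\<Prod>j\<in>K. x * A j)"
    and T: "\<And>j. j \<in> J \<Longrightarrow> norm (T j * (2 * S j + T j)) \<le> y * B j"
    and w: "\<And>j. j \<in> J \<Longrightarrow> norm (w j) \<le> W j"
    and C: "\<And>i. i \<le> card J \<Longrightarrow> s i * x ^ i * y ^ (card J - i) \<le> C"
    and nonneg: "\<And>j. j \<in> J \<Longrightarrow> 0 \<le> A j" "\<And>j. j \<in> J \<Longrightarrow> 0 \<le> B j"
  shows "norm ((\<Prod>j\<in>J. (S j + T j)\<^sup>2 * w j) * E) \<le> C * (\<Prod>j\<in>J. W j * (A j + B j))"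
proof -
  define U where "U = (\<lambda>j. T j * (2 * S j + T j))"
  have W: "0 \<le> (\<Prod>j\<in>J. W j)" using w norm_ge_zero order_trans by (intro prod_nonneg) blast
  have sq: "(S j + T j)\<^sup>2 = (S j)\<^sup>2 + U j" for j by (simp add: U_def power2_eq_square algebra_simps)
  have "(\<Prod>j\<in>J. (S j + T j)\<^sup>2 * w j) * E = (\<Prod>j\<in>J. w j) * ((\<Prod>j\<in>J. (S j)\<^sup>2 + U j) * E)"
    by (simp add: prod.distrib sq mult_ac)
  also have "(\<Prod>j\<in>J. (S j)\<^sup>2 + U j) = (\<Sum>K\<in>Pow J. (\<Prod>j\<in>K. (S j)\<^sup>2) * (\<Prod>j\<in>J - K. U j))"
    by (rule prod_add[OF J])
  also have "\<dots> * E = (\<Sum>K\<in>Pow J. ((\<Prod>j\<in>K. (S j)\<^sup>2) * E) * (\<Prod>j\<in>J - K. U j))"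
    unfolding sum_distrib_right by (intro sum.cong refl) (simp only: mult_ac)
  also have "norm ((\<Prod>j\<in>J. w j) * \<dots>) \<le> (\<Prod>j\<in>J. W j) * (\<Sum>K\<in>Pow J. C * ((\<Prod>j\<in>K. A j) * (\<Prod>j\<in>J - K. B j)))"
  proof (rule norm_mult_le[OF _ sum_norm_le])
    show "norm (\<Prod>j\<in>J. w j) \<le> (\<Prod>j\<in>J. W j)"
      by (rule order_trans[OF norm_prod_le]) (intro prod_mono conjI norm_ge_zero w)
    fix K assume "K \<in> Pow J"
    then have K: "K \<subseteq> J" by simp
    then have card: "card (J - K) = card J - card K" "card K \<le> card J"
      using J by (auto simp: card_Diff_subset finite_subset intro: card_mono)
    have AB: "0 \<le> (\<Prod>j\<in>K. A j) * (\<Prod>j\<in>J - K. B j)"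
      using K nonneg by (intro mult_nonneg_nonneg prod_nonneg) auto
    have "norm (\<Prod>j\<in>J - K. U j) \<le> (\<Prod>j\<in>J - K. y * B j)"
      by (rule order_trans[OF norm_prod_le]) (use T in \<open>auto intro!: prod_mono simp: U_def\<close>)
    from norm_mult_le[OF smooth[OF K] this]
    have "norm (((\<Prod>j\<in>K. (S j)\<^sup>2) * E) * (\<Prod>j\<in>J - K. U j)) \<le>
        (s (card K) * x ^ card K * y ^ (card J - card K)) * ((\<Prod>j\<in>K. A j) * (\<Prod>j\<in>J - K. B j))"
      by (simp add: prod.distrib card mult_ac)
    also have "\<dots> \<le> C * ((\<Prod>j\<in>K. A j) * (\<Prod>j\<in>J - K. B j))"
      by (intro mult_right_mono C card AB)
    finally show "norm (((\<Prod>j\<in>K. (S j)\<^sup>2) * E) * (\<Prod>j\<in>J - K. U j)) \<le> C * ((\<Prod>j\<in>K. A j) * (\<Prod>j\<in>J - K. B j))" .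
  qed
  also have "(\<Sum>K\<in>Pow J. C * ((\<Prod>j\<in>K. A j) * (\<Prod>j\<in>J - K. B j))) = C * (\<Prod>j\<in>J. A j + B j)"
    by (simp add: prod_add[OF J] sum_distrib_left)
  finally show ?thesis by (simp add: prod.distrib mult_ac)
qed

lemma sum_prod_scale_le:
  fixes f :: "'i set \<Rightarrow> 'b::real_normed_vector"
  assumes I: "finite I" and x: "\<And>i. i \<in> I \<Longrightarrow> 0 \<le> x i" and C: "0 \<le> C"
    and f: "\<And>J. J \<subseteq> I \<Longrightarrow> card J = k \<Longrightarrow> norm (f J) \<le> C * (\<Prod>j\<in>J. x j)"
  shows "norm (\<Sum>J | J \<subseteq> I \<and> card J = k. f J) \<le> C / fact k * (\<Sum>i\<in>I. x i) ^ k"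
proof -
  have "norm (\<Sum>J | J \<subseteq> I \<and> card J = k. f J) \<le> (\<Sum>J | J \<subseteq> I \<and> card J = k. C * (\<Prod>j\<in>J. x j))"
    by (rule sum_norm_le) (use f in auto)
  also have "\<dots> = C * (\<Sum>J | J \<subseteq> I \<and> card J = k. \<Prod>j\<in>J. x j)" by (simp add: sum_distrib_left)
  also have "\<dots> \<le> C * ((\<Sum>i\<in>I. x i) ^ k / fact k)"
    using C by (intro mult_left_mono sum_prod_subsets_le I x)
  finally show ?thesis by simp
qed

text \<open>With V = (1 + R) exp(-R) - 1 one has 1 + R = (1 + V) exp(R); the product of the factors
  1 + V is expanded over subsets and sorted by cardinality.\<close>

lemma kerstan_expansion:
  fixes R :: "nat \<Rightarrow> 'b::{real_normed_algebra_1,banach,comm_ring_1}"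
  assumes I: "finite I"
  shows "(\<Prod>j\<in>I. 1 + R j) = (\<Sum>k\<le>card I. (\<Sum>J | J \<subseteq> I \<and> card J = k. \<Prod>j\<in>J. (1 + R j) * exp (- R j) - 1)
    * exp (\<Sum>j\<in>I. R j))"
proof -
  let ?V = "\<lambda>j. (1 + R j) * exp (- R j) - 1"
  have "(1 + ?V j) * exp (R j) = 1 + R j" for j
  proof -
    have "(1 + ?V j) * exp (R j) = (1 + R j) * (exp (R j) * exp (- R j))" by (simp add: mult_ac)
    then show ?thesis by (simp add: exp_minus_inverse)
  qed
  then have "(\<Prod>j\<in>I. 1 + R j) = (\<Prod>j\<in>I. ?V j + 1) * exp (\<Sum>j\<in>I. R j)"
    by (simp add: exp_sum[OF I] prod.distrib[symmetric] add.commute)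
  also have "(\<Prod>j\<in>I. ?V j + 1) = (\<Sum>J\<in>Pow I. \<Prod>j\<in>J. ?V j)"
    by (subst prod_add[OF I]) simp
  also have "\<dots> = (\<Sum>k\<le>card I. \<Sum>J | J \<subseteq> I \<and> card J = k. \<Prod>j\<in>J. ?V j)"
    by (rule sum_card_eq_sum_Pow[OF I refl, symmetric])
  finally show ?thesis by (simp add: sum_distrib_right)
qed

definition kerstan_term :: "nat set \<Rightarrow> (nat \<Rightarrow> 'b::{real_normed_algebra_1,banach,comm_ring_1}) \<Rightarrow> nat \<Rightarrow> 'b" where
  "kerstan_term I R k = (\<Sum>J | J \<subseteq> I \<and> card J = k. \<Prod>j\<in>J. (1 + R j) * exp (- R j) - 1) * exp (\<Sum>j\<in>I. R j)"

lemma g_nonneg: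
  assumes "0 \<le> r"
  shows "0 \<le> g r"
  using sums_le[OF _ sums_zero g_sums[OF assms]] assms by simp

text \<open>The whole exponential is left for smoothing here, at the price that exp(-R) stays inside
  \<open>w j\<close> and costs the factor g(2 p)/2.\<close>

lemma norm_kerstan_term_le_g:
  fixes R S T :: "nat \<Rightarrow> 'b::{real_normed_algebra_1,banach,comm_ring_1}"
  assumes I: "finite I" and RST: "\<And>j. j \<in> I \<Longrightarrow> R j = S j + T j"
    and p: "\<And>j. j \<in> I \<Longrightarrow> 0 \<le> p j" and R: "\<And>j. j \<in> I \<Longrightarrow> norm (R j) \<le> 2 * p j"
    and T: "\<And>j. j \<in> I \<Longrightarrow> norm (T j * (2 * S j + T j)) \<le> 8 * (p j)\<^sup>2 * b j"
    and ab: "\<And>j. j \<in> I \<Longrightarrow> 0 \<le> a j" "\<And>j. j \<in> I \<Longrightarrow> 0 \<le> b j"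
    and smooth: "\<And>J. J \<subseteq> I \<Longrightarrow> norm ((\<Prod>j\<in>J. (S j)\<^sup>2) * exp (\<Sum>j\<in>I. R j)) \<le>
      sqrt (fact (2 * card J)) * (\<Prod>j\<in>J. (p j)\<^sup>2 * a j)"
  shows "norm (kerstan_term I R k) \<le> sqrt (fact (2 * k)) / fact k *
    (\<Sum>j\<in>I. g (2 * p j) / 2 * ((p j)\<^sup>2 * a j + 4 * sqrt 2 * (p j)\<^sup>2 * b j)) ^ k"
proof -
  let ?V = "\<lambda>j. (1 + R j) * exp (- R j) - 1"
  let ?E = "exp (\<Sum>j\<in>I. R j)"
  have "\<exists>w. ?V j = (R j)\<^sup>2 * w \<and> norm w \<le> g (2 * p j) / 2" if "j \<in> I" for j
    using kerstan_factor[OF R[OF that]] by metis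
  then obtain w where w: "\<And>j. j \<in> I \<Longrightarrow> ?V j = (R j)\<^sup>2 * w j" "\<And>j. j \<in> I \<Longrightarrow> norm (w j) \<le> g (2 * p j) / 2"
    by metis
  \<comment> \<open>Raising \<open>i\<close> by one multiplies \<open>sqrt (fact (2 * i))\<close> by
    at least sqrt 2, with equality at i = 0. So sqrt 2 is the largest weight for the factors with
    \<open>T\<close> that works for every \<open>k\<close>; the coefficient 4 sqrt 2 of
    \<open>b j\<close> is 8 divided by it.\<close>
  have C: "sqrt (fact (2 * i)) * 1 ^ i * sqrt 2 ^ (k - i) \<le> sqrt (fact (2 * k))" if "i \<le> k" for i
    using that
  proof (induction k rule: dec_induct)
    case (step k)
    have "sqrt (fact (2 * i)) * 1 ^ i * sqrt 2 ^ (Suc k - i) = (sqrt (fact (2 * i)) * 1 ^ i * sqrt 2 ^ (k - i)) * sqrt 2"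
      using step.hyps by (simp add: Suc_diff_le)
    also have "\<dots> \<le> sqrt (fact (2 * k)) * sqrt 2" by (intro mult_right_mono step.IH) auto
    also have "\<dots> = sqrt (2 * fact (2 * k))" by (simp add: real_sqrt_mult)
    also have "\<dots> \<le> sqrt (fact (2 * Suc k))"
    proof (intro real_sqrt_le_mono)
      have "2 * 1 \<le> real (2 * k + 2) * real (2 * k + 1)" by (intro mult_mono) auto
      then have "2 * fact (2 * k) \<le> (real (2 * k + 2) * real (2 * k + 1)) * fact (2 * k)"
        by (intro mult_right_mono) auto
      then show "2 * fact (2 * k) \<le> (fact (2 * Suc k) :: real)" by (simp add: mult_ac)
    qed
    finally show ?case .
  qed simp
  have eq: "kerstan_term I R k = (\<Sum>J | J \<subseteq> I \<and> card J = k. (\<Prod>j\<in>J. ?V j) * ?E)"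
    by (simp add: kerstan_term_def sum_distrib_right)
  show ?thesis unfolding eq
  proof (rule sum_prod_scale_le[OF I])
    fix J assume J: "J \<subseteq> I" "card J = k"
    have "(\<Prod>j\<in>J. ?V j) * ?E = (\<Prod>j\<in>J. (S j + T j)\<^sup>2 * w j) * ?E"
      using J w(1) RST by (intro arg_cong2[where f="(*)"] prod.cong) auto
    also have "norm \<dots> \<le> sqrt (fact (2 * k)) * (\<Prod>j\<in>J. g (2 * p j) / 2 * ((p j)\<^sup>2 * a j + 4 * sqrt 2 * (p j)\<^sup>2 * b j))"
    proof (rule norm_prod_square_expansion_le[where x=1 and y="sqrt 2" and s="\<lambda>i. sqrt (fact (2 * i))"])
      show "finite J" using J I finite_subset by blast
      have e: "sqrt 2 * (4 * sqrt 2 * x * y) = 8 * x * y" for x y :: real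
      proof -
        have "sqrt 2 * (4 * sqrt 2 * x * y) = (sqrt 2 * sqrt 2) * 4 * x * y" by (simp only: mult_ac)
        then show ?thesis by simp
      qed
      show "norm (T j * (2 * S j + T j)) \<le> sqrt 2 * (4 * sqrt 2 * (p j)\<^sup>2 * b j)" if "j \<in> J" for j
        unfolding e using T[of j] J that by blast
      show "norm ((\<Prod>j\<in>K. (S j)\<^sup>2) * ?E) \<le> sqrt (fact (2 * card K)) * (\<Prod>j\<in>K. 1 * ((p j)\<^sup>2 * a j))"
        if "K \<subseteq> J" for K using smooth[of K] J that by auto
    qed (use J w(2) C ab in \<open>auto simp: subset_eq\<close>)
    finally show "norm ((\<Prod>j\<in>J. ?V j) * ?E) \<le>
      sqrt (fact (2 * k)) * (\<Prod>j\<in>J. g (2 * p j) / 2 * ((p j)\<^sup>2 * a j + 4 * sqrt 2 * (p j)\<^sup>2 * b j))" .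
  qed (use ab p in \<open>auto intro!: mult_nonneg_nonneg add_nonneg_nonneg g_nonneg\<close>)
qed

text \<open>Half of each exponential factor of the terms of the product is absorbed into the accompanying
  Poisson element; the other half of the latter still smooths.\<close>

lemma norm_kerstan_term_le_half:
  fixes q S T :: "nat \<Rightarrow> 'b::{real_normed_algebra_1,banach,comm_ring_1}"
  defines "R \<equiv> \<lambda>j. S j + T j"
  assumes I: "finite I" and R: "\<And>j. j \<in> I \<Longrightarrow> R j = p j *\<^sub>R (q j - 1)"
    and q: "\<And>j. j \<in> I \<Longrightarrow> norm (q j) \<le> 1"
    and p: "\<And>j. j \<in> I \<Longrightarrow> 0 \<le> p j" "\<And>j. j \<in> I \<Longrightarrow> p j \<le> 1"
    and T: "\<And>j. j \<in> I \<Longrightarrow> norm (T j * (2 * S j + T j)) \<le> 8 * (p j)\<^sup>2 * b j"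
    and ab: "\<And>j. j \<in> I \<Longrightarrow> 0 \<le> a j" "\<And>j. j \<in> I \<Longrightarrow> 0 \<le> b j"
    and smooth: "\<And>J. J \<subseteq> I \<Longrightarrow> norm ((\<Prod>j\<in>J. (S j)\<^sup>2) * exp ((1/2) *\<^sub>R (\<Sum>j\<in>I. R j))) \<le>
      sqrt (fact (2 * card J)) * (\<Prod>j\<in>J. 2 * ((p j)\<^sup>2 * a j))"
    and C: "\<And>i. i \<le> k \<Longrightarrow> sqrt (fact (2 * i)) * 2 ^ i * 8 ^ (k - i) * (777/1000) ^ k \<le> C * fact k"
  shows "norm (kerstan_term I R k) \<le> C * (\<Sum>j\<in>I. (p j)\<^sup>2 * (a j + b j)) ^ k"
proof -
  let ?V = "\<lambda>j. (1 + R j) * exp (- R j) - 1"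
  let ?E = "exp (\<Sum>j\<in>I. R j)"
  let ?H = "exp ((1/2) *\<^sub>R (\<Sum>j\<in>I. R j))"
  have "norm (R j) \<le> 2" if "j \<in> I" for j
  proof -
    have "norm (q j - 1) \<le> 2" using q[OF that] norm_triangle_ineq4[of "q j" 1] by simp
    then show ?thesis unfolding R[OF that] using p[OF that] mult_mono[of "p j" 1 "norm (q j - 1)" 2] by simp
  qed
  then have "\<exists>w. ?V j = exp ((-1/2) *\<^sub>R R j) * ((R j)\<^sup>2 * w) \<and> norm w \<le> 777/1000" if "j \<in> I" for j
    using kerstan_factor_half[of "R j"] that by metis
  then obtain w where w: "\<And>j. j \<in> I \<Longrightarrow> ?V j = exp ((-1/2) *\<^sub>R R j) * ((R j)\<^sup>2 * w j)"
      "\<And>j. j \<in> I \<Longrightarrow> norm (w j) \<le> 777/1000"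
    by metis
  have eq: "kerstan_term I R k = (\<Sum>J | J \<subseteq> I \<and> card J = k. (\<Prod>j\<in>J. ?V j) * ?E)"
    by (simp add: kerstan_term_def sum_distrib_right)
  have C0: "0 \<le> C * fact k"
    by (rule order_trans[OF _ C[of 0]]) auto
  have bound: "norm ((\<Prod>j\<in>J. ?V j) * ?E) \<le> (C * fact k) * (\<Prod>j\<in>J. (p j)\<^sup>2 * a j + (p j)\<^sup>2 * b j)"
    if J: "J \<subseteq> I" "card J = k" for J
  proof -
    have fJ: "finite J" using J I finite_subset by blast
    \<comment> \<open>The half exponents are removed for the indices in \<open>J\<close> only. Of
      the full sum over \<open>I\<close> this leaves one half of the whole sum, which smooths, and
      another half of the sum over \<open>I - J\<close>; the exponential \<open>E'\<close> of the
      latter is a contraction.\<close>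
    define E' where "E' = exp ((1/2) *\<^sub>R (\<Sum>j\<in>I - J. R j))"
    have split: "(\<Sum>j\<in>I. R j) = (\<Sum>j\<in>I - J. R j) + (\<Sum>j\<in>J. R j)"
      by (rule sum.subset_diff[OF J(1) I])
    have "(\<Prod>j\<in>J. exp ((-1/2) *\<^sub>R R j)) * ?E = exp ((\<Sum>j\<in>J. (-1/2) *\<^sub>R R j) + (\<Sum>j\<in>I. R j))"
      by (simp only: exp_sum[OF fJ, symmetric] exp_add_commuting mult.commute)
    also have "(\<Sum>j\<in>J. (-1/2) *\<^sub>R R j) + (\<Sum>j\<in>I. R j) = (1/2) *\<^sub>R (\<Sum>j\<in>I. R j) + (1/2) *\<^sub>R (\<Sum>j\<in>I - J. R j)"
    proof -
      have half: "(-1/2) *\<^sub>R y + (x + y) = (1/2) *\<^sub>R (x + y) + (1/2) *\<^sub>R x" for x y :: 'b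
        using scaleR_half_double[of x] scaleR_half_double[of y] by (simp add: algebra_simps)
      show ?thesis unfolding scaleR_sum_right[symmetric] split by (rule half)
    qed
    also have "exp \<dots> = ?H * E'" unfolding E'_def by (simp only: exp_add_commuting mult.commute)
    finally have H: "(\<Prod>j\<in>J. exp ((-1/2) *\<^sub>R R j)) * ?E = ?H * E'" .
    have E'1: "norm E' \<le> 1"
      unfolding E'_def scaleR_sum_right exp_sum[OF finite_Diff[OF I]]
    proof (rule norm_prod_le_1)
      fix j assume "j \<in> I - J"
      then show "norm (exp ((1/2) *\<^sub>R R j)) \<le> 1"
        using norm_exp_contraction[of "q j" "1/2 * p j"] q p by (simp add: R)
    qed
    have "norm ((\<Prod>j\<in>J. (S j + T j)\<^sup>2 * w j) * ?H) \<le>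
        (C * fact k / (777/1000) ^ k) * (\<Prod>j\<in>J. 777/1000 * ((p j)\<^sup>2 * a j + (p j)\<^sup>2 * b j))"
    \<comment> \<open>Smoothing with half of the exponential doubles each \<open>a j\<close>, whence
      x = 2, and y = 8 is the plain bound for \<open>T j * (2 * S j + T j)\<close>. Their interplay
      is left to the hypothesis \<open>C\<close>.\<close>
    proof (rule norm_prod_square_expansion_le[where x=2 and y=8 and s="\<lambda>i. sqrt (fact (2 * i))", OF fJ])
      show "sqrt (fact (2 * i)) * 2 ^ i * 8 ^ (card J - i) \<le> C * fact k / (777/1000) ^ k" if "i \<le> card J" for i
        using C[of i] that J by (subst pos_le_divide_eq) auto
    qed (use J smooth T ab w in \<open>auto simp: subset_eq R_def mult.assoc\<close>)
    from norm_mult_le[OF this E'1] have "norm (((\<Prod>j\<in>J. (S j + T j)\<^sup>2 * w j) * ?H) * E') \<le>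
      (C * fact k / (777/1000) ^ k) * (\<Prod>j\<in>J. 777/1000 * ((p j)\<^sup>2 * a j + (p j)\<^sup>2 * b j)) * 1" .
    also have "\<dots> = (C * fact k) * (\<Prod>j\<in>J. (p j)\<^sup>2 * a j + (p j)\<^sup>2 * b j)"
    proof -
      have "(\<Prod>j\<in>J. 777/1000 * ((p j)\<^sup>2 * a j + (p j)\<^sup>2 * b j)) =
          (777/1000) ^ k * (\<Prod>j\<in>J. (p j)\<^sup>2 * a j + (p j)\<^sup>2 * b j)"
        by (simp only: prod.distrib prod_constant J(2))
      then show ?thesis by simp
    qed
    also have "((\<Prod>j\<in>J. (S j + T j)\<^sup>2 * w j) * ?H) * E' = (\<Prod>j\<in>J. ?V j) * ?E"
    proof -
      have "(\<Prod>j\<in>J. ?V j) = (\<Prod>j\<in>J. exp ((-1/2) *\<^sub>R R j) * ((R j)\<^sup>2 * w j))"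
        using J w(1) by (intro prod.cong) auto
      then have "(\<Prod>j\<in>J. ?V j) * ?E = ((\<Prod>j\<in>J. exp ((-1/2) *\<^sub>R R j)) * ?E) * (\<Prod>j\<in>J. (R j)\<^sup>2 * w j)"
        by (simp only: prod.distrib mult_ac)
      then show ?thesis unfolding H by (simp only: R_def mult_ac)
    qed
    finally show ?thesis .
  qed
  have "norm (kerstan_term I R k) \<le> (C * fact k) / fact k * (\<Sum>j\<in>I. (p j)\<^sup>2 * a j + (p j)\<^sup>2 * b j) ^ k"
    unfolding eq by (rule sum_prod_scale_le[OF I _ C0 bound]) (use ab in auto)
  then show ?thesis by (simp add: distrib_left)
qed

section \<open>The first-order term and the constant 3.11\<close>

text \<open>The source of \<open>D' 1\<close>: with x^2 in place of \<open>a j\<close>, it merges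
  the unsmoothed bound 2 with the smoothed one. Outside the trivial case x^2 + b is below 2/3.11,
  which is what makes a linear bound possible although \<open>b\<close> also enters
  quadratically.\<close>

lemma first_order_min_le:
  fixes x b :: real
  assumes x: "0 \<le> x" and b: "0 \<le> b"
  shows "min 2 (777/1000 * (2 * sqrt 2 * x\<^sup>2 + 4 * sqrt 2 * b * x + 4 * b\<^sup>2)) \<le> 311/100 * (x\<^sup>2 + b)"
proof (cases "2 \<le> 311/100 * (x\<^sup>2 + b)")
  case False
  have "sqrt 2 \<le> 14143/10000" by (rule real_le_lsqrt) (auto simp: power2_eq_square)
  from mult_right_mono[OF this, of "x\<^sup>2"] mult_right_mono[OF this, of "b * x"]
  have "sqrt 2 * x\<^sup>2 \<le> 14143/10000 * x\<^sup>2" "sqrt 2 * (b * x) \<le> 14143/10000 * (b * x)"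
    using x b by auto
  then have "777/1000 * (2 * sqrt 2 * x\<^sup>2 + 4 * sqrt 2 * b * x + 4 * b\<^sup>2) \<le>
      2198/1000 * x\<^sup>2 + 4396/1000 * (b * x) + 3108/1000 * b\<^sup>2"
  proof -
    have "777/1000 * (2 * sqrt 2 * x\<^sup>2 + 4 * sqrt 2 * b * x + 4 * b\<^sup>2) =
        777/500 * (sqrt 2 * x\<^sup>2) + 777/250 * (sqrt 2 * (b * x)) + 3108/1000 * b\<^sup>2"
      by (simp add: algebra_simps)
    moreover have "0 \<le> x\<^sup>2" "0 \<le> b * x" using x b by auto
    ultimately show ?thesis
      using \<open>sqrt 2 * x\<^sup>2 \<le> 14143/10000 * x\<^sup>2\<close> \<open>sqrt 2 * (b * x) \<le> 14143/10000 * (b * x)\<close> by linarith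
  qed
  also have "\<dots> \<le> 311/100 * (x\<^sup>2 + b)"
  proof (cases "b \<le> 369/1000")
    case True
    \<comment> \<open>Completing the square in \<open>x\<close>: 0.912 = 3.11 - 2.198, and 2.4102
      slightly exceeds 4.396 / (2 * 0.912). The remaining quadratic in \<open>b\<close> is
      nonnegative up to about 0.36997, hence the threshold 0.369.\<close>
    have "0 \<le> 912/1000 * (x - 24102/10000 * b)\<^sup>2" by simp
    moreover have "0 \<le> b * (311/100 - (912/1000 * (24102/10000)\<^sup>2 + 3108/1000) * b)" using b True by (intro mult_nonneg_nonneg) (auto simp: power2_eq_square)
    moreover have "0 \<le> b * x" using x b by simp
    ultimately show ?thesis by (simp add: power2_eq_square algebra_simps)
  next
    case False': False
    \<comment> \<open>From x \<le> x^2 + 1/4 and x^2 < 2/3.11 - b one gets x \<le> \<open>y\<close>,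
      as 2/3.11 + 1/4 < 0.8931. For these \<open>b\<close> the expression 0.912 x^2 - 4.396 b x
      decreases on [0, y], so \<open>x\<close> may be replaced by \<open>y\<close>.\<close>
    define y where "y = 8931/10000 - b"
    have "0 \<le> (x - 1/2)\<^sup>2" by simp
    then have "x \<le> x\<^sup>2 + 1/4" by (simp add: power2_eq_square algebra_simps)
    then have xy: "x \<le> y" using False by (simp add: y_def)
    have "0 \<le> (y - x) * (4396/1000 * b - 912/1000 * (x + y))"
      using xy False' by (intro mult_nonneg_nonneg) (auto simp: y_def)
    also have "\<dots> = 912/1000 * x\<^sup>2 - 4396/1000 * (b * x) - 5308/1000 * b\<^sup>2 + 5555082/1000000 * b - 72743638032/100000000000"
      by (simp add: y_def power2_eq_square field_simps)
    finally have 1: "0 \<le> \<dots>" .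
    \<comment> \<open>At x = y a quadratic in \<open>b\<close> with leading coefficient 2.2 is left;
      its minimum, near b = 0.5557, is positive.\<close>
    have "0 \<le> 22/10 * (b - 5557/10000)\<^sup>2" by simp
    also have "\<dots> = 22/10 * b\<^sup>2 - 244508/100000 * b + 679365478/1000000000"
      by (simp add: power2_eq_square field_simps)
    finally have 2: "0 \<le> \<dots>" .
    have "311/100 * x\<^sup>2 + 311/100 * b < 2" using False by (simp add: distrib_left)
    then have "b \<le> 1" using zero_le_power2[of x] by linarith
    then show ?thesis using 1 2 unfolding distrib_left by linarith
  qed
  finally show ?thesis by (rule min.coboundedI2)
qed simp

text \<open>Two estimates compete. Without smoothing, V exp(R) = 1 + R - exp(R) is at most 2 p^2;
  with smoothing, the square of S + T is multiplied out and each of its three terms estimated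
  separately. The general argument at k = 1 would only give 8 * 0.777 = 6.216.\<close>

lemma norm_kerstan_term_1_le:
  fixes q S T :: "nat \<Rightarrow> 'b::{real_normed_algebra_1,banach,comm_ring_1}"
  defines "R \<equiv> \<lambda>j. S j + T j"
  assumes I: "finite I" and R: "\<And>j. j \<in> I \<Longrightarrow> R j = p j *\<^sub>R (q j - 1)"
    and q: "\<And>j. j \<in> I \<Longrightarrow> norm (q j) \<le> 1"
    and p: "\<And>j. j \<in> I \<Longrightarrow> 0 \<le> p j" "\<And>j. j \<in> I \<Longrightarrow> p j \<le> 1"
    and T: "\<And>j. j \<in> I \<Longrightarrow> norm (T j) \<le> 2 * p j * b j"
    and ab: "\<And>j. j \<in> I \<Longrightarrow> 0 \<le> a j" "\<And>j. j \<in> I \<Longrightarrow> 0 \<le> b j"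
    and smooth1: "\<And>j. j \<in> I \<Longrightarrow> norm (S j * exp ((1/2) *\<^sub>R (\<Sum>j\<in>I. R j))) \<le> sqrt 2 * p j * sqrt (a j)"
    and smooth2: "\<And>j. j \<in> I \<Longrightarrow> norm ((S j)\<^sup>2 * exp ((1/2) *\<^sub>R (\<Sum>j\<in>I. R j))) \<le> 2 * sqrt 2 * ((p j)\<^sup>2 * a j)"
  shows "norm (kerstan_term I R 1) \<le> 311/100 * (\<Sum>j\<in>I. (p j)\<^sup>2 * (a j + b j))"
proof -
  let ?V = "\<lambda>j. (1 + R j) * exp (- R j) - 1"
  let ?E = "exp (\<Sum>j\<in>I. R j)"
  let ?H = "exp ((1/2) *\<^sub>R (\<Sum>j\<in>I. R j))"
  have eq: "kerstan_term I R 1 = (\<Sum>J | J \<subseteq> I \<and> card J = 1. (\<Prod>j\<in>J. ?V j) * ?E)"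
    by (simp add: kerstan_term_def sum_distrib_right)
  have contr: "norm (exp (t *\<^sub>R (\<Sum>i\<in>I - {j}. R i))) \<le> 1" if "0 \<le> t" for t j
    unfolding scaleR_sum_right exp_sum[OF finite_Diff[OF I]]
  proof (rule norm_prod_le_1)
    fix i assume "i \<in> I - {j}"
    then show "norm (exp (t *\<^sub>R R i)) \<le> 1"
      using norm_exp_contraction[of "q i" "t * p i"] q p that by (simp add: R)
  qed
  have single: "norm (?V j * ?E) \<le> 311/100 * ((p j)\<^sup>2 * (a j + b j))" if j: "j \<in> I" for j
  proof -
    have split: "(\<Sum>i\<in>I. R i) = R j + (\<Sum>i\<in>I - {j}. R i)"
      by (rule sum.remove[OF I j])
    have E: "?E = exp (R j) * exp (\<Sum>i\<in>I - {j}. R i)"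
      unfolding split by (rule exp_add_commuting) (rule mult.commute)
    have "?V j * ?E = (1 + R j - exp (R j)) * exp (1 *\<^sub>R (\<Sum>i\<in>I - {j}. R i))"
    proof -
      have "?V j * exp (R j) = (1 + R j) * (exp (R j) * exp (- R j)) - exp (R j)" by (simp add: algebra_simps)
      then have "?V j * exp (R j) = 1 + R j - exp (R j)" by (simp add: exp_minus_inverse)
      then show ?thesis unfolding E by (simp add: mult.assoc[symmetric])
    qed
    also have "norm \<dots> \<le> 2 * (p j)\<^sup>2 * 1"
      using norm_exp_defect[OF q[OF j] p(1)[OF j] p(2)[OF j] R[OF j]] contr[of 1 j]
      by (intro norm_mult_le) auto
    finally have 1: "norm (?V j * ?E) \<le> (p j)\<^sup>2 * 2" by simp
    have "norm (R j) \<le> 2"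
    proof -
      have "norm (q j - 1) \<le> 2" using q[OF j] norm_triangle_ineq4[of "q j" 1] by simp
      then show ?thesis unfolding R[OF j] using p[OF j] mult_mono[of "p j" 1 "norm (q j - 1)" 2] by simp
    qed
    then obtain w where w: "?V j = exp ((-1/2) *\<^sub>R R j) * ((R j)\<^sup>2 * w)" "norm w \<le> 777/1000"
      by (rule kerstan_factor_half)
    have "exp ((-1/2) *\<^sub>R R j) * ?E = ?H * exp ((1/2) *\<^sub>R (\<Sum>i\<in>I - {j}. R i))"
    proof -
      have half: "(-1/2) *\<^sub>R x + (x + y) = (1/2) *\<^sub>R (x + y) + (1/2) *\<^sub>R y" for x y :: 'b
        using scaleR_half_double[of x] scaleR_half_double[of y] by (simp add: algebra_simps)
      have "exp ((-1/2) *\<^sub>R R j) * ?E = exp ((-1/2) *\<^sub>R R j + (R j + (\<Sum>i\<in>I - {j}. R i)))"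
        unfolding split by (rule exp_add_commuting[symmetric]) (rule mult.commute)
      also have "\<dots> = ?H * exp ((1/2) *\<^sub>R (\<Sum>i\<in>I - {j}. R i))"
        unfolding half split by (rule exp_add_commuting) (rule mult.commute)
      finally show ?thesis .
    qed
    then have "?V j * ?E = (((S j)\<^sup>2 * ?H + 2 * (T j * (S j * ?H)) + T j * (T j * ?H)) * w) * exp ((1/2) *\<^sub>R (\<Sum>i\<in>I - {j}. R i))"
      (is "_ = (?Y * w) * ?X")
    proof -
      assume e: "exp ((-1/2) *\<^sub>R R j) * ?E = ?H * exp ((1/2) *\<^sub>R (\<Sum>i\<in>I - {j}. R i))"
      have "?V j * ?E = (exp ((-1/2) *\<^sub>R R j) * ?E) * ((R j)\<^sup>2 * w)" unfolding w(1) by (simp only: mult_ac)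
      also have "\<dots> = ((R j)\<^sup>2 * ?H * w) * ?X" unfolding e by (simp only: mult_ac)
      also have "(R j)\<^sup>2 * ?H = ?Y" by (simp add: R_def power2_eq_square algebra_simps)
      finally show ?thesis .
    qed
    moreover have "norm ((?Y * w) * ?X) \<le> ((2 * sqrt 2 * ((p j)\<^sup>2 * a j) + 2 * (2 * p j * b j * (sqrt 2 * p j * sqrt (a j))) +
        2 * p j * b j * (2 * p j * b j * 1)) * (777/1000)) * 1"
    proof (rule norm_mult_le[OF norm_mult_le[OF _ w(2)] contr])
      have "norm (2 * (T j * (S j * ?H))) \<le> 2 * norm (T j * (S j * ?H))"
        using norm_triangle_ineq[of "T j * (S j * ?H)" "T j * (S j * ?H)"] by (simp only: mult_2)
      also have "norm (T j * (S j * ?H)) \<le> 2 * p j * b j * (sqrt 2 * p j * sqrt (a j))"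
        by (rule norm_mult_le[OF T[OF j] smooth1[OF j]])
      finally have 1: "norm (2 * (T j * (S j * ?H))) \<le> 2 * (2 * p j * b j * (sqrt 2 * p j * sqrt (a j)))" by simp
      have "norm ?H \<le> 1"
        unfolding scaleR_sum_right exp_sum[OF I]
      proof (rule norm_prod_le_1)
        fix i assume "i \<in> I"
        then show "norm (exp ((1/2) *\<^sub>R R i)) \<le> 1"
          using norm_exp_contraction[of "q i" "1/2 * p i"] q p by (simp add: R)
      qed
      from norm_mult_le[OF T[OF j] norm_mult_le[OF T[OF j] this]]
      have "norm (T j * (T j * ?H)) \<le> 2 * p j * b j * (2 * p j * b j * 1)" .
      with 1 smooth2[OF j] show "norm ?Y \<le> 2 * sqrt 2 * ((p j)\<^sup>2 * a j) +
          2 * (2 * p j * b j * (sqrt 2 * p j * sqrt (a j))) + 2 * p j * b j * (2 * p j * b j * 1)"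
        by (intro norm_triangle_mono)
    qed simp
    ultimately have 2: "norm (?V j * ?E) \<le> (p j)\<^sup>2 * (777/1000 * (2 * sqrt 2 * (sqrt (a j))\<^sup>2 + 4 * sqrt 2 * b j * sqrt (a j) + 4 * (b j)\<^sup>2))"
      using ab(1)[OF j] by (simp add: power2_eq_square algebra_simps)
    have "norm (?V j * ?E) \<le> (p j)\<^sup>2 * min 2 (777/1000 * (2 * sqrt 2 * (sqrt (a j))\<^sup>2 + 4 * sqrt 2 * b j * sqrt (a j) + 4 * (b j)\<^sup>2))"
      using 1 2 by (auto simp: min_def)
    also have "\<dots> \<le> (p j)\<^sup>2 * (311/100 * ((sqrt (a j))\<^sup>2 + b j))"
      using ab[OF j] by (intro mult_left_mono first_order_min_le) auto
    finally show ?thesis using ab(1)[OF j] by (simp add: algebra_simps)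
  qed
  have "norm (kerstan_term I R 1) \<le> (311/100) / fact 1 * (\<Sum>j\<in>I. (p j)\<^sup>2 * (a j + b j)) ^ 1"
    unfolding eq
  proof (rule sum_prod_scale_le[OF I])
    fix J assume J: "J \<subseteq> I" "card J = 1"
    then obtain j where "J = {j}" using card_1_singletonE by blast
    then show "norm ((\<Prod>j\<in>J. ?V j) * ?E) \<le> 311/100 * (\<Prod>j\<in>J. (p j)\<^sup>2 * (a j + b j))"
      using single[of j] J by simp
  qed (use ab in auto)
  then show ?thesis by simp
qed

section \<open>Comparison with the numerical constants\<close>

text \<open>The threshold is chosen so that 3 * 2.072 = 8 * 0.777, which is the comparison made in
  \<open>D'_bound\<close>. Six terms of the series reach it.\<close>

lemma g_2_ge: "2072/1000 \<le> g 2 / 2"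
proof -
  have "(\<Sum>m<6. (real (m + 2) - 1) / fact (m + 2) * 2 ^ m) \<le> g 2 / 2"
    using sums_unique[OF g_sums[of 2]] sums_summable[OF g_sums[of 2]]
    by (simp only: zero_le_numeral) (rule sum_le_suminf, auto)
  then show ?thesis by (simp add: eval_nat_numeral)
qed

lemma sqrt_fact_le_D:
  assumes "2 \<le> k"
  shows "sqrt (fact (2 * k)) \<le> D k * fact k"
proof (cases "k < 10")
  case True
  then have "k \<in> {2,3,4,5,6,7,8,9}" using assms by auto
  then show ?thesis
    by (elim insertE emptyE; simp only:; intro real_le_lsqrt) (simp_all add: D_def fact_numeral power2_eq_square)
qed (auto simp: D_def)

text \<open>From i = 1 on, raising \<open>i\<close> multiplies \<open>sqrt (fact (2 * i))\<close> by
  at least sqrt 12, more than 3. The step from 0 to 1 gains only sqrt 2, so i = 0 is compared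
  directly: 81 is below sqrt(8!), but 9 and 27 exceed sqrt(4!) and sqrt(6!), and for k = 2, 3 the
  larger tabulated values of \<open>D\<close> are used.\<close>

lemma sqrt_fact_mult_power_le:
  assumes "2 \<le> k" "i \<le> k"
  shows "sqrt (fact (2 * i)) * 3 ^ (k - i) \<le> D k * fact k"
proof -
  have step: "sqrt (fact (2 * m)) * 3 \<le> sqrt (fact (2 * Suc m))" if "1 \<le> m" for m
  proof -
    have "3 * 3 \<le> real (2 * m + 2) * real (2 * m + 1)" using that by (intro mult_mono) auto
    then have "fact (2 * m) * 9 \<le> fact (2 * m) * (real (2 * m + 2) * real (2 * m + 1))"
      by (intro mult_left_mono) auto
    then have "sqrt (fact (2 * m) * 9) \<le> sqrt (fact (2 * Suc m))"
      by (intro real_sqrt_le_mono) (simp add: mult_ac)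
    then show ?thesis by (simp add: real_sqrt_mult real_sqrt_eq_iff[of 9 "3 * 3", symmetric, simplified])
  qed
  have up: "sqrt (fact (2 * m)) * 3 ^ (k - m) \<le> sqrt (fact (2 * k))" if "1 \<le> m" "m \<le> k" for m k
    using that(2,1)
  proof (induction k rule: dec_induct)
    case (step k)
    then have "sqrt (fact (2 * m)) * 3 ^ (Suc k - m) \<le> sqrt (fact (2 * k)) * 3"
      by (simp add: Suc_diff_le)
    also have "\<dots> \<le> sqrt (fact (2 * Suc k))" using step.hyps step.prems by (intro \<open>\<And>m. 1 \<le> m \<Longrightarrow> sqrt (fact (2 * m)) * 3 \<le> sqrt (fact (2 * Suc m))\<close>) simp
    finally show ?case .
  qed simp
  show ?thesis
  proof (cases "i = 0")
    case False
    then show ?thesis using up[of i k] sqrt_fact_le_D[OF assms(1)] assms by linarith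
  next
    case True
    consider "k = 2" | "k = 3" | "4 \<le> k" using assms by linarith
    then have "3 ^ k \<le> D k * fact k"
    proof cases
      case 3
      have "3 ^ k = 3 ^ 4 * (3::real) ^ (k - 4)" using 3 power_add[of "3::real" 4 "k - 4"] by simp
      also have "\<dots> \<le> sqrt (fact (2 * 4)) * 3 ^ (k - 4)"
      proof (rule mult_right_mono)
        have "(3::real) ^ 4 = sqrt ((3 ^ 4)\<^sup>2)" by simp
        also have "\<dots> \<le> sqrt (fact (2 * 4))" by (intro real_sqrt_le_mono) (simp add: fact_numeral)
        finally show "(3::real) ^ 4 \<le> sqrt (fact (2 * 4))" .
      qed simp
      also have "\<dots> \<le> sqrt (fact (2 * k))" by (rule up) (use 3 in auto)
      finally show ?thesis using sqrt_fact_le_D[OF assms(1)] by linarith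
    qed (simp_all add: D_def fact_numeral)
    then show ?thesis using True by simp
  qed
qed

lemma D'_bound:
  assumes "2 \<le> k" "i \<le> k"
  shows "sqrt (fact (2 * i)) * 2 ^ i * 8 ^ (k - i) * (777/1000) ^ k \<le> D' k * fact k"
proof -
  have split: "(777/1000::real) ^ k = (777/1000) ^ i * (777/1000) ^ (k - i)"
    using assms by (simp add: power_add[symmetric])
  \<comment> \<open>The powers of 0.777 are distributed: 2 * 0.777 = 1.554 is to be compared with
    g(2)/2, and 8 * 0.777 = 6.216 with 3 g(2)/2.\<close>
  have "sqrt (fact (2 * i)) * 2 ^ i * 8 ^ (k - i) * (777/1000) ^ k =
      sqrt (fact (2 * i)) * ((1554/1000) ^ i * (6216/1000) ^ (k - i))"
  proof -
    have e: "(1554/1000::real) ^ i = 2 ^ i * (777/1000) ^ i" "(6216/1000::real) ^ (k - i) = 8 ^ (k - i) * (777/1000) ^ (k - i)"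
      by (simp_all add: power_mult_distrib[symmetric])
    show ?thesis unfolding split e by (simp only: mult_ac)
  qed
  also have "\<dots> \<le> sqrt (fact (2 * i)) * ((g 2 / 2) ^ i * (3 * (g 2 / 2)) ^ (k - i))"
    using g_2_ge by (intro mult_left_mono mult_mono power_mono) auto
  also have "\<dots> = sqrt (fact (2 * i)) * 3 ^ (k - i) * ((g 2 / 2) ^ i * (g 2 / 2) ^ (k - i))"
    by (simp only: power_mult_distrib mult_ac)
  also have "(g 2 / 2) ^ i * (g 2 / 2) ^ (k - i) = (g 2 / 2) ^ k"
    using assms by (simp add: power_add[symmetric])
  also have "sqrt (fact (2 * i)) * 3 ^ (k - i) * (g 2 / 2) ^ k \<le> (D k * fact k) * (g 2 / 2) ^ k"
    using g_2_ge by (intro mult_right_mono sqrt_fact_mult_power_le assms) auto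
  also have "\<dots> = D' k * fact k" using assms by (simp add: D'_def mult_ac)
  finally show ?thesis .
qed

section \<open>Smoothing by compound Poisson measures\<close>

text \<open>Both 1 + (L/N)(Q - 1) and exp((L/N)(Q - 1)) are contractions for large N and differ by
  O(1/N^2), so their powers differ by O(1/N). The fixed shift \<open>m\<close> leaves room for the
  slots occupied by centred factors.\<close>

lemma exp_limit_contraction:
  fixes Q :: "'b::{real_normed_algebra_1,banach,comm_ring_1}"
  assumes Q: "norm Q \<le> 1" and L: "0 \<le> L"
  shows "(\<lambda>N. (1 + (L / real N) *\<^sub>R (Q - 1)) ^ (N - m)) \<longlonglongrightarrow> exp (L *\<^sub>R (Q - 1))"
proof -
  define Z where "Z = Q - 1"
  have Z: "norm Z \<le> 2" using norm_triangle_ineq4[of Q 1] Q by (simp add: Z_def)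
  define x where "x = (\<lambda>N. exp ((L / real N) *\<^sub>R Z))"
  define y where "y = (\<lambda>N. 1 + (L / real N) *\<^sub>R Z)"
  have ev: "\<forall>\<^sub>F N in sequentially. 2 * L \<le> real N \<and> 0 < real N"
    using eventually_ge_at_top[of "max 1 (nat \<lceil>2 * L\<rceil>)"] by eventually_elim linarith
  have le: "norm (x N ^ (N - m) - y N ^ (N - m)) \<le> (2 * L)\<^sup>2 * (1 / real N)"
    if N: "2 * L \<le> real N" "0 < real N" for N
  proof -
    have LN: "0 \<le> L / real N" "L / real N \<le> 1/2" using N L by (auto simp: field_simps)
    have "norm ((L / real N) *\<^sub>R Z) \<le> L / real N * 2"
      unfolding norm_scaleR abs_of_nonneg[OF LN(1)] by (rule mult_left_mono[OF Z LN(1)])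
    then have "norm (x N - 1 - (L / real N) *\<^sub>R Z) \<le> exp (L / real N * 2) - 1 - L / real N * 2"
      unfolding x_def by (rule norm_exp_remainder)
    also have "\<dots> \<le> (L / real N * 2)\<^sup>2"
    proof -
      have "exp (t * 2) - 1 - t * 2 \<le> (t * 2)\<^sup>2" if "0 \<le> t" "t \<le> 1/2" for t :: real
        using exp_bound[of "t * 2"] that by simp
      then show ?thesis using LN by blast
    qed
    finally have d: "norm (x N - y N) \<le> (L / real N * 2)\<^sup>2" by (simp add: y_def algebra_simps)
    have "norm (x N) \<le> 1" unfolding x_def Z_def by (rule norm_exp_contraction[OF Q LN(1)])
    moreover have "norm (y N) \<le> 1"
    proof -
      have "y N = (1 - L / real N) *\<^sub>R 1 + (L / real N) *\<^sub>R Q" by (simp add: y_def Z_def algebra_simps)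
      also have "norm \<dots> \<le> \<bar>1 - L / real N\<bar> + (L / real N) * norm Q"
      proof -
        have "norm (c *\<^sub>R 1 + t *\<^sub>R Q) \<le> \<bar>c\<bar> + t * norm Q" if "0 \<le> t" for c t
          using norm_triangle_ineq[of "c *\<^sub>R 1" "t *\<^sub>R Q"] that by simp
        then show ?thesis using LN(1) by blast
      qed
      also have "\<dots> \<le> \<bar>1 - L / real N\<bar> + (L / real N) * 1"
        using LN Q by (intro add_left_mono mult_left_mono) auto
      finally show ?thesis using LN by simp
    qed
    ultimately have "norm (x N ^ (N - m) - y N ^ (N - m)) \<le> real (N - m) * norm (x N - y N)"
      by (rule norm_power_diff)
    also have "\<dots> \<le> real N * (L / real N * 2)\<^sup>2" by (intro mult_mono d) auto
    also have "\<dots> = (2 * L)\<^sup>2 * (1 / real N)" using N by (simp add: power2_eq_square)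
    finally show ?thesis .
  qed
  have d0: "(\<lambda>N. x N ^ (N - m) - y N ^ (N - m)) \<longlonglongrightarrow> 0"
  proof (rule Lim_null_comparison)
    show "\<forall>\<^sub>F N in sequentially. norm (x N ^ (N - m) - y N ^ (N - m)) \<le> (2 * L)\<^sup>2 * (1 / real N)"
      using ev by eventually_elim (use le in blast)
    show "(\<lambda>N. (2 * L)\<^sup>2 * (1 / real N)) \<longlonglongrightarrow> 0"
      by (intro tendsto_mult_right_zero lim_1_over_n)
  qed
  have "(\<lambda>N. x N ^ (N - m)) \<longlonglongrightarrow> exp (L *\<^sub>R Z)"
  proof -
    have "(\<lambda>N. L * real (N - m) / real N) \<longlonglongrightarrow> L"
    proof -
      have "(\<lambda>N. L * (1 - real m * (1 / real N))) \<longlonglongrightarrow> L * (1 - real m * 0)"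
        by (intro tendsto_intros lim_1_over_n)
      moreover have "\<forall>\<^sub>F N in sequentially. L * (1 - real m * (1 / real N)) = L * real (N - m) / real N"
        using eventually_ge_at_top[of "max 1 m"] by eventually_elim (auto simp: field_simps of_nat_diff)
      ultimately show ?thesis by (auto intro: Lim_transform_eventually)
    qed
    moreover have "isCont (\<lambda>t. exp (t *\<^sub>R Z)) L"
      using exp_scaleR_has_vector_derivative_right has_vector_derivative_continuous by blast
    ultimately have "(\<lambda>N. exp ((L * real (N - m) / real N) *\<^sub>R Z)) \<longlonglongrightarrow> exp (L *\<^sub>R Z)"
      by (rule isCont_tendsto_compose[rotated])
    moreover have "x N ^ (N - m) = exp ((L * real (N - m) / real N) *\<^sub>R Z)" for N
    proof -
      have "exp (t *\<^sub>R Z) ^ n = exp ((real n * t) *\<^sub>R Z)" for t n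
      proof (induction n)
        case (Suc n)
        have "exp (t *\<^sub>R Z) * exp ((real n * t) *\<^sub>R Z) = exp (t *\<^sub>R Z + (real n * t) *\<^sub>R Z)"
          by (rule exp_add_commuting[symmetric]) (rule mult.commute)
        then show ?case using Suc by (simp add: algebra_simps)
      qed simp
      then show ?thesis by (simp add: x_def mult.commute)
    qed
    ultimately show ?thesis by simp
  qed
  from tendsto_diff[OF this d0] have "(\<lambda>N. y N ^ (N - m)) \<longlonglongrightarrow> exp (L *\<^sub>R Z)" by simp
  then show ?thesis by (simp add: y_def Z_def)
qed

text \<open>The denominator counts the injections of k elements into N slots; divided by N^k it is a
  product of k factors 1 - i/N.\<close>

lemma choose_limit: "(\<lambda>N. real N ^ k / (fact k * real (N choose k))) \<longlonglongrightarrow> 1"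
proof -
  have "(\<lambda>N. \<Prod>i=0..<k. 1 - real i * (1 / real N)) \<longlonglongrightarrow> (\<Prod>i=0..<k. 1 - real i * 0)"
    by (intro tendsto_intros lim_1_over_n)
  then have "(\<lambda>N. inverse (\<Prod>i=0..<k. 1 - real i * (1 / real N))) \<longlonglongrightarrow> inverse 1"
    by (intro tendsto_inverse) auto
  moreover have "\<forall>\<^sub>F N in sequentially. inverse (\<Prod>i=0..<k. 1 - real i * (1 / real N)) =
      real N ^ k / (fact k * real (N choose k))"
    using eventually_ge_at_top[of 1]
  proof eventually_elim
    case (elim N)
    have "fact k * real (N choose k) = (\<Prod>i=0..<k. real N - real i)"
      by (simp add: binomial_gbinomial gbinomial_prod_rev)
    also have "\<dots> = (\<Prod>i=0..<k. real N * (1 - real i * (1 / real N)))"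
      using elim by (intro prod.cong) (auto simp: field_simps)
    also have "\<dots> = real N ^ k * (\<Prod>i=0..<k. 1 - real i * (1 / real N))"
      by (simp add: prod.distrib)
    finally show ?case using elim by (simp add: divide_simps)
  qed
  ultimately show ?thesis by (auto intro: Lim_transform_eventually)
qed

section \<open>Second moments of sums over distinct slots\<close>

lemma finite_measure_prob_space: "prob_space N \<Longrightarrow> finite_measure N"
  by (simp add: prob_space_def)

lemma integral_add_bounded:
  assumes "finite_measure N" "bounded_measurable N f" "bounded_measurable N k"
  shows "(\<integral>x. f x + k x \<partial>N) = integral\<^sup>L N f + integral\<^sup>L N k"
  by (intro Bochner_Integration.integral_add integrable_bounded_measurable assms)

lemma integral_sum_bounded:
  assumes "finite_measure N" "\<And>i. i \<in> I \<Longrightarrow> bounded_measurable N (f i)"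
  shows "(\<integral>x. (\<Sum>i\<in>I. f i x) \<partial>N) = (\<Sum>i\<in>I. integral\<^sup>L N (f i))"
  by (intro Bochner_Integration.integral_sum integrable_bounded_measurable assms)

text \<open>Products over injectively chosen slots: \<open>slot_sum u N K \<xi>\<close> is the sum of
  \<open>\<Prod>i\<in>K. u i (\<xi> (\<sigma> i))\<close> over all injections \<open>\<sigma>\<close> from \<open>K\<close> to \<open>{..<N}\<close>.\<close>

primrec slot_sum :: "('i \<Rightarrow> 'c \<Rightarrow> real) \<Rightarrow> nat \<Rightarrow> 'i set \<Rightarrow> (nat \<Rightarrow> 'c) \<Rightarrow> real" where
  "slot_sum u 0 K \<xi> = (if K = {} then 1 else 0)"
| "slot_sum u (Suc N) K \<xi> = slot_sum u N K \<xi> + (\<Sum>i\<in>K. u i (\<xi> N) * slot_sum u N (K - {i}) \<xi>)"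

lemma slot_sum_upd: "N \<le> m \<Longrightarrow> slot_sum u N K (\<xi>(m := z)) = slot_sum u N K \<xi>"
  by (induction N arbitrary: K) auto

text \<open>\<open>S\<close> is the law of a single slot and \<open>u i\<close> the weight that the
  centred factor \<open>i\<close> puts on the slot it occupies; under \<open>P N\<close> the slots
  are independent.\<close>

locale slots = prob_space S for S :: "'c measure" +
  fixes u :: "'i \<Rightarrow> 'c \<Rightarrow> real" and I :: "'i set"
  assumes u: "\<And>i. i \<in> I \<Longrightarrow> bounded_measurable S (u i)" and finite_I: "finite I"
begin

abbreviation P :: "nat \<Rightarrow> (nat \<Rightarrow> 'c) measure" where
  "P N \<equiv> PiM {..<N} (\<lambda>_. S)"

sublocale prod: product_prob_space "\<lambda>_. S" UNIV
  by unfold_locales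

lemma prob_P: "prob_space (P N)"
  by (intro prob_space_PiM prob_space_axioms)

lemma finite_P: "finite_measure (P N)"
  by (intro finite_measure_prob_space prob_P)

lemma bounded_component: "bounded_measurable S f \<Longrightarrow> j < N \<Longrightarrow> bounded_measurable (P N) (\<lambda>\<xi>. f (\<xi> j))"
  by (rule bounded_measurable_compose[OF _ measurable_component_singleton]) auto

lemma bounded_slot_sum:
  assumes "K \<subseteq> I" "m \<le> N"
  shows "bounded_measurable (P N) (slot_sum u m K)"
  using assms
proof (induction m arbitrary: K)
  case 0
  have "slot_sum u 0 K = (\<lambda>\<xi>. if K = {} then 1 else 0)" by (rule ext) simp
  then show ?case by (simp add: bounded_measurable_const)
next
  case (Suc m)
  have "slot_sum u (Suc m) K = (\<lambda>\<xi>. slot_sum u m K \<xi> + (\<Sum>i\<in>K. u i (\<xi> m) * slot_sum u m (K - {i}) \<xi>))"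
    by (rule ext) simp
  moreover have "bounded_measurable (P N)
      (\<lambda>\<xi>. slot_sum u m K \<xi> + (\<Sum>i\<in>K. u i (\<xi> m) * slot_sum u m (K - {i}) \<xi>))"
    using Suc.prems
    by (intro bounded_measurable_add bounded_measurable_sum bounded_measurable_mult bounded_component Suc.IH u) auto
  ultimately show ?case by simp
qed

lemma integral_P_Suc:
  assumes "bounded_measurable (P (Suc N)) f"
  shows "integral\<^sup>L (P (Suc N)) f = (\<integral>\<xi>. (\<integral>z. f (\<xi>(N := z)) \<partial>S) \<partial>P N)"
  using prod.product_integral_insert[of "{..<N}" N f] integrable_bounded_measurable[OF finite_P assms]
  by (simp add: lessThan_Suc)

text \<open>Induction on the number of slots, integrating out the last one. Of the two factorials,
  one belongs to the number of injections and the other accumulates from Cauchy-Schwarz, since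
  different weights in the same slot need not be orthogonal.\<close>

lemma integral_slot_sum_square_le:
  assumes mean: "\<And>i. i \<in> I \<Longrightarrow> integral\<^sup>L S (u i) = 0"
    and K: "K \<subseteq> I"
  shows "(\<integral>\<xi>. (slot_sum u N K \<xi>)\<^sup>2 \<partial>P N) \<le>
    fact (card K) * (fact (card K) * real (N choose card K)) * (\<Prod>i\<in>K. \<integral>z. (u i z)\<^sup>2 \<partial>S)"
  using K
proof (induction N arbitrary: K)
  case 0
  interpret P0: prob_space "P 0" by (rule prob_P)
  show ?case
  proof (cases "K = {}")
    case False
    then show ?thesis
      by (auto intro!: mult_nonneg_nonneg prod_nonneg integral_nonneg)
  qed (simp add: P0.prob_space[simplified])
next
  case (Suc N)
  note K = Suc.prems
  have fK: "finite K" using K finite_I finite_subset by blast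
  define k where "k = card K"
  define U where "U = (\<lambda>i. \<integral>z. (u i z)\<^sup>2 \<partial>S)"
  have U: "0 \<le> U i" for i unfolding U_def by simp
  let ?\<Psi> = "\<lambda>K. slot_sum u N K"
  have bu: "bounded_measurable S (u i)" if "i \<in> K" for i using u K that by auto
  have fS: "finite_measure S" by unfold_locales
  have inner: "(\<integral>z. (slot_sum u (Suc N) K (\<xi>(N := z)))\<^sup>2 \<partial>S) \<le>
      (?\<Psi> K \<xi>)\<^sup>2 + real k * (\<Sum>i\<in>K. U i * (?\<Psi> (K - {i}) \<xi>)\<^sup>2)" for \<xi>
  proof -
    let ?L = "\<lambda>z. \<Sum>i\<in>K. u i z * ?\<Psi> (K - {i}) \<xi>"
    have bL: "bounded_measurable S ?L"
      by (intro bounded_measurable_sum bounded_measurable_mult bounded_measurable_const bu)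
    have "(\<integral>z. (slot_sum u (Suc N) K (\<xi>(N := z)))\<^sup>2 \<partial>S) =
        (\<integral>z. (?\<Psi> K \<xi>)\<^sup>2 + 2 * ?\<Psi> K \<xi> * ?L z + (?L z)\<^sup>2 \<partial>S)"
      by (intro Bochner_Integration.integral_cong refl) (simp add: slot_sum_upd power2_sum)
    also have "\<dots> = (?\<Psi> K \<xi>)\<^sup>2 + 2 * ?\<Psi> K \<xi> * integral\<^sup>L S ?L + (\<integral>z. (?L z)\<^sup>2 \<partial>S)"
      by (subst integral_add_bounded integral_add_bounded[OF fS bounded_measurable_const]
          | intro fS bounded_measurable_add bounded_measurable_const bounded_measurable_mult bounded_measurable_power2 bL)+
         (simp add: prob_space)
    \<comment> \<open>The weights are centred, so injections that avoid the slot \<open>N\<close>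
      are orthogonal to those that use it.\<close>
    also have "integral\<^sup>L S ?L = 0"
    proof -
      have "integral\<^sup>L S ?L = (\<Sum>i\<in>K. \<integral>z. u i z * ?\<Psi> (K - {i}) \<xi> \<partial>S)"
        by (intro integral_sum_bounded fS bounded_measurable_mult bounded_measurable_const bu)
      also have "\<dots> = 0" using mean K by (intro sum.neutral) auto
      finally show ?thesis .
    qed
    \<comment> \<open>Cauchy-Schwarz for the \<open>k\<close> factors that may occupy the last slot;
      this is the loss of a factor \<open>k\<close> per step.\<close>
    also have "(\<integral>z. (?L z)\<^sup>2 \<partial>S) \<le> (\<integral>z. (\<Sum>i\<in>K. (u i z)\<^sup>2 * (?\<Psi> (K - {i}) \<xi>)\<^sup>2) * real k \<partial>S)"
    proof (rule integral_mono)
      show "integrable S (\<lambda>z. (?L z)\<^sup>2)"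
        by (intro integrable_bounded_measurable fS bounded_measurable_power2 bL)
      show "integrable S (\<lambda>z. (\<Sum>i\<in>K. (u i z)\<^sup>2 * (?\<Psi> (K - {i}) \<xi>)\<^sup>2) * real k)"
        by (intro integrable_bounded_measurable fS bounded_measurable_mult bounded_measurable_sum
          bounded_measurable_power2 bounded_measurable_const bu)
      show "(?L z)\<^sup>2 \<le> (\<Sum>i\<in>K. (u i z)\<^sup>2 * (?\<Psi> (K - {i}) \<xi>)\<^sup>2) * real k" for z
        using sum_squared_le_sum_of_squares[of "\<lambda>i. u i z * ?\<Psi> (K - {i}) \<xi>" K]
        by (simp add: power_mult_distrib k_def)
    qed
    also have "\<dots> = real k * (\<Sum>i\<in>K. U i * (?\<Psi> (K - {i}) \<xi>)\<^sup>2)"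
      by (simp add: mult.commute[of _ "real k"])
         (subst integral_sum_bounded, auto intro!: fS bounded_measurable_mult bounded_measurable_power2 bounded_measurable_const bu simp: U_def)
    finally show ?thesis by (simp only: mult_zero_right add_0_right)
  qed
  have b\<Psi>: "bounded_measurable (P N) (\<lambda>\<xi>. (?\<Psi> K' \<xi>)\<^sup>2)" if "K' \<subseteq> K" for K'
    using that K by (intro bounded_measurable_power2 bounded_slot_sum) auto
  have bR: "bounded_measurable (P N) (\<lambda>\<xi>. real k * (\<Sum>i\<in>K. U i * (?\<Psi> (K - {i}) \<xi>)\<^sup>2))"
    by (intro bounded_measurable_mult bounded_measurable_sum bounded_measurable_const b\<Psi>) auto
  have "(\<integral>\<xi>. (slot_sum u (Suc N) K \<xi>)\<^sup>2 \<partial>P (Suc N)) =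
      (\<integral>\<xi>. (\<integral>z. (slot_sum u (Suc N) K (\<xi>(N := z)))\<^sup>2 \<partial>S) \<partial>P N)"
    by (intro integral_P_Suc bounded_measurable_power2 bounded_slot_sum K order_refl)
  also have "\<dots> \<le> (\<integral>\<xi>. (?\<Psi> K \<xi>)\<^sup>2 + real k * (\<Sum>i\<in>K. U i * (?\<Psi> (K - {i}) \<xi>)\<^sup>2) \<partial>P N)"
    by (intro integral_mono_AE' AE_I2 inner integrable_bounded_measurable finite_P bounded_measurable_add b\<Psi> bR order_refl)
       (use U in \<open>auto intro!: add_nonneg_nonneg mult_nonneg_nonneg sum_nonneg\<close>)
  also have "\<dots> = (\<integral>\<xi>. (?\<Psi> K \<xi>)\<^sup>2 \<partial>P N) + real k * (\<Sum>i\<in>K. U i * (\<integral>\<xi>. (?\<Psi> (K - {i}) \<xi>)\<^sup>2 \<partial>P N))"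
  proof -
    have "(\<integral>\<xi>. (\<Sum>i\<in>K. U i * (?\<Psi> (K - {i}) \<xi>)\<^sup>2) \<partial>P N) = (\<Sum>i\<in>K. U i * (\<integral>\<xi>. (?\<Psi> (K - {i}) \<xi>)\<^sup>2 \<partial>P N))"
      by (subst integral_sum_bounded) (auto intro!: finite_P bounded_measurable_mult bounded_measurable_const b\<Psi>)
    then show ?thesis by (subst integral_add_bounded[OF finite_P b\<Psi> bR]) auto
  qed
  also have "\<dots> \<le> fact k * (fact k * real (N choose k)) * prod U K +
      real k * (\<Sum>i\<in>K. U i * (fact (k - 1) * (fact (k - 1) * real (N choose (k - 1))) * prod U (K - {i})))"
  proof (intro add_mono mult_left_mono sum_mono)
    show "(\<integral>\<xi>. (?\<Psi> K \<xi>)\<^sup>2 \<partial>P N) \<le> fact k * (fact k * real (N choose k)) * prod U K"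
      using Suc.IH[OF K] by (simp add: k_def U_def)
    show "(\<integral>\<xi>. (?\<Psi> (K - {i}) \<xi>)\<^sup>2 \<partial>P N) \<le> fact (k - 1) * (fact (k - 1) * real (N choose (k - 1))) * prod U (K - {i})"
      if "i \<in> K" for i
      using Suc.IH[of "K - {i}"] K that fK by (auto simp: k_def U_def)
  qed (use U in auto)
  also have "\<dots> = fact k * (fact k * real (N choose k)) * prod U K +
      real k * (real k * (fact (k - 1) * (fact (k - 1) * real (N choose (k - 1))) * prod U K))"
  proof -
    have "(\<Sum>i\<in>K. U i * (c * prod U (K - {i}))) = real k * (c * prod U K)" for c
    proof -
      have "(\<Sum>i\<in>K. U i * (c * prod U (K - {i}))) = (\<Sum>i\<in>K. c * prod U K)"
        using fK by (intro sum.cong refl) (simp add: prod.remove)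
      then show ?thesis by (simp add: k_def)
    qed
    then show ?thesis by simp
  qed
  \<comment> \<open>Pascal's rule, after collecting k * k * (k-1)! * (k-1)! = k! * k!.\<close>
  also have "\<dots> = fact k * (fact k * real (Suc N choose k)) * prod U K"
  proof (cases k)
    case (Suc m)
    then show ?thesis by (simp add: algebra_simps)
  qed simp
  finally show ?case by (simp add: k_def U_def)
qed

end

section \<open>Slot products in the algebra and their norm\<close>

text \<open>The sum, over all injections, of N-fold products with \<open>y i\<close> in the slot of
  \<open>i\<close> and \<mu> in every free slot, in a recursion parallel to that of
  \<open>slot_sum\<close>.\<close>

primrec slot_product :: "'b::comm_ring_1 \<Rightarrow> ('i \<Rightarrow> 'b) \<Rightarrow> nat \<Rightarrow> 'i set \<Rightarrow> 'b" where
  "slot_product \<mu> y 0 K = (if K = {} then 1 else 0)"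
| "slot_product \<mu> y (Suc N) K = slot_product \<mu> y N K * \<mu> + (\<Sum>i\<in>K. slot_product \<mu> y N (K - {i}) * y i)"

text \<open>By commutativity all injections contribute the same product, and the coefficient is
  their number.\<close>

lemma slot_product_eq:
  fixes \<mu> :: "'b::comm_ring_1"
  assumes "finite K"
  shows "slot_product \<mu> y N K =
    of_nat (fact (card K) * (N choose card K)) * ((\<Prod>i\<in>K. y i) * \<mu> ^ (N - card K))"
  using assms
proof (induction N arbitrary: K)
  case 0
  show ?case
  proof (cases "K = {}")
    case False
    then have "card K \<noteq> 0" using 0 by simp
    then obtain m where "card K = Suc m" using not0_implies_Suc by blast
    then show ?thesis using False by simp
  qed simp
next
  case (Suc N)
  define k where "k = card K"
  let ?p = "\<Prod>i\<in>K. y i"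
  have *: "slot_product \<mu> y N (K - {i}) * y i = of_nat (fact (k - 1) * (N choose (k - 1))) * (?p * \<mu> ^ (N - (k - 1)))"
    if "i \<in> K" for i
  proof -
    have "card (K - {i}) = k - 1" using that Suc.prems by (simp add: k_def)
    moreover have "?p = y i * (\<Prod>i\<in>K - {i}. y i)" using that Suc.prems by (rule prod.remove[rotated])
    ultimately show ?thesis using Suc.IH[of "K - {i}"] Suc.prems by (simp add: mult_ac)
  qed
  have "slot_product \<mu> y (Suc N) K = of_nat (fact k * (N choose k)) * (?p * \<mu> ^ (N - k)) * \<mu> +
      of_nat k * (of_nat (fact (k - 1) * (N choose (k - 1))) * (?p * \<mu> ^ (N - (k - 1))))"
    using Suc.IH[OF Suc.prems] * by (simp add: k_def)
  also have "\<dots> = of_nat (fact k * (Suc N choose k)) * (?p * \<mu> ^ (Suc N - k))"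
  proof (cases k)
    case (Suc m)
    \<comment> \<open>If \<open>N < Suc m\<close>, truncated subtraction spoils the count of the
      exponents, but then the binomial coefficient is 0.\<close>
    have *: "of_nat (N choose Suc m) * (\<mu> ^ (N - Suc m) * \<mu>) = of_nat (N choose Suc m) * \<mu> ^ (N - m)"
    proof (cases "Suc m \<le> N")
      case True
      then have "N - m = Suc (N - Suc m)" by simp
      then show ?thesis by (simp add: mult.commute)
    qed (simp add: binomial_eq_0)
    have "of_nat (fact k * (N choose k)) * (?p * \<mu> ^ (N - k)) * \<mu> =
        of_nat (fact k) * ?p * (of_nat (N choose Suc m) * (\<mu> ^ (N - Suc m) * \<mu>))"
      unfolding Suc of_nat_mult by (simp only: mult_ac)
    also have "\<dots> = of_nat (fact k * (N choose k)) * (?p * \<mu> ^ (N - m))"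
      unfolding * Suc of_nat_mult by (simp only: mult_ac)
    finally have "of_nat (fact k * (N choose k)) * (?p * \<mu> ^ (N - k)) * \<mu> = of_nat (fact k * (N choose k)) * (?p * \<mu> ^ (N - m))" .
    moreover have "of_nat k * (of_nat (fact (k - 1) * (N choose (k - 1))) * (?p * \<mu> ^ (N - (k - 1)))) =
       of_nat (fact k * (N choose m)) * (?p * \<mu> ^ (N - m))"
      by (simp add: Suc algebra_simps)
    ultimately show ?thesis by (simp add: Suc algebra_simps)
  qed (simp add: mult_ac)
  finally show ?case by (simp add: k_def)
qed

context measurable_abelian_semigroup
begin

lemma measurable_sum_lessThan:
  "(\<And>j. j < N \<Longrightarrow> f j \<in> L \<rightarrow>\<^sub>M M) \<Longrightarrow> (\<lambda>x. \<Sum>j<N::nat. f j x) \<in> L \<rightarrow>\<^sub>M M"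
  by (induction N) (auto simp: space_eq_UNIV)

lemma bounded_measurable_translate:
  "bounded_measurable M h \<Longrightarrow> bounded_measurable M (\<lambda>y. h (x + y))"
  by (rule bounded_measurable_compose[OF _ measurable_translate]) (auto simp: measurable_ident_sets)

text \<open>Random walk representation: \<mu> is the law of one step \<open>v\<close>, and
  \<open>y i\<close> is the image under \<open>v\<close> of the signed measure with density
  \<open>u i\<close>. Multiplying by one more factor of the algebra means integrating over one more
  slot, so the two recursions match.\<close>

lemma expect_slot_product:
  assumes "slots S u I" and v: "v \<in> S \<rightarrow>\<^sub>M M"
    and \<mu>: "\<And>h. bounded_measurable M h \<Longrightarrow> expect \<mu> h = (\<integral>z. h (v z) \<partial>S)"
    and y: "\<And>i h. i \<in> I \<Longrightarrow> bounded_measurable M h \<Longrightarrow> expect (y i) h = (\<integral>z. h (v z) * u i z \<partial>S)"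
    and h: "bounded_measurable M h" and K: "K \<subseteq> I"
  shows "expect (slot_product \<mu> y N K) h =
    (\<integral>\<xi>. h (\<Sum>j<N. v (\<xi> j)) * slot_sum u N K \<xi> \<partial>PiM {..<N} (\<lambda>_. S))"
proof -
  interpret slots S u I by fact
  have fS: "finite_measure S" by unfold_locales
  show ?thesis using h K
  proof (induction N arbitrary: h K)
    case 0
    interpret P0: prob_space "P 0" by (rule prob_P)
    show ?case using 0 by (simp add: expect_one expect_zero P0.prob_space[simplified])
  next
    case (Suc N)
    note h = Suc.prems(1) and K = Suc.prems(2)
    let ?s = "\<lambda>\<xi>. \<Sum>j<N. v (\<xi> j)" and ?\<Psi> = "slot_sum u N"
    have vj: "(\<lambda>\<xi>. v (\<xi> j)) \<in> P m \<rightarrow>\<^sub>M M" if "j < m" for j m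
      by (rule measurable_compose[OF _ v]) (use that in \<open>auto intro: measurable_component_singleton\<close>)
    have s: "?s \<in> P N \<rightarrow>\<^sub>M M" by (intro measurable_sum_lessThan vj)
    have s': "(\<lambda>\<xi>. \<Sum>j<Suc N. v (\<xi> j)) \<in> P (Suc N) \<rightarrow>\<^sub>M M"
      by (intro measurable_sum_lessThan vj)
    have bhv: "bounded_measurable S (\<lambda>z. h (x + v z))" for x
      by (rule bounded_measurable_compose[OF bounded_measurable_translate[OF h] v])
    have bu: "bounded_measurable S (u i)" if "i \<in> K" for i using u K that by auto
    have step: "expect (slot_product \<mu> y N K' * Y) h = (\<integral>\<xi>. expect Y (\<lambda>z. h (?s \<xi> + z)) * ?\<Psi> K' \<xi> \<partial>P N)"
      if "K' \<subseteq> K" for K' Y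
      unfolding mult.commute[of _ Y] expect_mult[OF h]
      using that K by (intro Suc.IH bounded_measurable_expect h) auto
    have bE: "bounded_measurable (P N) (\<lambda>\<xi>. expect Y (\<lambda>z. h (?s \<xi> + z)) * ?\<Psi> K' \<xi>)" if "K' \<subseteq> K" for K' Y
      using that K by (intro bounded_measurable_mult bounded_slot_sum order_refl
        bounded_measurable_compose[OF bounded_measurable_expect[OF h] s]) auto
    have "expect (slot_product \<mu> y (Suc N) K) h =
        (\<integral>\<xi>. expect \<mu> (\<lambda>z. h (?s \<xi> + z)) * ?\<Psi> K \<xi> \<partial>P N) +
        (\<Sum>i\<in>K. \<integral>\<xi>. expect (y i) (\<lambda>z. h (?s \<xi> + z)) * ?\<Psi> (K - {i}) \<xi> \<partial>P N)"
      by (simp add: expect_add[OF h] expect_sum[OF h] step)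
    also have "\<dots> = (\<integral>\<xi>. expect \<mu> (\<lambda>z. h (?s \<xi> + z)) * ?\<Psi> K \<xi> +
        (\<Sum>i\<in>K. expect (y i) (\<lambda>z. h (?s \<xi> + z)) * ?\<Psi> (K - {i}) \<xi>) \<partial>P N)"
      by (subst integral_add_bounded[OF finite_P bE bounded_measurable_sum])
         (auto intro!: bE simp: integral_sum_bounded[OF finite_P bE])
    also have "\<dots> = (\<integral>\<xi>. (\<integral>z. h (\<Sum>j<Suc N. v ((\<xi>(N := z)) j)) * slot_sum u (Suc N) K (\<xi>(N := z)) \<partial>S) \<partial>P N)"
    proof (intro Bochner_Integration.integral_cong refl)
      fix \<xi>
      have "(\<integral>z. h (\<Sum>j<Suc N. v ((\<xi>(N := z)) j)) * slot_sum u (Suc N) K (\<xi>(N := z)) \<partial>S) =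
          (\<integral>z. h (?s \<xi> + v z) * ?\<Psi> K \<xi> + (\<Sum>i\<in>K. h (?s \<xi> + v z) * u i z * ?\<Psi> (K - {i}) \<xi>) \<partial>S)"
        by (intro Bochner_Integration.integral_cong refl)
           (simp add: slot_sum_upd distrib_left sum_distrib_left mult.assoc)
      also have "\<dots> = (\<integral>z. h (?s \<xi> + v z) * ?\<Psi> K \<xi> \<partial>S) + (\<Sum>i\<in>K. \<integral>z. h (?s \<xi> + v z) * u i z * ?\<Psi> (K - {i}) \<xi> \<partial>S)"
      proof (subst integral_add_bounded[OF fS])
        show "(\<integral>z. h (?s \<xi> + v z) * ?\<Psi> K \<xi> \<partial>S) + (\<integral>z. (\<Sum>i\<in>K. h (?s \<xi> + v z) * u i z * ?\<Psi> (K - {i}) \<xi>) \<partial>S) =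
            (\<integral>z. h (?s \<xi> + v z) * ?\<Psi> K \<xi> \<partial>S) + (\<Sum>i\<in>K. \<integral>z. h (?s \<xi> + v z) * u i z * ?\<Psi> (K - {i}) \<xi> \<partial>S)"
          by (intro arg_cong2[where f="(+)"] refl integral_sum_bounded fS bounded_measurable_mult bounded_measurable_const bhv bu)
      qed (intro bounded_measurable_sum bounded_measurable_mult bounded_measurable_const bhv bu; assumption)+
      also have "\<dots> = expect \<mu> (\<lambda>z. h (?s \<xi> + z)) * ?\<Psi> K \<xi> +
          (\<Sum>i\<in>K. expect (y i) (\<lambda>z. h (?s \<xi> + z)) * ?\<Psi> (K - {i}) \<xi>)"
        using K by (auto simp: \<mu>[OF bounded_measurable_translate[OF h]] y[OF _ bounded_measurable_translate[OF h]] subset_eq intro!: sum.cong)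
      finally show "expect \<mu> (\<lambda>z. h (?s \<xi> + z)) * ?\<Psi> K \<xi> +
          (\<Sum>i\<in>K. expect (y i) (\<lambda>z. h (?s \<xi> + z)) * ?\<Psi> (K - {i}) \<xi>) =
        (\<integral>z. h (\<Sum>j<Suc N. v ((\<xi>(N := z)) j)) * slot_sum u (Suc N) K (\<xi>(N := z)) \<partial>S)" by simp
    qed
    also have "\<dots> = (\<integral>\<xi>. h (\<Sum>j<Suc N. v (\<xi> j)) * slot_sum u (Suc N) K \<xi> \<partial>P (Suc N))"
      by (intro integral_P_Suc[symmetric] bounded_measurable_mult bounded_slot_sum K order_refl
        bounded_measurable_compose[OF h s'])
    finally show ?case .
  qed
qed

text \<open>Duality: the difference of the values at \<open>A\<close> and at its complement is the
  integral of a function \<open>h\<close> of modulus 1, hence at most the first absolute moment of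
  the slot sum, which is at most the root of the second. At the other structures a factor
  \<open>y i\<close> makes the product vanish, and \<open>I\<close> being nonempty provides such a
  factor.\<close>

lemma norm_slot_product_le:
  assumes S: "slots S u I" and v: "v \<in> S \<rightarrow>\<^sub>M M"
    and \<mu>: "\<And>h. bounded_measurable M h \<Longrightarrow> expect \<mu> h = (\<integral>z. h (v z) \<partial>S)"
    and y: "\<And>i h. i \<in> I \<Longrightarrow> bounded_measurable M h \<Longrightarrow> expect (y i) h = (\<integral>z. h (v z) * u i z \<partial>S)"
    and other: "\<And>i M' A. i \<in> I \<Longrightarrow> M' \<noteq> M \<Longrightarrow> Rep_smeasure (y i) M' A = 0"
    and mean: "\<And>i. i \<in> I \<Longrightarrow> integral\<^sup>L S (u i) = 0"
    and I: "I \<noteq> {}"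
  shows "norm (slot_product \<mu> y N I) \<le>
    sqrt (fact (card I) * (fact (card I) * real (N choose card I)) * (\<Prod>i\<in>I. \<integral>z. (u i z)\<^sup>2 \<partial>S))"
    (is "_ \<le> sqrt ?B")
proof (rule norm_smeasure_le)
  interpret slots S u I by fact
  interpret PN: prob_space "P N" by (rule prob_P)
  show B: "0 \<le> sqrt ?B"
    by (auto intro!: mult_nonneg_nonneg prod_nonneg)
  fix M' :: "'a measure" and A assume M': "measurable_abelian_semigroup M'" "A \<in> sets M'"
  show "\<bar>Rep_smeasure (slot_product \<mu> y N I) M' A - Rep_smeasure (slot_product \<mu> y N I) M' (UNIV - A)\<bar> \<le> sqrt ?B"
  proof (cases "M' = M")
    case False
    obtain i where i: "i \<in> I" using I by blast
    have "Rep_smeasure (y i) M' = (\<lambda>_. 0)" using other[OF i False] by auto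
    then have "Rep_smeasure (y i * X) M' = Rep_smeasure (0 * X) M'" for X
      by (simp only: times_smeasure.rep_eq zero_smeasure.rep_eq)
    then have 0: "Rep_smeasure (y i * X) M' A = 0" for X A
      by (simp add: zero_smeasure.rep_eq)
    define c where "c = (of_nat (fact (card I) * (N choose card I)) :: 'a smeasure)"
    define r where "r = (\<Prod>i\<in>I - {i}. y i)"
    define m where "m = \<mu> ^ (N - card I)"
    have "slot_product \<mu> y N I = y i * (c * (r * m))"
      unfolding slot_product_eq[OF finite_I] prod.remove[OF finite_I i] c_def[symmetric] r_def[symmetric] m_def[symmetric]
      by (simp only: mult_ac)
    then have "slot_product \<mu> y N I = y i * (c * (r * m))" .
    then show ?thesis using B by (simp add: 0)
  next
    case True
    define h where "h = (\<lambda>x. indicator A x - indicator (UNIV - A) x :: real)"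
    have A: "A \<in> sets M" "UNIV - A \<in> sets M"
      using M' True sets.compl_sets[of A M] by (auto simp: space_eq_UNIV)
    have h1: "\<bar>h x\<bar> = 1" for x by (auto simp: h_def indicator_def)
    have h: "bounded_measurable M h"
      using A h1 by (intro bounded_measurableI[of _ _ 1]) (auto simp: h_def)
    let ?X = "Rep_smeasure (slot_product \<mu> y N I) M" and ?\<Psi> = "slot_sum u N I"
    have sX: "signed_measure M ?X" by (intro signed_measure_Rep measurable_abelian_semigroup_axioms)
    have "signed_integral M ?X (\<lambda>x. 1 * indicator A x + (-1) * indicator (UNIV - A) x) =
        1 * signed_integral M ?X (indicator A) + (-1) * signed_integral M ?X (indicator (UNIV - A))"
      using A by (intro signed_integral_linear_fun[OF sX, of _ 1 _ 1]) (auto simp: indicator_def)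
    then have "?X A - ?X (UNIV - A) = expect (slot_product \<mu> y N I) h"
      by (simp add: signed_integral_indicator[OF sX] A expect_def h_def)
    also have "\<dots> = (\<integral>\<xi>. h (\<Sum>j<N. v (\<xi> j)) * ?\<Psi> \<xi> \<partial>P N)"
      by (rule expect_slot_product[OF S v \<mu> y h order_refl])
    finally have "\<bar>?X A - ?X (UNIV - A)\<bar> = \<bar>\<integral>\<xi>. h (\<Sum>j<N. v (\<xi> j)) * ?\<Psi> \<xi> \<partial>P N\<bar>" by simp
    also have "\<dots> \<le> (\<integral>\<xi>. \<bar>h (\<Sum>j<N. v (\<xi> j)) * ?\<Psi> \<xi>\<bar> \<partial>P N)" by (rule integral_abs_bound)
    also have "\<dots> = (\<integral>\<xi>. \<bar>?\<Psi> \<xi>\<bar> \<partial>P N)" by (simp add: abs_mult h1)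
    also have "\<dots> \<le> sqrt ?B"
    proof (rule real_le_rsqrt)
      have b: "bounded_measurable (P N) ?\<Psi>" by (rule bounded_slot_sum) auto
      have ab: "bounded_measurable (P N) (\<lambda>\<xi>. \<bar>?\<Psi> \<xi>\<bar>)"
        using b by (auto simp: bounded_measurable_def)
      have "(\<integral>\<xi>. \<bar>?\<Psi> \<xi>\<bar> \<partial>P N)\<^sup>2 \<le> (\<integral>\<xi>. \<bar>?\<Psi> \<xi>\<bar>\<^sup>2 \<partial>P N)"
        using PN.variance_positive[of "\<lambda>\<xi>. \<bar>?\<Psi> \<xi>\<bar>"]
          PN.variance_eq[OF integrable_bounded_measurable[OF finite_P ab]
            integrable_bounded_measurable[OF finite_P bounded_measurable_power2[OF ab]]] by linarith
      also have "\<dots> \<le> ?B" using integral_slot_sum_square_le[OF mean order_refl, of N] by simp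
      finally show "(\<integral>\<xi>. \<bar>?\<Psi> \<xi>\<bar> \<partial>P N)\<^sup>2 \<le> ?B" .
    qed
    finally show ?thesis using True by simp
  qed
qed

end

section \<open>Binomial approximation and the smoothing inequality\<close>

lemma integral_bernoulli_pair:
  assumes Q: "prob_space Q" and q: "0 \<le> q" "q \<le> 1"
    and f: "bounded_measurable (measure_pmf (bernoulli_pmf q) \<Otimes>\<^sub>M Q) f"
  shows "integral\<^sup>L (measure_pmf (bernoulli_pmf q) \<Otimes>\<^sub>M Q) f =
    q * (\<integral>x. f (True, x) \<partial>Q) + (1 - q) * (\<integral>x. f (False, x) \<partial>Q)"
proof -
  interpret Q: prob_space Q by fact
  interpret pair_prob_space "measure_pmf (bernoulli_pmf q)" Q ..
  have "integral\<^sup>L (measure_pmf (bernoulli_pmf q) \<Otimes>\<^sub>M Q) f = (\<integral>b. (\<integral>x. f (b, x) \<partial>Q) \<partial>measure_pmf (bernoulli_pmf q))"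
    by (intro integral_fst'[symmetric] integrable_bounded_measurable[OF _ f]) unfold_locales
  also have "\<dots> = q * (\<integral>x. f (True, x) \<partial>Q) + (1 - q) * (\<integral>x. f (False, x) \<partial>Q)"
    using q by (subst integral_bernoulli_pmf) auto
  finally show ?thesis .
qed

lemma bounded_measurable_if_fst:
  assumes f: "bounded_measurable Q f" and Q: "prob_space Q"
  shows "bounded_measurable (measure_pmf p \<Otimes>\<^sub>M Q) (\<lambda>z. if fst z then f (snd z) else c)"
proof -
  obtain C where C[measurable]: "f \<in> borel_measurable Q" and C2: "\<And>x. \<bar>f x\<bar> \<le> C"
    using f unfolding bounded_measurable_def by blast
  show ?thesis
  proof (rule bounded_measurableI[of _ _ "max C \<bar>c\<bar>"])
    show "(\<lambda>z. if fst z then f (snd z) else c) \<in> borel_measurable (measure_pmf p \<Otimes>\<^sub>M Q)"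
      by measurable
    show "\<bar>if fst z then f (snd z) else c\<bar> \<le> max C \<bar>c\<bar>" for z using C2 by (auto intro: max.coboundedI1)
  qed
qed

context measurable_abelian_semigroup
begin

lemma density_finite:
  fixes G :: "'a \<Rightarrow> real"
  assumes Q: "prob_space Q" "sets Q = sets M" and G: "bounded_measurable M G" "\<And>x. 0 \<le> G x"
  shows "finite_measure (density Q G)" "measure (density Q G) UNIV = integral\<^sup>L Q G"
    "sets (density Q G) = sets M"
    "\<And>h. bounded_measurable M h \<Longrightarrow> expect (embed (density Q G)) h = (\<integral>x. G x * h x \<partial>Q)"
proof -
  have sp: "space Q = UNIV" using sets_eq_imp_space_eq[OF Q(2)] by (simp add: space_eq_UNIV)
  have fQ: "finite_measure Q" by (rule finite_measure_prob_space[OF Q(1)])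
  have GQ: "bounded_measurable Q G" "G \<in> borel_measurable Q"
    using G(1) Q(2) by (auto simp: bounded_measurable_def cong: measurable_cong_sets)
  note int = integrable_bounded_measurable[OF fQ GQ(1)]
  have "emeasure (density Q G) UNIV = (\<integral>\<^sup>+x. ennreal (G x) \<partial>Q)"
    using GQ sp sets.top[of Q] by (subst emeasure_density) (auto intro!: nn_integral_cong)
  also have "\<dots> = ennreal (integral\<^sup>L Q G)" by (rule nn_integral_eq_integral[OF int]) (simp add: G)
  finally have e: "emeasure (density Q G) UNIV = ennreal (integral\<^sup>L Q G)" .
  show f: "finite_measure (density Q G)"
    by (rule finite_measureI) (simp add: e sp)
  show "measure (density Q G) UNIV = integral\<^sup>L Q G"
    by (simp add: measure_def e G)
  show s: "sets (density Q G) = sets M" by (simp add: Q)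
  show "expect (embed (density Q G)) h = (\<integral>x. G x * h x \<partial>Q)" if hb: "bounded_measurable M h" for h
  proof -
    obtain C where C: "h \<in> borel_measurable M" "\<And>x. \<bar>h x\<bar> \<le> C"
      using hb unfolding bounded_measurable_def by blast
    have "h \<in> borel_measurable Q" using C(1) Q(2) by (simp cong: measurable_cong_sets)
    then show ?thesis unfolding expect_embed[OF f s C] using GQ G by (subst integral_density) auto
  qed
qed

text \<open>A slot is a coin with success probability q = L/N together with an independent point of
  law \<open>Q\<close>; the step is that point on success and 0 on failure, so its law is 1 + q (Q -
  1). The slot bound, divided by the number of injections, passes to the limit.\<close>

lemma norm_poisson_smoothing:
  fixes G :: "'i \<Rightarrow> 'a \<Rightarrow> real"
  assumes I: "finite I" and Q: "prob_space Q" "sets Q = sets M" and L: "0 < L"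
    and G: "\<And>i. i \<in> I \<Longrightarrow> bounded_measurable M (G i)" "\<And>i x. i \<in> I \<Longrightarrow> 0 \<le> G i x"
    and y: "\<And>i. i \<in> I \<Longrightarrow> y i = embed (density Q (G i)) - integral\<^sup>L Q (G i) *\<^sub>R 1"
  shows "norm ((\<Prod>i\<in>I. y i) * exp (L *\<^sub>R (embed Q - 1))) \<le>
    sqrt (fact (card I) * (\<Prod>i\<in>I. (\<integral>x. (G i x)\<^sup>2 \<partial>Q) / L))"
proof -
  interpret Q: prob_space Q by fact
  have sp: "space Q = UNIV" using sets_eq_imp_space_eq[OF Q(2)] by (simp add: space_eq_UNIV)
  have fQ: "finite_measure Q" by unfold_locales
  have nQ: "norm (embed Q) \<le> 1"
    using norm_embed[OF fQ Q(2)] Q.prob_space by (simp add: sp)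
  note dens = density_finite[OF Q G]
  define k where "k = card I"
  define m where "m = (\<lambda>i. integral\<^sup>L Q (G i))"
  define g2 where "g2 = (\<lambda>i. \<integral>x. (G i x)\<^sup>2 \<partial>Q)"
  \<comment> \<open>Second moment of the weight of \<open>i\<close> when the success probability is
    L/N. Only the first summand grows like N; the second, caused by centring, disappears after
    division by N.\<close>
  define U where "U = (\<lambda>N i. g2 i * (real N / L) + (m i)\<^sup>2 / (1 - L / real N))"
  show ?thesis
  proof (cases "I = {}")
    \<comment> \<open>Without a centred factor the slot estimate does not apply, but the exponential
      alone is a contraction.\<close>
    case True
    then show ?thesis using norm_exp_contraction[OF nQ, of L] L by simp
  next
    case I0: False
    have bound: "norm ((\<Prod>i\<in>I. y i) * (1 + (L / real N) *\<^sub>R (embed Q - 1)) ^ (N - k)) \<le>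
        sqrt (fact k * ((real N ^ k / (fact k * real (N choose k))) * (\<Prod>i\<in>I. U N i / real N)))"
      if N: "L < real N" "k \<le> N" for N
    proof -
      define q where "q = L / real N"
      have q: "0 < q" "q < 1" using N L by (auto simp: q_def)
      define S where "S = measure_pmf (bernoulli_pmf q) \<Otimes>\<^sub>M Q"
      define v :: "bool \<times> 'a \<Rightarrow> 'a" where "v = (\<lambda>z. if fst z then snd z else 0)"
      \<comment> \<open>The factor 1/q compensates the rarity of success. On failure the step is 0,
        where the weight produces the atom - m i of \<open>y i\<close>; this is also what gives
        \<open>u i\<close> mean zero.\<close>
      define u where "u = (\<lambda>i (z :: bool \<times> 'a). if fst z then G i (snd z) / q else - m i / (1 - q))"
      interpret S: pair_prob_space "measure_pmf (bernoulli_pmf q)" Q ..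
      have bQ: "bounded_measurable M f \<Longrightarrow> bounded_measurable Q f" for f
        using Q(2) by (simp add: bounded_measurable_def cong: measurable_cong_sets)
      have bG: "bounded_measurable M (\<lambda>x. G i x / q)" if "i \<in> I" for i
        unfolding divide_inverse by (intro bounded_measurable_mult bounded_measurable_const G that)
      have bu: "bounded_measurable S (u i)" if "i \<in> I" for i
        unfolding S_def u_def by (intro bounded_measurable_if_fst bQ bG that Q)
      have sl: "slots S u I"
        unfolding S_def by (intro slots.intro slots_axioms.intro S.prob_space_axioms I bu[unfolded S_def])
      have v: "v \<in> S \<rightarrow>\<^sub>M M"
      proof -
        have [measurable]: "snd \<in> measure_pmf (bernoulli_pmf q) \<Otimes>\<^sub>M Q \<rightarrow>\<^sub>M M"
          using measurable_snd[of "measure_pmf (bernoulli_pmf q)" Q] Q(2) by (simp cong: measurable_cong_sets)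
        have [measurable]: "0 \<in> space M" by (simp add: space_eq_UNIV)
        show ?thesis unfolding S_def v_def by measurable
      qed
      note int = integral_bernoulli_pair[OF Q(1) less_imp_le[OF q(1)] less_imp_le[OF q(2)], folded S_def]
      have \<mu>: "expect (1 + q *\<^sub>R (embed Q - 1)) h = (\<integral>z. h (v z) \<partial>S)" if h: "bounded_measurable M h" for h
      proof -
        obtain C where C: "h \<in> borel_measurable M" "\<And>x. \<bar>h x\<bar> \<le> C"
          using h unfolding bounded_measurable_def by blast
        have "(\<integral>z. h (v z) \<partial>S) = q * integral\<^sup>L Q h + (1 - q) * h 0"
          by (subst int[OF bounded_measurable_compose[OF h v]]) (simp add: v_def Q.prob_space)
        moreover have "expect (1 + q *\<^sub>R (embed Q - 1)) h = h 0 + q * (integral\<^sup>L Q h - h 0)"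
          by (simp add: expect_add[OF h] expect_scaleR[OF h] expect_diff[OF h] expect_one[OF h] expect_embed[OF fQ Q(2) C])
        ultimately show ?thesis by (simp add: algebra_simps)
      qed
      have ye: "expect (y i) h = (\<integral>z. h (v z) * u i z \<partial>S)" if i: "i \<in> I" and h: "bounded_measurable M h" for i h
      proof -
        have "(\<integral>z. h (v z) * u i z \<partial>S) = q * (\<integral>x. h x * (G i x / q) \<partial>Q) + (1 - q) * (h 0 * (- m i / (1 - q)))"
          by (subst int[OF bounded_measurable_mult[OF bounded_measurable_compose[OF h v] bu[OF i]]])
             (simp add: v_def u_def Q.prob_space)
        also have "\<dots> = (\<integral>x. G i x * h x \<partial>Q) - m i * h 0"
          using q by (simp add: mult.commute)
        finally show ?thesis
          using dens(4)[OF i i h] by (simp add: y[OF i] expect_diff[OF h] expect_scaleR[OF h] expect_one[OF h] m_def)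
      qed
      have mean: "integral\<^sup>L S (u i) = 0" if i: "i \<in> I" for i
        using q by (subst int[OF bu[OF i]]) (simp add: u_def m_def Q.prob_space)
      have U: "(\<integral>z. (u i z)\<^sup>2 \<partial>S) = U N i" if i: "i \<in> I" for i
      proof -
        have "(\<integral>z. (u i z)\<^sup>2 \<partial>S) = q * (g2 i / q\<^sup>2) + (1 - q) * (m i / (1 - q))\<^sup>2"
          by (subst int[OF bounded_measurable_power2[OF bu[OF i]]])
             (simp add: u_def g2_def power_divide Q.prob_space)
        also have "\<dots> = g2 i / q + (m i)\<^sup>2 / (1 - q)" using q by (simp add: power2_eq_square)
        finally show ?thesis using N L by (simp add: U_def q_def)
      qed
      have other: "Rep_smeasure (y i) M' A = 0" if i: "i \<in> I" and M': "M' \<noteq> M" for i M' A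
        using Rep_embed_diff_other[OF dens(1)[OF i i] dens(3)[OF i i] M'] by (simp add: y[OF i] dens(2)[OF i i])
      define f where "f = fact k * real (N choose k)"
      define X where "X = (\<Prod>i\<in>I. y i) * (1 + q *\<^sub>R (embed Q - 1)) ^ (N - k)"
      have f: "0 < f" using N by (simp add: f_def)
      have "norm (slot_product (1 + q *\<^sub>R (embed Q - 1)) y N I) \<le>
          sqrt (fact k * f * (\<Prod>i\<in>I. \<integral>z. (u i z)\<^sup>2 \<partial>S))"
        unfolding f_def k_def by (rule norm_slot_product_le[OF sl v \<mu> ye other mean I0])
      moreover have "slot_product (1 + q *\<^sub>R (embed Q - 1)) y N I = f *\<^sub>R X"
        unfolding slot_product_eq[OF I] X_def f_def k_def
        by (simp add: scaleR_conv_of_real)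
      ultimately have "f * norm X \<le> sqrt (fact k * f * (\<Prod>i\<in>I. U N i))"
        using f U by simp
      then have "norm X \<le> sqrt (fact k * f * (\<Prod>i\<in>I. U N i)) / f"
        using f by (simp add: pos_le_divide_eq mult.commute)
      also have "\<dots> = sqrt (fact k * f * (\<Prod>i\<in>I. U N i) / f\<^sup>2)"
        using f by (simp add: real_sqrt_divide)
      \<comment> \<open>Inserting N^k separates a ratio that tends to 1 from the second moments
        normalised by N, which have limits of their own.\<close>
      also have "fact k * f * (\<Prod>i\<in>I. U N i) / f\<^sup>2 = fact k * ((real N ^ k / f) * (\<Prod>i\<in>I. U N i / real N))"
        using f N L by (simp add: prod_dividef k_def power2_eq_square)
      finally show ?thesis unfolding X_def f_def q_def .
    qed
    have ev: "\<forall>\<^sub>F N in sequentially. L < real N \<and> k \<le> N"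
      using eventually_ge_at_top[of "max k (nat \<lfloor>L\<rfloor> + 1)"] by eventually_elim linarith
    have lim: "(\<lambda>N. U N i / real N) \<longlonglongrightarrow> g2 i / L" for i
    proof -
      have "(\<lambda>N. g2 i / L + (m i)\<^sup>2 / (1 - L * (1 / real N)) * (1 / real N)) \<longlonglongrightarrow> g2 i / L + (m i)\<^sup>2 / (1 - L * 0) * 0"
        by (intro tendsto_intros lim_1_over_n) auto
      moreover have "\<forall>\<^sub>F N in sequentially. g2 i / L + (m i)\<^sup>2 / (1 - L * (1 / real N)) * (1 / real N) = U N i / real N"
        using ev by eventually_elim (use L in \<open>simp add: U_def add_divide_distrib\<close>)
      ultimately show ?thesis by (auto intro: Lim_transform_eventually)
    qed
    have "norm ((\<Prod>i\<in>I. y i) * exp (L *\<^sub>R (embed Q - 1))) \<le> sqrt (fact k * (1 * (\<Prod>i\<in>I. g2 i / L)))"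
    proof (rule tendsto_le[OF sequentially_bot])
      show "(\<lambda>N. sqrt (fact k * ((real N ^ k / (fact k * real (N choose k))) * (\<Prod>i\<in>I. U N i / real N))))
          \<longlonglongrightarrow> sqrt (fact k * (1 * (\<Prod>i\<in>I. g2 i / L)))"
        by (intro tendsto_intros choose_limit lim)
      show "(\<lambda>N. norm ((\<Prod>i\<in>I. y i) * (1 + (L / real N) *\<^sub>R (embed Q - 1)) ^ (N - k)))
          \<longlonglongrightarrow> norm ((\<Prod>i\<in>I. y i) * exp (L *\<^sub>R (embed Q - 1)))"
        using L by (intro tendsto_intros exp_limit_contraction nQ) simp
      show "\<forall>\<^sub>F N in sequentially. norm ((\<Prod>i\<in>I. y i) * (1 + (L / real N) *\<^sub>R (embed Q - 1)) ^ (N - k)) \<le>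
        sqrt (fact k * ((real N ^ k / (fact k * real (N choose k))) * (\<Prod>i\<in>I. U N i / real N)))"
        using ev by eventually_elim (use bound in blast)
    qed
    then show ?thesis by (simp add: k_def g2_def)
  qed
qed

end

section \<open>The constants \<open>c\<^sub>\<ell>\<close>\<close>

lemma g_2_pos: "0 < g 2" using g_2_ge by linarith

lemma D_pos: "2 \<le> k \<Longrightarrow> 0 < D k"
  by (auto simp: D_def)

lemma D'_pos: "1 \<le> k \<Longrightarrow> 0 < D' k"
  using g_2_pos D_pos[of k] by (auto simp: D'_def)

text \<open>The root of the central binomial coefficient is 2^k up to a power of k. Hence the series
  of \<open>D' k * x ^ k\<close> has radius of convergence 1/g(2), and the tabulated values below k
  = 10 have no influence on it.\<close>

lemma D'_eq_central_binomial:
  assumes "10 \<le> k"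
  shows "D' k = sqrt (real (2 * k choose k)) * (g 2 / 2) ^ k"
proof -
  have "real (2 * k choose k) = fact (2 * k) / (fact k)\<^sup>2"
    using binomial_fact[of k "2 * k", where 'a=real] by (simp add: power2_eq_square mult_2)
  then have "sqrt (real (2 * k choose k)) = sqrt (fact (2 * k)) / fact k" by (simp add: real_sqrt_divide)
  then show ?thesis using assms by (simp add: D'_def D_def)
qed

lemma summable_D':
  assumes "0 \<le> x" "x < 1 / g 2"
  shows "summable (\<lambda>k. D' k * x ^ k)"
proof (rule summable_comparison_test)
  have "norm (g 2 * x) < 1" using assms g_2_pos by (simp add: abs_mult field_simps)
  then show "summable (\<lambda>k. (g 2 * x) ^ k)" by (rule summable_geometric)
  have "norm (D' k * x ^ k) \<le> (g 2 * x) ^ k" if "10 \<le> k" for k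
  proof -
    have "real (2 * k choose k) \<le> (\<Sum>i\<le>2 * k. real (2 * k choose i))"
      by (rule member_le_sum) auto
    also have "\<dots> = 2 ^ (2 * k)" using choose_row_sum[of "2 * k"] by (metis of_nat_numeral of_nat_power of_nat_sum)
    also have "\<dots> = (2 ^ k)\<^sup>2" by (simp add: power_mult[symmetric] mult.commute)
    finally have "sqrt (real (2 * k choose k)) \<le> 2 ^ k" by (intro real_le_lsqrt) auto
    then have "D' k \<le> 2 ^ k * (g 2 / 2) ^ k"
      unfolding D'_eq_central_binomial[OF that] using g_2_pos by (intro mult_right_mono) auto
    also have "\<dots> = g 2 ^ k" by (simp add: power_mult_distrib[symmetric])
    finally have "D' k * x ^ k \<le> g 2 ^ k * x ^ k" using assms by (intro mult_right_mono) auto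
    then show ?thesis using D'_pos[of k] that assms by (simp add: power_mult_distrib)
  qed
  then show "\<exists>N. \<forall>k\<ge>N. norm (D' k * x ^ k) \<le> (g 2 * x) ^ k" by blast
qed

text \<open>On the boundary of the disc of convergence the terms are at least 1/sqrt(2k). A block of
  n terms with indices up to 2n contributes at least sqrt(n)/2.\<close>

lemma D'_partial_sums_unbounded: "\<exists>n. C < (\<Sum>i<n. D' (l + 1 + i) * (1 / g 2) ^ (l + 1 + i))"
proof -
  \<comment> \<open>Skipping the first \<open>m\<close> terms brings the index
    \<open>l + 1 + i\<close> to at least 10, where the closed form of \<open>D\<close>
    applies.\<close>
  define m where "m = l + 11"
  have tm: "1 / sqrt (2 * real k) \<le> D' k * (1 / g 2) ^ k" if "10 \<le> k" for k
  proof -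
    have "4 ^ k / (2 * real k) \<le> real (2 * k choose k)" using that by (intro central_binomial_lower_bound) auto
    then have "sqrt (4 ^ k / (2 * real k)) \<le> sqrt (real (2 * k choose k))" by (rule real_sqrt_le_mono)
    moreover have "sqrt (4 ^ k) = 2 ^ k"
    proof -
      have "(4::real) ^ k = (2 ^ k)\<^sup>2" by (simp add: power2_eq_square power_mult_distrib[symmetric])
      then show ?thesis by simp
    qed
    ultimately have "2 ^ k / sqrt (2 * real k) \<le> sqrt (real (2 * k choose k))" by (simp add: real_sqrt_divide)
    then have "2 ^ k / sqrt (2 * real k) * (1 / 2) ^ k \<le> sqrt (real (2 * k choose k)) * (1 / 2) ^ k"
      by (intro mult_right_mono) auto
    moreover have "D' k * (1 / g 2) ^ k = sqrt (real (2 * k choose k)) * (1 / 2) ^ k"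
      unfolding D'_eq_central_binomial[OF that] using g_2_pos by (simp add: power_divide)
    ultimately show ?thesis by (simp add: power_divide)
  qed
  \<comment> \<open>The second condition keeps all indices \<open>l + 1 + i\<close> of the block
    {m..<m + n} below 2n.\<close>
  obtain n :: nat where n: "2 * \<bar>C\<bar> + 2 < sqrt (real n)" "m + m \<le> n"
  proof -
    obtain n0 :: nat where "(2 * \<bar>C\<bar> + 2)\<^sup>2 < real n0" using reals_Archimedean2 by blast
    then have "2 * \<bar>C\<bar> + 2 < sqrt (real (max n0 (m + m)))" by (intro real_less_rsqrt) auto
    then show ?thesis by (intro that[of "max n0 (m + m)"]) auto
  qed
  let ?t = "\<lambda>i. D' (l + 1 + i) * (1 / g 2) ^ (l + 1 + i)"
  have t0: "0 \<le> ?t i" for i using D'_pos[of "l + 1 + i"] g_2_pos by simp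
  have "sqrt (real n) / 2 = real n * (1 / sqrt (2 * real (2 * n)))"
    by (cases "n = 0") (simp_all add: real_sqrt_mult real_div_sqrt)
  also have "\<dots> = (\<Sum>i\<in>{m..<m + n}. 1 / sqrt (2 * real (2 * n)))" by simp
  also have "\<dots> \<le> (\<Sum>i\<in>{m..<m + n}. ?t i)"
  proof (rule sum_mono)
    fix i assume i: "i \<in> {m..<m + n}"
    have "1 / sqrt (2 * real (2 * n)) \<le> 1 / sqrt (2 * real (l + 1 + i))"
      using i n(2) by (intro divide_left_mono real_sqrt_le_mono) (auto simp: m_def)
    also have "\<dots> \<le> ?t i" using i by (intro tm) (auto simp: m_def)
    finally show "1 / sqrt (2 * real (2 * n)) \<le> ?t i" .
  qed
  also have "\<dots> \<le> (\<Sum>i<m + n. ?t i)" using t0 by (intro sum_mono2) auto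
  finally have "sqrt (real n) / 2 \<le> (\<Sum>i<m + n. ?t i)" .
  then show ?thesis using n(1) by (intro exI[of _ "m + n"]) linarith
qed

text \<open>In other words, h2(x)/x^(l+1) decreases strictly: the polynomial has degree at most
  \<open>l\<close>, and its constant term 2 supplies the strictness.\<close>

lemma h2_mono_strict:
  assumes "0 < x" "x < y"
  shows "h2 l y < (y / x) ^ (l + 1) * h2 l x"
proof -
  have yx: "1 < y / x" using assms by simp
  have "1 < (y / x) ^ (l + 1)" by (rule one_less_power[OF yx]) simp
  then have "2 < (y / x) ^ (l + 1) * 2" by linarith
  moreover have "(\<Sum>k = 1..l. D' k * y ^ k) \<le> (\<Sum>k = 1..l. (y / x) ^ (l + 1) * (D' k * x ^ k))"
  proof (rule sum_mono)
    fix k assume k: "k \<in> {1..l}"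
    have "y ^ k = (y / x) ^ k * x ^ k" using assms by (simp add: power_divide)
    also have "\<dots> \<le> (y / x) ^ (l + 1) * x ^ k"
      using yx k assms by (intro mult_right_mono power_increasing) auto
    finally have "D' k * y ^ k \<le> D' k * ((y / x) ^ (l + 1) * x ^ k)"
      using D'_pos[of k] k by (intro mult_left_mono) auto
    then show "D' k * y ^ k \<le> (y / x) ^ (l + 1) * (D' k * x ^ k)" by (simp add: mult_ac)
  qed
  ultimately show ?thesis by (simp add: h2_def distrib_left sum_distrib_left)
qed

lemma h2_pos: "0 \<le> x \<Longrightarrow> 0 < h2 l x"
  unfolding h2_def using D'_pos by (intro add_pos_nonneg sum_nonneg) (auto intro!: mult_nonneg_nonneg simp: less_imp_le)

text \<open>All exponents of \<open>h1\<close> are at least l + 1, so h1(x)/x^(l+1) does not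
  decrease, infinite values included. Against \<open>h2_mono_strict\<close> this leaves room for one
  crossing only.\<close>

lemma h1_scale:
  assumes "0 < x" "x \<le> y"
  shows "ennreal ((y / x) ^ (l + 1)) * h1 l x \<le> h1 l y"
  unfolding h1_def ennreal_suminf_cmult[symmetric]
proof (intro suminf_le summableI)
  fix i
  have "(y / x) ^ (l + 1) * x ^ (l + 1 + i) = y ^ (l + 1) * x ^ i"
    using assms by (simp add: power_divide power_add)
  also have "\<dots> \<le> y ^ (l + 1) * y ^ i"
    using assms by (intro mult_left_mono power_mono) auto
  also have "\<dots> = y ^ (l + 1 + i)" by (simp only: power_add)
  finally have "D' (l + 1 + i) * ((y / x) ^ (l + 1) * x ^ (l + 1 + i)) \<le> D' (l + 1 + i) * y ^ (l + 1 + i)"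
    using D'_pos[of "l + 1 + i"] by (intro mult_left_mono) auto
  then have "(y / x) ^ (l + 1) * (D' (l + 1 + i) * x ^ (l + 1 + i)) \<le> D' (l + 1 + i) * y ^ (l + 1 + i)"
    by (simp only: mult.left_commute)
  then show "ennreal ((y / x) ^ (l + 1)) * ennreal (D' (l + 1 + i) * x ^ (l + 1 + i)) \<le>
      ennreal (D' (l + 1 + i) * y ^ (l + 1 + i))"
    using assms D'_pos[of "l + 1 + i"] by (simp add: ennreal_mult[symmetric] ennreal_leI)
qed

text \<open>At the radius 1/g(2) some partial sum of \<open>h1\<close> exceeds \<open>h2\<close>,
  and by continuity it still does so at some \<open>x1\<close> inside the disc. On [0, x1]
  everything is finite and continuous, and at 0 the order is reversed, so the intermediate value
  theorem applies.\<close>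

lemma x_sol_ex: "\<exists>x>0. h1 l x = ennreal (h2 l x)"
proof -
  let ?\<rho> = "1 / g 2"
  define S where "S = (\<lambda>n x. \<Sum>i<n. D' (l + 1 + i) * x ^ (l + 1 + i))"
  \<comment> \<open>The real-valued form of \<open>h1 l\<close> inside the radius. Pulling out
    x^(l+1) leaves a power series in standard form, whose continuity extends to 0.\<close>
  define f where "f = (\<lambda>x. x ^ (l + 1) * (\<Sum>i. D' (l + 1 + i) * x ^ i))"
  have sm: "summable (\<lambda>i. D' (l + 1 + i) * x ^ i)" if x: "0 < x" "x < ?\<rho>" for x
  proof -
    have "summable (\<lambda>i. D' (i + (l + 1)) * x ^ (i + (l + 1)))"
      using summable_D'[of x] x by (subst summable_iff_shift) auto
    then have "summable (\<lambda>i. D' (i + (l + 1)) * x ^ (i + (l + 1)) / x ^ (l + 1))" by (rule summable_divide)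
    then show ?thesis using x by (simp add: power_add add_ac)
  qed
  have f: "(\<lambda>i. D' (l + 1 + i) * x ^ (l + 1 + i)) sums f x" if x: "0 < x" "x < ?\<rho>" for x
    using sums_mult[OF summable_sums[OF sm[OF x]], of "x ^ (l + 1)"]
    by (simp add: f_def power_add mult_ac)
  have h1f: "h1 l x = ennreal (f x)" if x: "0 < x" "x < ?\<rho>" for x
    unfolding h1_def using f[OF x] D'_pos x by (intro suminf_ennreal_eq) (auto simp: less_imp_le)
  have Sf: "S n x \<le> f x" if x: "0 < x" "x < ?\<rho>" for n x
    unfolding S_def sums_unique[OF f[OF x]] using D'_pos x
    by (intro sum_le_suminf sums_summable[OF f[OF x]]) (auto simp: less_imp_le)
  obtain n where n: "h2 l ?\<rho> < S n ?\<rho>" unfolding S_def using D'_partial_sums_unbounded by blast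
  have "isCont (\<lambda>x. S n x - h2 l x) ?\<rho>" unfolding S_def h2_def by (intro continuous_intros)
  then have "\<forall>\<^sub>F x in at_left ?\<rho>. 0 < S n x - h2 l x"
    using n order_tendstoD(1)[of "\<lambda>x. S n x - h2 l x" _ "at ?\<rho>" 0]
    by (simp add: isCont_def eventually_at_split)
  moreover have "\<forall>\<^sub>F x in at_left ?\<rho>. x \<in> {0<..<?\<rho>}"
    using g_2_pos by (intro eventually_at_left_real) simp
  ultimately have "\<forall>\<^sub>F x in at_left ?\<rho>. 0 < S n x - h2 l x \<and> x \<in> {0<..<?\<rho>}"
    by eventually_elim simp
  then obtain x1 where x1: "h2 l x1 < S n x1" "0 < x1" "x1 < ?\<rho>"
    using eventually_happens[of _ "at_left ?\<rho>"] by auto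
  \<comment> \<open>Summability at a point strictly beyond \<open>x1\<close> gives continuity of the
    power series up to and including \<open>x1\<close>.\<close>
  define K where "K = (x1 + ?\<rho>) / 2"
  have K: "x1 < K" "K < ?\<rho>" using x1 by (auto simp: K_def)
  have cont: "isCont (\<lambda>x. f x - h2 l x) x" if "0 \<le> x" "x \<le> x1" for x
    unfolding f_def h2_def using that K x1
    by (intro continuous_intros isCont_powser[OF sm[of K]]) auto
  have "\<exists>x\<ge>0. x \<le> x1 \<and> f x - h2 l x = 0"
    using x1 cont Sf[of x1 n] h2_pos[of 0 l] by (intro IVT) (auto simp: f_def)
  then obtain x where x: "0 \<le> x" "x \<le> x1" "f x = h2 l x" by auto
  have "x \<noteq> 0" using x(3) h2_pos[of 0 l] by (auto simp: f_def)
  then show ?thesis using x x1 h1f[of x] by (intro exI[of _ x]) auto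
qed

lemma x_sol: "0 < x_sol l" "h1 l (x_sol l) = ennreal (h2 l (x_sol l))"
proof -
  have "\<not> x < y" if x: "0 < x" "h1 l x = ennreal (h2 l x)" and y: "0 < y" "h1 l y = ennreal (h2 l y)" for x y
  proof
    assume "x < y"
    then have "ennreal ((y / x) ^ (l + 1)) * ennreal (h2 l x) \<le> ennreal (h2 l y)"
      using h1_scale[of x y l] x y by simp
    then have "(y / x) ^ (l + 1) * h2 l x \<le> h2 l y"
      using x y h2_pos[of x l] h2_pos[of y l] by (simp add: ennreal_mult[symmetric])
    then show False using h2_mono_strict[OF x(1) \<open>x < y\<close>, of l] by simp
  qed
  then have "\<exists>!x. x > 0 \<and> h1 l x = ennreal (h2 l x)"
    using x_sol_ex[of l] by (metis linorder_less_linear)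
  from theI'[OF this] show "0 < x_sol l" "h1 l (x_sol l) = ennreal (h2 l (x_sol l))"
    unfolding x_sol_def by auto
qed

text \<open>For \<open>\<beta> \<le> x_sol l\<close> the tail of the expansion is estimated, otherwise its head.\<close>

lemma c_const_bound:
  assumes \<beta>: "0 \<le> \<beta>"
  shows "\<beta> \<le> x_sol l \<Longrightarrow> (\<Sum>k = Suc l..n. D' k * \<beta> ^ k) \<le> c_const l * \<beta> ^ (l + 1)"
    and "x_sol l < \<beta> \<Longrightarrow> h2 l \<beta> \<le> c_const l * \<beta> ^ (l + 1)"
proof -
  note x = x_sol[of l]
  show "(\<Sum>k = Suc l..n. D' k * \<beta> ^ k) \<le> c_const l * \<beta> ^ (l + 1)" if le: "\<beta> \<le> x_sol l"
  proof -
    define t where "t = (\<lambda>k. D' k * x_sol l ^ k)"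
    have t0: "0 \<le> t (l + 1 + i)" for i using D'_pos[of "l + 1 + i"] x(1) by (simp add: t_def)
    have "(\<Sum>k = Suc l..n. t k) = (\<Sum>i<n - l. t (l + 1 + i))"
      by (rule sum.reindex_bij_witness[of _ "\<lambda>i. l + 1 + i" "\<lambda>k. k - Suc l"]) auto
    also have "ennreal \<dots> = (\<Sum>i<n - l. ennreal (t (l + 1 + i)))" using t0 by (simp add: sum_ennreal)
    also have "\<dots> \<le> h1 l (x_sol l)" unfolding h1_def t_def by (intro sum_le_suminf summableI) auto
    finally have tail: "(\<Sum>k = Suc l..n. t k) \<le> h2 l (x_sol l)"
      using x h2_pos[of "x_sol l" l] by simp
    have "(\<Sum>k = Suc l..n. D' k * \<beta> ^ k) \<le> (\<Sum>k = Suc l..n. t k * (\<beta> / x_sol l) ^ (l + 1))"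
    proof (rule sum_mono)
      fix k assume k: "k \<in> {Suc l..n}"
      have "\<beta> ^ k = x_sol l ^ k * (\<beta> / x_sol l) ^ k" using x(1) by (simp add: power_divide)
      also have "\<dots> \<le> x_sol l ^ k * (\<beta> / x_sol l) ^ (l + 1)"
        using x(1) \<beta> le k by (intro mult_left_mono power_decreasing) auto
      finally have "D' k * \<beta> ^ k \<le> D' k * (x_sol l ^ k * (\<beta> / x_sol l) ^ (l + 1))"
        using D'_pos[of k] k by (intro mult_left_mono) auto
      then show "D' k * \<beta> ^ k \<le> t k * (\<beta> / x_sol l) ^ (l + 1)"
        by (simp only: t_def mult.assoc)
    qed
    also have "\<dots> = (\<Sum>k = Suc l..n. t k) * (\<beta> / x_sol l) ^ (l + 1)" by (rule sum_distrib_right[symmetric])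
    also have "\<dots> \<le> h2 l (x_sol l) * (\<beta> / x_sol l) ^ (l + 1)"
      using tail x(1) \<beta> by (intro mult_right_mono) auto
    finally show ?thesis by (simp add: c_const_def power_divide)
  qed
  show "h2 l \<beta> \<le> c_const l * \<beta> ^ (l + 1)" if "x_sol l < \<beta>"
    using h2_mono_strict[OF x(1) that, of l] by (simp add: c_const_def power_divide mult.commute)
qed

section \<open>The expansion of a product of probability measures\<close>

text \<open>Consecutive terms have ratio at most 2, because (2k+2)(2k+1) \<le> (2(k+1))^2.\<close>

lemma sqrt_fact_ratio_le: "sqrt (fact (2 * (m + i))) / fact (m + i) \<le> 2 ^ i * (sqrt (fact (2 * m)) / fact m)"
proof (induction i)
  case (Suc i)
  let ?k = "m + i"
  have "fact (2 * Suc ?k) = real (2 * ?k + 2) * real (2 * ?k + 1) * fact (2 * ?k)" by (simp add: algebra_simps)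
  also have "\<dots> \<le> (2 * real (Suc ?k))\<^sup>2 * fact (2 * ?k)"
    unfolding power2_eq_square by (intro mult_right_mono mult_mono) auto
  finally have "sqrt (fact (2 * Suc ?k)) \<le> 2 * real (Suc ?k) * sqrt (fact (2 * ?k))"
    using real_sqrt_le_mono by (fastforce simp: real_sqrt_mult)
  then have "sqrt (fact (2 * Suc ?k)) / fact (Suc ?k) \<le> 2 * real (Suc ?k) * sqrt (fact (2 * ?k)) / fact (Suc ?k)"
    by (intro divide_right_mono) auto
  also have "\<dots> = 2 * (sqrt (fact (2 * ?k)) / fact ?k)" by (simp del: of_nat_Suc)
  also have "\<dots> \<le> 2 * (2 ^ i * (sqrt (fact (2 * m)) / fact m))" by (intro mult_left_mono Suc.IH) auto
  finally show ?case by simp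
qed simp

text \<open>Domination by a geometric series of ratio 2 x. With x = sqrt 2 * \<alpha> its
  denominator becomes 1 - 2^(3/2) \<alpha>.\<close>

lemma sum_sqrt_fact_le:
  assumes x: "0 \<le> x" "2 * x < 1"
  shows "(\<Sum>k = m..n. sqrt (fact (2 * k)) / fact k * x ^ k) \<le> sqrt (fact (2 * m)) / fact m * x ^ m / (1 - 2 * x)"
proof -
  let ?s = "\<lambda>k. sqrt (fact (2 * k)) / fact k"
  have "(\<Sum>k = m..n. ?s k * x ^ k) = (\<Sum>i<Suc n - m. ?s (m + i) * x ^ (m + i))"
    by (rule sum.reindex_bij_witness[of _ "\<lambda>i. m + i" "\<lambda>k. k - m"]) auto
  also have "\<dots> \<le> (\<Sum>i<Suc n - m. ?s m * x ^ m * (2 * x) ^ i)"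
  proof (rule sum_mono)
    fix i
    have "?s (m + i) * x ^ (m + i) \<le> (2 ^ i * ?s m) * x ^ (m + i)"
      using x by (intro mult_right_mono sqrt_fact_ratio_le) auto
    also have "\<dots> = ?s m * x ^ m * (2 * x) ^ i" by (simp only: power_add power_mult_distrib mult_ac)
    finally show "?s (m + i) * x ^ (m + i) \<le> ?s m * x ^ m * (2 * x) ^ i" .
  qed
  also have "\<dots> = ?s m * x ^ m * (\<Sum>i<Suc n - m. (2 * x) ^ i)" by (rule sum_distrib_left[symmetric])
  also have "\<dots> \<le> ?s m * x ^ m * (1 / (1 - 2 * x))"
  proof (rule mult_left_mono)
    have "(\<Sum>i<Suc n - m. (2 * x) ^ i) \<le> (\<Sum>i. (2 * x) ^ i)"
      using x by (intro sum_le_suminf summable_geometric) auto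
    also have "\<dots> = 1 / (1 - 2 * x)" using x by (intro suminf_geometric) auto
    finally show "(\<Sum>i<Suc n - m. (2 * x) ^ i) \<le> 1 / (1 - 2 * x)" .
  qed (use x in auto)
  finally show ?thesis by simp
qed

section \<open>Truncated densities\<close>

context measurable_abelian_semigroup
begin

text \<open>Truncation of a density at the level \<open>c\<close>: the part below the level is square integrable, the
  mass above the level is paid for in total variation.\<close>

lemma truncated_density:
  fixes f :: "'a \<Rightarrow> real"
  assumes Q: "prob_space Q" "sets Q = sets M" and N: "prob_space N" "N = density Q (\<lambda>x. ennreal (f x))"
    and f: "f \<in> borel_measurable Q" "AE x in Q. 0 \<le> f x" and c: "0 \<le> c"
  defines "G \<equiv> \<lambda>x. if 0 \<le> f x \<and> f x \<le> c then f x else 0"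
  shows "bounded_measurable M G" "\<And>x. 0 \<le> G x" "integral\<^sup>L Q G \<le> 1"
    "norm ((embed N - 1) - (embed (density Q G) - integral\<^sup>L Q G *\<^sub>R 1)) \<le> 2 * (1 - integral\<^sup>L Q G)"
    "norm (embed (density Q G) - integral\<^sup>L Q G *\<^sub>R 1) \<le> 2 * integral\<^sup>L Q G"
    "\<And>C d. 0 < C \<Longrightarrow> 0 \<le> d \<Longrightarrow> c = C * d \<Longrightarrow>
      (\<integral>x. f x * min (f x / C) d \<partial>Q) = (\<integral>x. (G x)\<^sup>2 \<partial>Q) / C + d * (1 - integral\<^sup>L Q G)"
proof -
  have sp: "space Q = UNIV" using sets_eq_imp_space_eq[OF Q(2)] by (simp add: space_eq_UNIV)
  interpret N: prob_space N by fact
  have sN: "sets N = sets M" "space N = UNIV" using N(2) Q(2) sp by auto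
  have fQ: "finite_measure Q" "finite_measure N" using Q(1) N(1) by (auto intro: finite_measure_prob_space)
  have GQ: "G \<in> borel_measurable Q" unfolding G_def using f(1) by measurable
  show Gb: "bounded_measurable M G"
    using GQ c by (intro bounded_measurableI[of _ _ c])
       (auto simp: G_def measurable_cong_sets[OF Q(2) refl, symmetric])
  \<comment> \<open>\<open>f\<close> is nonnegative almost everywhere only; the test
    \<open>0 \<le> f x\<close> in \<open>G\<close> makes \<open>G\<close> nonnegative at every
    point.\<close>
  show G0: "0 \<le> G x" for x by (simp add: G_def)
  note dens = density_finite[OF Q Gb G0]
  have bQ: "bounded_measurable Q h \<longleftrightarrow> bounded_measurable M h" for h
    by (simp add: bounded_measurable_def measurable_cong_sets[OF Q(2) refl])
  have intG: "integrable Q G" "integrable Q (\<lambda>x. (G x)\<^sup>2)"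
    using Gb by (auto intro!: integrable_bounded_measurable[OF fQ(1)] bounded_measurable_power2
      simp: bQ)
  have "(\<integral>\<^sup>+x. ennreal (f x) \<partial>Q) = 1"
    using N.emeasure_space_1 sets.top[of Q] f(1) unfolding N(2)
    by (simp add: emeasure_density sp cong: nn_integral_cong)
  then have int: "integrable Q f" "integral\<^sup>L Q f = 1"
    using f by (auto intro!: integrableI_nonneg simp: integral_eq_nn_integral)
  have GleF: "AE x in Q. G x \<le> f x" using f(2) by eventually_elim (simp add: G_def)
  show m1: "integral\<^sup>L Q G \<le> 1"
    using integral_mono_AE[OF intG(1) int(1) GleF] int(2) by simp
  define B where "B = {x. 0 \<le> f x \<and> f x \<le> c}"
  have B: "B \<in> sets M"
  proof -
    have "{x \<in> space Q. 0 \<le> f x \<and> f x \<le> c} \<in> sets Q" using f(1) by measurable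
    then show ?thesis by (simp add: B_def sp Q)
  qed
  have low: "measure (density Q G) A = measure N (A \<inter> B)" if A: "A \<in> sets M" for A
  proof -
    have "emeasure N (A \<inter> B) = (\<integral>\<^sup>+x. ennreal (f x) * indicator (A \<inter> B) x \<partial>Q)"
      unfolding N(2) using f(1) A B Q(2) by (intro emeasure_density) auto
    also have "\<dots> = (\<integral>\<^sup>+x. ennreal (G x) * indicator A x \<partial>Q)"
      by (intro nn_integral_cong) (auto simp: G_def B_def indicator_def)
    also have "\<dots> = emeasure (density Q G) A"
      using GQ A Q(2) by (intro emeasure_density[symmetric]) auto
    finally show ?thesis by (simp add: measure_def)
  qed
  \<comment> \<open>The restriction of \<open>N\<close> to the complement of \<open>B\<close>, so
    that \<open>N\<close> is the sum of \<open>density Q G\<close> and \<open>L\<close>; the points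
    with negative \<open>f\<close> form a null set.\<close>
  define L where "L = density N (indicator (UNIV - B))"
  have cB: "UNIV - B \<in> sets M" using sets.compl_sets[OF B] by (simp add: space_eq_UNIV)
  have L: "emeasure L A = emeasure N ((UNIV - B) \<inter> A)" if "A \<in> sets M" for A
    unfolding L_def using that cB sN by (intro emeasure_density[THEN trans]) (auto simp: nn_integral_indicator[symmetric] indicator_inter_arith[symmetric] simp del: nn_integral_indicator)
  have sL: "sets L = sets M" by (simp add: L_def sN)
  have fL: "finite_measure L"
    by (rule finite_measureI) (use L[OF sets.top] N.emeasure_finite in \<open>auto simp: L_def sN space_eq_UNIV\<close>)
  have high: "measure L A = measure N A - measure N (A \<inter> B)" if A: "A \<in> sets M" for A
  proof -
    have "measure L A = measure N (A - (A \<inter> B))"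
      by (simp add: measure_def L[OF A]) (rule arg_cong[where f="\<lambda>X. enn2real (emeasure N X)"], auto)
    also have "\<dots> = measure N A - measure N (A \<inter> B)"
      using A B sN by (intro N.finite_measure_Diff) auto
    finally show ?thesis .
  qed
  have UM: "UNIV \<in> sets M" using sets.top[of M] by (simp add: space_eq_UNIV)
  have massN: "measure N UNIV = 1" using N.prob_space by (simp add: sN)
  have massL: "measure L UNIV = 1 - integral\<^sup>L Q G"
    using high[OF UM] low[OF UM] dens(2) massN by simp
  have "1 *\<^sub>R embed N = (\<Sum>b\<in>UNIV. 1 *\<^sub>R embed (if b then density Q G else L))"
    by (rule embed_sum) (auto simp: fQ dens(1) Q(2) sL fL sN low high UNIV_bool)
  then have eN: "embed N = embed (density Q G) + embed L" by (simp add: UNIV_bool)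
  have two: "norm (embed K - measure K UNIV *\<^sub>R 1) \<le> 2 * measure K UNIV"
    if "finite_measure K" "sets K = sets M" for K
    using norm_triangle_ineq4[of "embed K" "measure K UNIV *\<^sub>R 1"] norm_embed[OF that] by simp
  have "(embed N - 1) - (embed (density Q G) - integral\<^sup>L Q G *\<^sub>R 1) = embed L - (1 - integral\<^sup>L Q G) *\<^sub>R 1"
    by (simp add: eN scaleR_diff_left)
  then show "norm ((embed N - 1) - (embed (density Q G) - integral\<^sup>L Q G *\<^sub>R 1)) \<le> 2 * (1 - integral\<^sup>L Q G)"
    using two[OF fL sL] by (simp add: massL)
  show "norm (embed (density Q G) - integral\<^sup>L Q G *\<^sub>R 1) \<le> 2 * integral\<^sup>L Q G"
    using two[OF dens(1,3)] by (simp add: dens(2))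
  show "(\<integral>x. f x * min (f x / C) d \<partial>Q) = (\<integral>x. (G x)\<^sup>2 \<partial>Q) / C + d * (1 - integral\<^sup>L Q G)"
    if C: "0 < C" "0 \<le> d" "c = C * d" for C d
  proof -
    \<comment> \<open>Up to the level C d the minimum is f/C and f - G vanishes; above it the
      minimum is d and G vanishes. One formula thus covers both ranges almost everywhere.\<close>
    have "(\<integral>x. f x * min (f x / C) d \<partial>Q) = (\<integral>x. (G x)\<^sup>2 / C + d * (f x - G x) \<partial>Q)"
    proof (rule integral_cong_AE)
      show "AE x in Q. f x * min (f x / C) d = (G x)\<^sup>2 / C + d * (f x - G x)"
        using f(2)
      proof eventually_elim
        case (elim x)
        show ?case
        proof (cases "f x \<le> c")
          case True
          then have "f x / C \<le> d" using C by (simp add: field_simps)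
          then show ?thesis using True elim by (simp add: G_def min_def power2_eq_square)
        next
          case False
          then have "\<not> f x / C \<le> d" using C by (simp add: field_simps)
          then show ?thesis using False by (simp add: G_def min_def)
        qed
      qed
    qed (use f(1) GQ in measurable)
    also have "\<dots> = (\<integral>x. (G x)\<^sup>2 \<partial>Q) / C + d * (1 - integral\<^sup>L Q G)"
      using intG int by simp
    finally show ?thesis .
  qed
qed

text \<open>For the squares every factor is taken twice, with index set
  \<open>J \<times> UNIV\<close> over the booleans. The 2 |J| factors produce (2 |J|)!, and the root
  of the product of the squared second moments is their product.\<close>

lemma norm_prod_truncated_smoothing:
  fixes G :: "nat \<Rightarrow> 'a \<Rightarrow> real"
  assumes J: "finite J" and Q: "prob_space Q" "sets Q = sets M" and t: "0 < t"
    and G: "\<And>j. j \<in> J \<Longrightarrow> bounded_measurable M (G j)" "\<And>j x. j \<in> J \<Longrightarrow> 0 \<le> G j x"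
    and p: "\<And>j. j \<in> J \<Longrightarrow> 0 \<le> p j"
  defines "S \<equiv> \<lambda>j. p j *\<^sub>R (embed (density Q (G j)) - integral\<^sup>L Q (G j) *\<^sub>R 1)"
  shows "norm ((\<Prod>j\<in>J. (S j)\<^sup>2) * exp (t *\<^sub>R (embed Q - 1))) \<le>
      sqrt (fact (2 * card J)) * (\<Prod>j\<in>J. (p j)\<^sup>2 * ((\<integral>x. (G j x)\<^sup>2 \<partial>Q) / t))"
    and "\<And>j. j \<in> J \<Longrightarrow> norm (S j * exp (t *\<^sub>R (embed Q - 1))) \<le> p j * sqrt ((\<integral>x. (G j x)\<^sup>2 \<partial>Q) / t)"
proof -
  define y where "y = (\<lambda>j. embed (density Q (G j)) - integral\<^sup>L Q (G j) *\<^sub>R 1)"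
  define a where "a = (\<lambda>j. (\<integral>x. (G j x)\<^sup>2 \<partial>Q) / t)"
  have a: "0 \<le> a j" for j using t by (simp add: a_def)
  let ?E = "exp (t *\<^sub>R (embed Q - 1))"
  have square: "(\<Prod>i\<in>J \<times> (UNIV :: bool set). z (fst i)) = (\<Prod>j\<in>J. (z j)\<^sup>2)" for z :: "nat \<Rightarrow> 'c::comm_ring_1"
  proof -
    have "(\<Prod>i\<in>J \<times> (UNIV :: bool set). z (fst i)) = (\<Prod>j\<in>J. \<Prod>b\<in>(UNIV :: bool set). z j)"
      by (subst prod.cartesian_product) (simp add: case_prod_unfold)
    then show ?thesis by (simp add: card_UNIV_bool)
  qed
  have "norm ((\<Prod>i\<in>J \<times> (UNIV :: bool set). y (fst i)) * ?E) \<le>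
      sqrt (fact (card (J \<times> (UNIV :: bool set))) * (\<Prod>i\<in>J \<times> (UNIV :: bool set). a (fst i)))"
    unfolding a_def y_def
    by (rule norm_poisson_smoothing[where G="\<lambda>i. G (fst i)"]) (use J Q t G in auto)
  also have "\<dots> = sqrt (fact (2 * card J)) * (\<Prod>j\<in>J. a j)"
    using a by (simp add: square card_cartesian_product mult.commute real_sqrt_mult prod_power_distrib[symmetric] prod_nonneg)
  finally have sq: "norm ((\<Prod>j\<in>J. (y j)\<^sup>2) * ?E) \<le> sqrt (fact (2 * card J)) * (\<Prod>j\<in>J. a j)"
    by (simp only: square)
  have S: "S j = p j *\<^sub>R y j" for j by (simp add: S_def y_def)
  have "(\<Prod>j\<in>J. (S j)\<^sup>2) * ?E = (\<Prod>j\<in>J. (p j)\<^sup>2) *\<^sub>R ((\<Prod>j\<in>J. (y j)\<^sup>2) * ?E)"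
    using J by (induction J rule: finite_induct) (simp_all add: S power_mult_distrib mult_ac)
  also have "norm \<dots> \<le> (\<Prod>j\<in>J. (p j)\<^sup>2) * (sqrt (fact (2 * card J)) * (\<Prod>j\<in>J. a j))"
    using sq by (simp add: abs_prod mult_left_mono prod_nonneg)
  finally show "norm ((\<Prod>j\<in>J. (S j)\<^sup>2) * ?E) \<le> sqrt (fact (2 * card J)) * (\<Prod>j\<in>J. (p j)\<^sup>2 * ((\<integral>x. (G j x)\<^sup>2 \<partial>Q) / t))"
  proof -
    have e: "(\<Prod>j\<in>J. (p j)\<^sup>2 * ((\<integral>x. (G j x)\<^sup>2 \<partial>Q) / t)) = (\<Prod>j\<in>J. (p j)\<^sup>2) * (\<Prod>j\<in>J. a j)"
      by (simp only: prod.distrib a_def)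
    assume "norm ((\<Prod>j\<in>J. (S j)\<^sup>2) * ?E) \<le> (\<Prod>j\<in>J. (p j)\<^sup>2) * (sqrt (fact (2 * card J)) * (\<Prod>j\<in>J. a j))"
    then show ?thesis unfolding e by (simp only: mult_ac)
  qed
  fix j assume j: "j \<in> J"
  have "norm ((\<Prod>i\<in>{j}. y i) * ?E) \<le> sqrt (fact (card {j}) * (\<Prod>i\<in>{j}. a i))"
    unfolding a_def y_def by (rule norm_poisson_smoothing) (use Q t G j in auto)
  then have "norm (y j * ?E) \<le> sqrt (a j)" by simp
  then show "norm (S j * ?E) \<le> p j * sqrt ((\<integral>x. (G j x)\<^sup>2 \<partial>Q) / t)"
    using p[OF j] by (simp add: S mult_left_mono a_def)
qed

end

section \<open>The setting of the theorem inside the algebra\<close>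

context
  fixes M :: "'a::comm_monoid_add measure" and n :: nat and p :: "nat \<Rightarrow> real" and Q :: "nat \<Rightarrow> 'a measure"
    and f :: "nat \<Rightarrow> 'a \<Rightarrow> real" and Qbar :: "'a measure" and lam :: real
  assumes M: "measurable_abelian_semigroup M" and n: "1 \<le> n"
    and p: "\<And>j. j \<in> {1..n} \<Longrightarrow> 0 < p j \<and> p j \<le> 1"
    and Q: "\<And>j. j \<in> {1..n} \<Longrightarrow> prob_space (Q j) \<and> sets (Q j) = sets M"
    and lam_def: "lam = (\<Sum>j = 1..n. p j)"
    and Qbar_def: "Qbar = mixture M {1..n} p Q"
    and f: "\<And>j. j \<in> {1..n} \<Longrightarrow> f j \<in> borel_measurable Qbar \<and>
          (AE x in Qbar. 0 \<le> f j x) \<and> Q j = density Qbar (\<lambda>x. ennreal (f j x))"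
begin

interpretation measurable_abelian_semigroup M by (rule M)

private abbreviation (input) "I \<equiv> {1..n}"

private definition r :: "nat \<Rightarrow> 'a smeasure" where "r j = p j *\<^sub>R (embed (Q j) - 1)"

private lemma lam_pos: "0 < lam"
  unfolding lam_def using n p by (intro sum_pos) auto

private lemma fQ: "j \<in> I \<Longrightarrow> finite_measure (Q j)" "j \<in> I \<Longrightarrow> sets (Q j) = sets M"
  using Q by (auto intro: finite_measure_prob_space)

private lemma sets_Qbar: "sets Qbar = sets M"
  by (simp add: Qbar_def mixture_def)

private lemma emeasure_Qbar: "A \<in> sets M \<Longrightarrow> emeasure Qbar A = ennreal (1 / lam * (\<Sum>j\<in>I. p j * measure (Q j) A))"
  unfolding Qbar_def lam_def using p fQ by (intro emeasure_mixture) (auto simp: less_imp_le)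

private lemma measure_Qbar:
  assumes "A \<in> sets M" shows "lam * measure Qbar A = (\<Sum>j\<in>I. p j * measure (Q j) A)"
proof -
  have "0 \<le> 1 / lam * (\<Sum>j\<in>I. p j * measure (Q j) A)"
    using p lam_pos by (intro mult_nonneg_nonneg sum_nonneg) (auto simp: less_imp_le)
  then show ?thesis using lam_pos by (simp add: measure_def[of Qbar] emeasure_Qbar[OF assms])
qed

private lemma prob_Qbar: "prob_space Qbar"
proof
  have UM: "UNIV \<in> sets M" using sets.top[of M] by (simp add: space_eq_UNIV)
  have "measure (Q j) UNIV = 1" if "j \<in> I" for j
    using Q[OF that] sets_eq_imp_space_eq[of "Q j" M] prob_space.prob_space[of "Q j"] by (simp add: space_eq_UNIV)
  then have "(\<Sum>j\<in>I. p j * measure (Q j) UNIV) = lam" by (simp add: lam_def)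
  then show "emeasure Qbar (space Qbar) = 1"
    using emeasure_Qbar[OF UM] lam_pos sets_eq_imp_space_eq[OF sets_Qbar] by (simp add: space_eq_UNIV)
qed

text \<open>Identifies the exponential common to all terms of the expansion with exp(lambda (Q -
  delta_0)), the one in the definition of \<open>H\<close>.\<close>

private lemma sum_r: "(\<Sum>j\<in>I. r j) = lam *\<^sub>R (embed Qbar - 1)"
proof -
  have "lam *\<^sub>R embed Qbar = (\<Sum>j\<in>I. p j *\<^sub>R embed (Q j))"
    using fQ prob_Qbar by (intro embed_sum measure_Qbar sets_Qbar) (auto intro: finite_measure_prob_space)
  then show ?thesis
    by (simp add: r_def scaleR_diff_right sum_subtractf lam_def scaleR_sum_left)
qed

private lemma norm_embed_Q:
  assumes j: "j \<in> I" shows "norm (embed (Q j)) \<le> 1"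
proof (rule order_trans[OF norm_embed[OF fQ(1)[OF j] fQ(2)[OF j]]])
  show "measure (Q j) UNIV \<le> 1" using Q[OF j] prob_space.prob_le_1 by blast
qed

private lemma norm_r: "j \<in> I \<Longrightarrow> norm (r j) \<le> 2 * p j"
  using norm_triangle_ineq4[of "embed (Q j)" 1] norm_embed_Q[of j] p[of j]
  by (simp add: r_def mult.commute[of _ "p j"])

text \<open>Both bounds use this decomposition: (C, d) is (2^(3/2) lambda, 2) for the first and
  (lambda, 1) for the second, and \<open>t\<close> is 1 or 1/2. The number \<open>b j\<close> is the
  mass of \<open>Q j\<close> above the level \<open>C * d\<close>, and \<open>a j\<close> is the
  second moment of the truncated density divided by lambda.\<close>

private lemma truncation:
  assumes C: "0 < C" and d: "0 \<le> d"
  obtains S T :: "nat \<Rightarrow> 'a smeasure" and a b :: "nat \<Rightarrow> real" where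
    "\<And>j. j \<in> I \<Longrightarrow> r j = S j + T j" "\<And>j. j \<in> I \<Longrightarrow> norm (T j) \<le> 2 * p j * b j"
    "\<And>j. j \<in> I \<Longrightarrow> norm (T j * (2 * S j + T j)) \<le> 8 * (p j)\<^sup>2 * b j"
    "\<And>j. j \<in> I \<Longrightarrow> 0 \<le> a j" "\<And>j. j \<in> I \<Longrightarrow> 0 \<le> b j"
    "\<And>J t. J \<subseteq> I \<Longrightarrow> 0 < t \<Longrightarrow> norm ((\<Prod>j\<in>J. (S j)\<^sup>2) * exp (t *\<^sub>R (\<Sum>j\<in>I. r j))) \<le>
      sqrt (fact (2 * card J)) * (\<Prod>j\<in>J. (p j)\<^sup>2 * (a j / t))"
    "\<And>j t. j \<in> I \<Longrightarrow> 0 < t \<Longrightarrow> norm (S j * exp (t *\<^sub>R (\<Sum>j\<in>I. r j))) \<le> p j * sqrt (a j / t)"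
    "\<And>j. j \<in> I \<Longrightarrow> (\<integral>x. f j x * min (f j x / C) d \<partial>Qbar) = a j * (lam / C) + d * b j"
proof -
  define G where "G = (\<lambda>j x. if 0 \<le> f j x \<and> f j x \<le> C * d then f j x else 0)"
  define m where "m = (\<lambda>j. integral\<^sup>L Qbar (G j))"
  define S where "S = (\<lambda>j. p j *\<^sub>R (embed (density Qbar (G j)) - m j *\<^sub>R 1))"
  define a where "a = (\<lambda>j. (\<integral>x. (G j x)\<^sup>2 \<partial>Qbar) / lam)"
  have c: "0 \<le> C * d" using C d by simp
  have tr: "bounded_measurable M (G j)" "\<And>x. 0 \<le> G j x" "m j \<le> 1"
      "norm ((embed (Q j) - 1) - (embed (density Qbar (G j)) - m j *\<^sub>R 1)) \<le> 2 * (1 - m j)"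
      "norm (embed (density Qbar (G j)) - m j *\<^sub>R 1) \<le> 2 * m j"
      "(\<integral>x. f j x * min (f j x / C) d \<partial>Qbar) = (\<integral>x. (G j x)\<^sup>2 \<partial>Qbar) / C + d * (1 - m j)"
    if j: "j \<in> I" for j
  proof -
    have N: "prob_space (Q j)" "Q j = density Qbar (\<lambda>x. ennreal (f j x))" "f j \<in> borel_measurable Qbar"
      "AE x in Qbar. 0 \<le> f j x" using Q[OF j] f[OF j] by auto
    note t = truncated_density[OF prob_Qbar sets_Qbar N c, folded G_def m_def]
    show "bounded_measurable M (G j)" "\<And>x. 0 \<le> G j x" "m j \<le> 1"
      "norm ((embed (Q j) - 1) - (embed (density Qbar (G j)) - m j *\<^sub>R 1)) \<le> 2 * (1 - m j)"
      "norm (embed (density Qbar (G j)) - m j *\<^sub>R 1) \<le> 2 * m j"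
      "(\<integral>x. f j x * min (f j x / C) d \<partial>Qbar) = (\<integral>x. (G j x)\<^sup>2 \<partial>Qbar) / C + d * (1 - m j)"
      unfolding G_def m_def
      using truncated_density[OF prob_Qbar sets_Qbar N c] C d by simp_all
  qed
  have nS: "norm (S j) \<le> 2 * p j * m j" if j: "j \<in> I" for j
    using mult_left_mono[OF tr(5)[OF j], of "p j"] p[OF j] by (simp add: S_def mult_ac)
  have nT: "norm (r j - S j) \<le> 2 * p j * (1 - m j)" if j: "j \<in> I" for j
    using mult_left_mono[OF tr(4)[OF j], of "p j"] p[OF j]
    by (simp add: S_def r_def scaleR_diff_right[symmetric] mult_ac)
  have exp_t: "exp (t *\<^sub>R (\<Sum>j\<in>I. r j)) = exp ((t * lam) *\<^sub>R (embed Qbar - 1))" for t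
    unfolding sum_r by simp
  show ?thesis
  proof (rule that[of S "\<lambda>j. r j - S j" "\<lambda>j. 1 - m j" a])
    fix j assume j: "j \<in> I"
    show "r j = S j + (r j - S j)" by simp
    show "norm (r j - S j) \<le> 2 * p j * (1 - m j)" by (rule nT[OF j])
    show "0 \<le> a j" using lam_pos by (simp add: a_def)
    show "0 \<le> 1 - m j" using tr(3)[OF j] by simp
    \<comment> \<open>With m = 1 - b the truncated mass, \<open>S j\<close> has norm at most 2 p m
      and \<open>T j\<close> at most 2 p b, so 2 S + T is bounded by 4 p m + 2 p b = 4 p - 2 p b.
      Dropping the last term gives the constant 8 = 2 * 4.\<close>
    have "norm (2 * S j + (r j - S j)) \<le> norm (S j) + norm (S j) + norm (r j - S j)"
      unfolding mult_2 by (intro norm_triangle_le add_mono norm_triangle_ineq order_refl)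
    also have "\<dots> \<le> 4 * p j - 2 * p j * (1 - m j)"
      using nS[OF j] nT[OF j] by (simp add: algebra_simps)
    also have "\<dots> \<le> 4 * p j" using tr(3)[OF j] p[OF j] by simp
    finally have "norm ((r j - S j) * (2 * S j + (r j - S j))) \<le> (2 * p j * (1 - m j)) * (4 * p j)"
      by (intro norm_mult_le nT[OF j])
    then show "norm ((r j - S j) * (2 * S j + (r j - S j))) \<le> 8 * (p j)\<^sup>2 * (1 - m j)"
      by (simp add: power2_eq_square mult_ac)
    show "(\<integral>x. f j x * min (f j x / C) d \<partial>Qbar) = a j * (lam / C) + d * (1 - m j)"
      using tr(6)[OF j] lam_pos by (simp add: a_def)
  next
    fix J :: "nat set" and t :: real assume J: "J \<subseteq> I" and t: "0 < t"
    then have "0 < t * lam" "finite J" using lam_pos finite_subset by auto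
    then show "norm ((\<Prod>j\<in>J. (S j)\<^sup>2) * exp (t *\<^sub>R (\<Sum>j\<in>I. r j))) \<le>
        sqrt (fact (2 * card J)) * (\<Prod>j\<in>J. (p j)\<^sup>2 * (a j / t))"
      unfolding exp_t using norm_prod_truncated_smoothing(1)[of J Qbar "t * lam" G p] J tr p prob_Qbar sets_Qbar
      by (simp add: S_def m_def a_def subset_eq less_imp_le mult.commute)
  next
    fix j and t :: real assume j: "j \<in> I" and t: "0 < t"
    then have "0 < t * lam" using lam_pos by auto
    then show "norm (S j * exp (t *\<^sub>R (\<Sum>j\<in>I. r j))) \<le> p j * sqrt (a j / t)"
      unfolding exp_t using norm_prod_truncated_smoothing(2)[of "{j}" Qbar "t * lam" G p j] j tr p prob_Qbar sets_Qbar
      by (simp add: S_def m_def a_def less_imp_le mult.commute)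
  qed
qed

text \<open>The decomposition of \<open>r j\<close> holds for indices in \<open>I\<close> only, so
  the functions themselves cannot be exchanged; all sums and products involved run over subsets of
  \<open>I\<close>.\<close>

private lemma r_sums:
  fixes S T :: "nat \<Rightarrow> 'a smeasure"
  assumes "\<And>j. j \<in> I \<Longrightarrow> r j = S j + T j"
  shows "(\<Sum>j\<in>I. S j + T j) = (\<Sum>j\<in>I. r j)" "kerstan_term I (\<lambda>j. S j + T j) k = kerstan_term I r k"
proof -
  show s: "(\<Sum>j\<in>I. S j + T j) = (\<Sum>j\<in>I. r j)" by (rule sum.cong) (simp_all only: assms)
  have "(\<Prod>j\<in>J. (1 + (S j + T j)) * exp (- (S j + T j)) - 1) = (\<Prod>j\<in>J. (1 + r j) * exp (- r j) - 1)"
    if "J \<subseteq> I" for J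
    using that by (intro prod.cong refl) (simp only: assms subsetD)
  then show "kerstan_term I (\<lambda>j. S j + T j) k = kerstan_term I r k"
    unfolding kerstan_term_def s by (intro arg_cong2[where f="(*)"] sum.cong refl) auto
qed

private definition \<alpha> :: real where
  "\<alpha> = (\<Sum>j = 1..n. g (2 * p j) * (p j)\<^sup>2 * (\<integral>x. f j x * min (f j x / (2 powr (3/2) * lam)) 2 \<partial>Qbar))"

private definition \<beta> :: real where
  "\<beta> = (\<Sum>j = 1..n. (p j)\<^sup>2 * (\<integral>x. f j x * min (f j x / lam) 1 \<partial>Qbar))"

private lemma powr_3_2: "2 powr (3/2) = 2 * sqrt (2::real)"
proof -
  have "2 powr (1 + 1/2) = 2 powr 1 * 2 powr (1/2 :: real)" by (rule powr_add)
  then show ?thesis by (simp add: powr_half_sqrt)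
qed

private lemma kerstan_term_le_\<alpha>:
  "norm (kerstan_term I r k) \<le> sqrt (fact (2 * k)) / fact k * (sqrt 2 * \<alpha>) ^ k" "0 \<le> \<alpha>"
proof -
  have C: "0 < 2 powr (3/2) * lam" using lam_pos by simp
  obtain S T :: "nat \<Rightarrow> 'a smeasure" and a b :: "nat \<Rightarrow> real" where
    ST: "\<And>j. j \<in> I \<Longrightarrow> r j = S j + T j" "\<And>j. j \<in> I \<Longrightarrow> norm (T j) \<le> 2 * p j * b j"
    "\<And>j. j \<in> I \<Longrightarrow> norm (T j * (2 * S j + T j)) \<le> 8 * (p j)\<^sup>2 * b j"
    "\<And>j. j \<in> I \<Longrightarrow> 0 \<le> a j" "\<And>j. j \<in> I \<Longrightarrow> 0 \<le> b j"
    "\<And>J t. J \<subseteq> I \<Longrightarrow> 0 < t \<Longrightarrow> norm ((\<Prod>j\<in>J. (S j)\<^sup>2) * exp (t *\<^sub>R (\<Sum>j\<in>I. r j))) \<le>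
      sqrt (fact (2 * card J)) * (\<Prod>j\<in>J. (p j)\<^sup>2 * (a j / t))"
    and int: "\<And>j. j \<in> I \<Longrightarrow> (\<integral>x. f j x * min (f j x / (2 powr (3/2) * lam)) 2 \<partial>Qbar) =
      a j * (lam / (2 powr (3/2) * lam)) + 2 * b j"
    by (rule truncation[OF C, of 2]) auto
  \<comment> \<open>The weights in \<open>\<alpha>\<close> are made for this: sqrt 2 / (2 sqrt 2) =
    1/2 in front of \<open>a j\<close>, and sqrt 2 * 2 = (1/2) * 4 sqrt 2 in front of
    \<open>b j\<close>.\<close>
  have summand: "sqrt 2 * (g (2 * p j) * (p j)\<^sup>2 * (\<integral>x. f j x * min (f j x / (2 powr (3/2) * lam)) 2 \<partial>Qbar)) =
      g (2 * p j) / 2 * ((p j)\<^sup>2 * a j + 4 * sqrt 2 * (p j)\<^sup>2 * b j)" if j: "j \<in> I" for j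
    unfolding int[OF j] unfolding powr_3_2 using lam_pos by (simp add: field_simps)
  have "sqrt 2 * \<alpha> = (\<Sum>j\<in>I. g (2 * p j) / 2 * ((p j)\<^sup>2 * a j + 4 * sqrt 2 * (p j)\<^sup>2 * b j))"
    unfolding \<alpha>_def sum_distrib_left by (rule sum.cong[OF refl summand])
  moreover have "norm (kerstan_term I r k) \<le> sqrt (fact (2 * k)) / fact k *
      (\<Sum>j\<in>I. g (2 * p j) / 2 * ((p j)\<^sup>2 * a j + 4 * sqrt 2 * (p j)\<^sup>2 * b j)) ^ k"
  proof (rule norm_kerstan_term_le_g[where S=S and T=T])
    show "norm ((\<Prod>j\<in>J. (S j)\<^sup>2) * exp (\<Sum>j\<in>I. r j)) \<le> sqrt (fact (2 * card J)) * (\<Prod>j\<in>J. (p j)\<^sup>2 * a j)"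
      if "J \<subseteq> I" for J using ST(6)[OF that, of 1] by simp
  qed (use ST(1,3,4,5) norm_r p in \<open>auto simp: less_imp_le\<close>)
  ultimately show "norm (kerstan_term I r k) \<le> sqrt (fact (2 * k)) / fact k * (sqrt 2 * \<alpha>) ^ k" by simp
  have "0 \<le> a j * (lam / (2 powr (3/2) * lam)) + 2 * b j" if "j \<in> I" for j
    using ST(4,5)[OF that] lam_pos by simp
  then show "0 \<le> \<alpha>"
    unfolding \<alpha>_def using p by (intro sum_nonneg mult_nonneg_nonneg g_nonneg) (auto simp: int less_imp_le)
qed

text \<open>The level \<open>lam\<close> makes the integral in \<open>\<beta>\<close> equal to
  \<open>a j + b j\<close>. Smoothing time 1/2 is used throughout; k = 1 has its own argument, which
  produces 3.11, and k \<ge> 2 is settled by \<open>D'_bound\<close>.\<close>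

private lemma kerstan_term_le_\<beta>:
  "1 \<le> k \<Longrightarrow> norm (kerstan_term I r k) \<le> D' k * \<beta> ^ k" "0 \<le> \<beta>"
proof -
  obtain S T :: "nat \<Rightarrow> 'a smeasure" and a b :: "nat \<Rightarrow> real" where
    ST: "\<And>j. j \<in> I \<Longrightarrow> r j = S j + T j" "\<And>j. j \<in> I \<Longrightarrow> norm (T j) \<le> 2 * p j * b j"
    "\<And>j. j \<in> I \<Longrightarrow> norm (T j * (2 * S j + T j)) \<le> 8 * (p j)\<^sup>2 * b j"
    "\<And>j. j \<in> I \<Longrightarrow> 0 \<le> a j" "\<And>j. j \<in> I \<Longrightarrow> 0 \<le> b j"
    "\<And>J t. J \<subseteq> I \<Longrightarrow> 0 < t \<Longrightarrow> norm ((\<Prod>j\<in>J. (S j)\<^sup>2) * exp (t *\<^sub>R (\<Sum>j\<in>I. r j))) \<le>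
      sqrt (fact (2 * card J)) * (\<Prod>j\<in>J. (p j)\<^sup>2 * (a j / t))"
    "\<And>j t. j \<in> I \<Longrightarrow> 0 < t \<Longrightarrow> norm (S j * exp (t *\<^sub>R (\<Sum>j\<in>I. r j))) \<le> p j * sqrt (a j / t)"
    and int: "\<And>j. j \<in> I \<Longrightarrow> (\<integral>x. f j x * min (f j x / lam) 1 \<partial>Qbar) = a j * (lam / lam) + 1 * b j"
    by (rule truncation[OF lam_pos, of 1]) auto
  have rs: "(\<Sum>j\<in>I. S j + T j) = (\<Sum>j\<in>I. r j)" by (rule r_sums(1)) (rule ST(1))
  have rk: "kerstan_term I (\<lambda>j. S j + T j) k = kerstan_term I r k" for k
    by (rule r_sums(2)) (rule ST(1))
  have \<beta>: "\<beta> = (\<Sum>j\<in>I. (p j)\<^sup>2 * (a j + b j))"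
    unfolding \<beta>_def using lam_pos by (intro sum.cong refl) (simp add: int)
  show "0 \<le> \<beta>" unfolding \<beta> using ST(4,5) by (intro sum_nonneg mult_nonneg_nonneg add_nonneg_nonneg) auto
  have smooth: "norm ((\<Prod>j\<in>J. (S j)\<^sup>2) * exp ((1/2) *\<^sub>R (\<Sum>j\<in>I. S j + T j))) \<le>
      sqrt (fact (2 * card J)) * (\<Prod>j\<in>J. 2 * ((p j)\<^sup>2 * a j))" if "J \<subseteq> I" for J
    unfolding rs using ST(6)[OF that, of "1/2"] by (simp add: mult_ac)
  have R: "S j + T j = p j *\<^sub>R (embed (Q j) - 1)" if "j \<in> I" for j
    using ST(1)[OF that] by (simp add: r_def)
  assume k: "1 \<le> k"
  show "norm (kerstan_term I r k) \<le> D' k * \<beta> ^ k"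
  proof (cases "k = 1")
    case True
    have "norm (kerstan_term I (\<lambda>j. S j + T j) 1) \<le> 311/100 * (\<Sum>j\<in>I. (p j)\<^sup>2 * (a j + b j))"
    proof (rule norm_kerstan_term_1_le[OF _ R norm_embed_Q])
      fix j assume j: "j \<in> I"
      show "norm (S j * exp ((1/2) *\<^sub>R (\<Sum>j\<in>I. S j + T j))) \<le> sqrt 2 * p j * sqrt (a j)"
        unfolding rs using ST(7)[OF j, of "1/2"] by (simp add: real_sqrt_mult mult_ac)
      show "norm ((S j)\<^sup>2 * exp ((1/2) *\<^sub>R (\<Sum>j\<in>I. S j + T j))) \<le> 2 * sqrt 2 * ((p j)\<^sup>2 * a j)"
        using smooth[of "{j}"] j by (simp add: mult_ac)
    qed (use ST p in \<open>auto simp: less_imp_le\<close>)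
    then show ?thesis unfolding rk \<beta> True by (simp add: D'_def)
  next
    case False
    have "norm (kerstan_term I (\<lambda>j. S j + T j) k) \<le> D' k * (\<Sum>j\<in>I. (p j)\<^sup>2 * (a j + b j)) ^ k"
      by (rule norm_kerstan_term_le_half[OF _ R norm_embed_Q])
         (use ST p smooth D'_bound k False in \<open>auto simp: less_imp_le\<close>)
    then show ?thesis unfolding rk \<beta> .
  qed
qed

private lemma expansion_remainder:
  assumes "l \<le> n"
  shows "(\<Prod>j\<in>I. 1 + r j) - (\<Sum>k\<le>l. kerstan_term I r k) = (\<Sum>k = Suc l..n. kerstan_term I r k)"
proof -
  have "(\<Prod>j\<in>I. 1 + r j) = (\<Sum>k\<le>n. kerstan_term I r k)"
    using kerstan_expansion[of I r] by (simp add: kerstan_term_def)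
  also have "\<dots> = (\<Sum>k\<le>l. kerstan_term I r k) + (\<Sum>k = Suc l..n. kerstan_term I r k)"
    using sum_up_index_split[of "kerstan_term I r" l "n - l"] assms by simp
  finally show ?thesis by simp
qed

private lemma remainder_le_\<alpha>:
  assumes l: "l \<le> n" and \<alpha>: "\<alpha> < 1 / 2 powr (3/2)"
  shows "norm ((\<Prod>j\<in>I. 1 + r j) - (\<Sum>k\<le>l. kerstan_term I r k)) \<le>
    sqrt (fact (2 * (l + 1))) / fact (l + 1) * 2 powr (real (l + 1) / 2) * (\<alpha> ^ (l + 1) / (1 - 2 powr (3/2) * \<alpha>))"
proof -
  have "norm (\<Sum>k = Suc l..n. kerstan_term I r k) \<le> (\<Sum>k = Suc l..n. sqrt (fact (2 * k)) / fact k * (sqrt 2 * \<alpha>) ^ k)"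
    by (rule sum_norm_le) (rule kerstan_term_le_\<alpha>(1))
  also have "\<dots> \<le> sqrt (fact (2 * Suc l)) / fact (Suc l) * (sqrt 2 * \<alpha>) ^ Suc l / (1 - 2 * (sqrt 2 * \<alpha>))"
    using kerstan_term_le_\<alpha>(2) \<alpha> by (intro sum_sqrt_fact_le) (auto simp: powr_3_2 field_simps)
  also have "(sqrt 2 * \<alpha>) ^ Suc l = 2 powr (real (l + 1) / 2) * \<alpha> ^ (l + 1)"
  proof -
    have "2 powr (real (l + 1) / 2) = (2 powr (1/2)) powr real (l + 1)" by (simp only: powr_powr) simp
    also have "\<dots> = sqrt 2 ^ (l + 1)" by (subst powr_realpow) (simp_all add: powr_half_sqrt)
    finally show ?thesis by (simp add: power_mult_distrib)
  qed
  finally show ?thesis unfolding expansion_remainder[OF l] powr_3_2 by (simp add: mult.assoc)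
qed

text \<open>For large \<open>\<beta>\<close> the remainder is estimated as product minus head: the
  product and the Poisson term \<open>kerstan_term I r 0\<close> have norm at most 1 each, which is
  the 2 in \<open>h2\<close>, and the other head terms supply its sum.\<close>

private lemma remainder_le_\<beta>:
  assumes l: "l \<le> n"
  shows "norm ((\<Prod>j\<in>I. 1 + r j) - (\<Sum>k\<le>l. kerstan_term I r k)) \<le> c_const l * \<beta> ^ (l + 1)"
proof (cases "\<beta> \<le> x_sol l")
  case True
  have "norm (\<Sum>k = Suc l..n. kerstan_term I r k) \<le> (\<Sum>k = Suc l..n. D' k * \<beta> ^ k)"
    by (rule sum_norm_le) (use kerstan_term_le_\<beta>(1) in auto)
  also have "\<dots> \<le> c_const l * \<beta> ^ (l + 1)"
    by (rule c_const_bound(1)[OF kerstan_term_le_\<beta>(2) True])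
  finally show ?thesis by (simp only: expansion_remainder[OF l])
next
  case False
  have "norm (1 + r j) \<le> 1" if j: "j \<in> I" for j
  proof -
    have "1 + r j = (1 - p j) *\<^sub>R 1 + p j *\<^sub>R embed (Q j)" by (simp add: r_def algebra_simps)
    also have "norm \<dots> \<le> norm ((1 - p j) *\<^sub>R (1 :: 'a smeasure)) + norm (p j *\<^sub>R embed (Q j))"
      by (rule norm_triangle_ineq)
    also have "\<dots> \<le> (1 - p j) + p j * 1"
      using p[OF j] norm_embed_Q[OF j] by (intro add_mono) (auto intro: mult_left_mono)
    finally show ?thesis by simp
  qed
  then have 1: "norm (\<Prod>j\<in>I. 1 + r j) \<le> 1" by (rule norm_prod_le_1)
  have "kerstan_term I r 0 = exp (lam *\<^sub>R (embed Qbar - 1))"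
  proof -
    have "{J. J \<subseteq> I \<and> card J = 0} = {{}}" by (auto dest: finite_subset)
    then show ?thesis unfolding kerstan_term_def sum_r by simp
  qed
  moreover have "norm (embed Qbar) \<le> 1"
    using norm_embed[OF finite_measure_prob_space[OF prob_Qbar] sets_Qbar] prob_space.prob_le_1[OF prob_Qbar, of UNIV] by simp
  ultimately have 0: "norm (kerstan_term I r 0) \<le> 1"
    using norm_exp_contraction[of "embed Qbar" lam] lam_pos by simp
  have "(\<Sum>k\<le>l. kerstan_term I r k) = kerstan_term I r 0 + (\<Sum>k = 1..l. kerstan_term I r k)"
    by (simp add: atMost_atLeast0 sum.atLeast_Suc_atMost)
  then have "norm (\<Sum>k\<le>l. kerstan_term I r k) \<le> 1 + (\<Sum>k = 1..l. D' k * \<beta> ^ k)"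
  proof -
    have "norm (\<Sum>k = 1..l. kerstan_term I r k) \<le> (\<Sum>k = 1..l. D' k * \<beta> ^ k)"
      by (rule sum_norm_le) (rule kerstan_term_le_\<beta>(1), simp)
    from norm_triangle_mono[OF 0 this] show ?thesis
      unfolding \<open>(\<Sum>k\<le>l. kerstan_term I r k) = _\<close> .
  qed
  with 1 have "norm ((\<Prod>j\<in>I. 1 + r j) - (\<Sum>k\<le>l. kerstan_term I r k)) \<le> h2 l \<beta>"
    using norm_triangle_ineq4[of "\<Prod>j\<in>I. 1 + r j" "\<Sum>k\<le>l. kerstan_term I r k"] by (simp add: h2_def)
  also have "\<dots> \<le> c_const l * \<beta> ^ (l + 1)"
    using False by (intro c_const_bound(2) kerstan_term_le_\<beta>(2)) simp
  finally show ?thesis .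
qed

private lemma Rep_r: "j \<in> I \<Longrightarrow> Rep_smeasure (r j) M = (\<lambda>A. p j * (measure (Q j) A - dirac M 0 A))"
  by (rule ext) (simp add: r_def scaleR_smeasure.rep_eq minus_smeasure.rep_eq Rep_one Rep_embed_M fQ)

text \<open>Each set function of the statement is recognised as the component at \<open>M\<close> of
  an element of the algebra. The total variation at \<open>M\<close> is at most the norm of that
  element, so the algebraic remainder bounds carry over.\<close>

private lemma tv_norm_bounds_aux:
  fixes R Fj V Mk H :: "nat \<Rightarrow> 'a set \<Rightarrow> real" and F G :: "'a set \<Rightarrow> real"
  assumes l: "l \<le> n"
    and R_def: "\<And>j. j \<in> {1..n} \<Longrightarrow> R j = (\<lambda>A. p j * (measure (Q j) A - dirac M 0 A))"
    and Fj_def: "\<And>j. j \<in> {1..n} \<Longrightarrow> Fj j = (\<lambda>A. dirac M 0 A + R j A)"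
    and V_def: "\<And>j. j \<in> {1..n} \<Longrightarrow>
          V j = (\<lambda>A. conv M (Fj j) (conv_exp M (\<lambda>B. - R j B)) A - dirac M 0 A)"
    and F_def: "F = conv_prod M Fj {1..n}"
    and Mk_def: "\<And>k. k \<in> {0..n} \<Longrightarrow>
          Mk k = (\<lambda>A. \<Sum>J | J \<subseteq> {1..n} \<and> card J = k. conv_prod M V J A)"
    and H_def: "\<And>k. k \<in> {0..n} \<Longrightarrow>
          H k = conv M (Mk k) (conv_exp M (\<lambda>A. lam * (measure Qbar A - dirac M 0 A)))"
    and G_def: "G = (\<lambda>A. \<Sum>k = 0..l. H k A)"
  shows "(\<alpha> < 1 / 2 powr (3/2) \<longrightarrow>
            tv_norm M (\<lambda>A. F A - G A) \<le>
              sqrt (fact (2 * (l + 1))) / fact (l + 1) * 2 powr (real (l + 1) / 2) *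
              (\<alpha> ^ (l + 1) / (1 - 2 powr (3/2) * \<alpha>))) \<and>
         tv_norm M (\<lambda>A. F A - G A) \<le> c_const l * \<beta> ^ (l + 1)"
proof -
  have R: "R j = Rep_smeasure (r j) M" if "j \<in> I" for j
    by (simp add: R_def[OF that] Rep_r[OF that])
  have F': "Fj j = Rep_smeasure (1 + r j) M" if "j \<in> I" for j
    by (rule ext) (simp add: Fj_def[OF that] R[OF that] plus_smeasure.rep_eq Rep_one)
  have V: "V j = Rep_smeasure ((1 + r j) * exp (- r j) - 1) M" if j: "j \<in> I" for j
  proof -
    have "(\<lambda>B. - R j B) = Rep_smeasure (- r j) M" by (rule ext) (simp add: R[OF j] uminus_smeasure.rep_eq)
    then show ?thesis
      unfolding V_def[OF j] F'[OF j]
      by (intro ext) (simp add: minus_smeasure.rep_eq Rep_one Rep_mult Rep_exp)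
  qed
  have F: "F = Rep_smeasure (\<Prod>j\<in>I. 1 + r j) M"
    unfolding F_def by (rule conv_prod_Rep) (simp_all only: finite_atLeastAtMost F')
  have Mk: "Mk k = Rep_smeasure (\<Sum>J | J \<subseteq> I \<and> card J = k. \<Prod>j\<in>J. (1 + r j) * exp (- r j) - 1) M"
    if "k \<in> {0..n}" for k
  proof (rule ext)
    fix A
    have "conv_prod M V J A = Rep_smeasure (\<Prod>j\<in>J. (1 + r j) * exp (- r j) - 1) M A" if "J \<subseteq> I" for J
      using that V finite_subset[OF that] by (subst conv_prod_Rep) auto
    then show "Mk k A = Rep_smeasure (\<Sum>J | J \<subseteq> I \<and> card J = k. \<Prod>j\<in>J. (1 + r j) * exp (- r j) - 1) M A"
      unfolding Mk_def[OF that] Rep_sum by (intro sum.cong refl) auto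
  qed
  have "(\<lambda>A. lam * (measure Qbar A - dirac M 0 A)) = Rep_smeasure (\<Sum>j\<in>I. r j) M"
    unfolding sum_r
    by (rule ext) (simp add: scaleR_smeasure.rep_eq minus_smeasure.rep_eq Rep_one
        Rep_embed_M finite_measure_prob_space prob_Qbar sets_Qbar)
  then have H: "H k = Rep_smeasure (kerstan_term I r k) M" if "k \<in> {0..n}" for k
    unfolding H_def[OF that] Mk[OF that] kerstan_term_def by (simp only: Rep_mult Rep_exp)
  have "G A = Rep_smeasure (\<Sum>k\<le>l. kerstan_term I r k) M A" for A
    unfolding G_def Rep_sum atMost_atLeast0 using l H by (intro sum.cong refl) auto
  then have "(\<lambda>A. F A - G A) = Rep_smeasure ((\<Prod>j\<in>I. 1 + r j) - (\<Sum>k\<le>l. kerstan_term I r k)) M"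
    by (intro ext) (simp add: F minus_smeasure.rep_eq)
  then have "tv_norm M (\<lambda>A. F A - G A) \<le> norm ((\<Prod>j\<in>I. 1 + r j) - (\<Sum>k\<le>l. kerstan_term I r k))"
    using tv_norm_le_norm[OF measurable_abelian_semigroup_axioms] by simp
  then show ?thesis
    using remainder_le_\<alpha>[OF l] remainder_le_\<beta>[OF l] order_trans by blast
qed

lemmas tv_norm_bounds = tv_norm_bounds_aux[unfolded \<alpha>_def \<beta>_def]

end

theorem corollary2p7:
  fixes M :: "'a::comm_monoid_add measure"
    and n l :: nat
    and p :: "nat \<Rightarrow> real"
    and Q :: "nat \<Rightarrow> 'a measure"
    and f :: "nat \<Rightarrow> 'a \<Rightarrow> real"
    and R Fj V Mk H :: "nat \<Rightarrow> 'a set \<Rightarrow> real"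
    and F G :: "'a set \<Rightarrow> real"
    and Qbar :: "'a measure"
    and lam \<alpha>1 \<beta>1 :: real
  assumes "measurable_abelian_semigroup M"
    and "1 \<le> n" and "l \<le> n"
    and "\<And>j. j \<in> {1..n} \<Longrightarrow> 0 < p j \<and> p j \<le> 1"
    and "\<And>j. j \<in> {1..n} \<Longrightarrow> prob_space (Q j) \<and> sets (Q j) = sets M"
    and R_def: "\<And>j. j \<in> {1..n} \<Longrightarrow> R j = (\<lambda>A. p j * (measure (Q j) A - dirac M 0 A))"
    and Fj_def: "\<And>j. j \<in> {1..n} \<Longrightarrow> Fj j = (\<lambda>A. dirac M 0 A + R j A)"
    and V_def: "\<And>j. j \<in> {1..n} \<Longrightarrow>
          V j = (\<lambda>A. conv M (Fj j) (conv_exp M (\<lambda>B. - R j B)) A - dirac M 0 A)"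
    and lam_def: "lam = (\<Sum>j = 1..n. p j)"
    and F_def: "F = conv_prod M Fj {1..n}"
    and Qbar_def: "Qbar = mixture M {1..n} p Q"
    and f_density: "\<And>j. j \<in> {1..n} \<Longrightarrow> f j \<in> borel_measurable Qbar \<and>
          (AE x in Qbar. 0 \<le> f j x) \<and> Q j = density Qbar (\<lambda>x. ennreal (f j x))"
    and Mk_def: "\<And>k. k \<in> {0..n} \<Longrightarrow>
          Mk k = (\<lambda>A. \<Sum>J | J \<subseteq> {1..n} \<and> card J = k. conv_prod M V J A)"
    and H_def: "\<And>k. k \<in> {0..n} \<Longrightarrow>
          H k = conv M (Mk k) (conv_exp M (\<lambda>A. lam * (measure Qbar A - dirac M 0 A)))"
    and G_def: "G = (\<lambda>A. \<Sum>k = 0..l. H k A)"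
    and \<alpha>1_def: "\<alpha>1 = (\<Sum>j = 1..n. g (2 * p j) * (p j)\<^sup>2 *
          (\<integral>x. f j x * min (f j x / (2 powr (3/2) * lam)) 2 \<partial>Qbar))"
    and \<beta>1_def: "\<beta>1 = (\<Sum>j = 1..n. (p j)\<^sup>2 *
          (\<integral>x. f j x * min (f j x / lam) 1 \<partial>Qbar))"
  shows "(\<alpha>1 < 1 / 2 powr (3/2) \<longrightarrow>
            tv_norm M (\<lambda>A. F A - G A) \<le>
              sqrt (fact (2 * (l + 1))) / fact (l + 1) * 2 powr (real (l + 1) / 2) *
              (\<alpha>1 ^ (l + 1) / (1 - 2 powr (3/2) * \<alpha>1))) \<and>
         tv_norm M (\<lambda>A. F A - G A) \<le> c_const l * \<beta>1 ^ (l + 1)"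
  unfolding \<alpha>1_def \<beta>1_def
  by (rule tv_norm_bounds[OF assms(1,2,4,5) lam_def Qbar_def f_density assms(3) R_def Fj_def V_def F_def Mk_def H_def G_def])

end
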